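(* Fix constants $\gamma > 0$ and $\beta > -1$, let $N = \lceil n/\gamma \rceil$, and for a normalized spike prior $\mathcal{X}$ let $L_n = \frac{d\mathbb{P}_n}{d\mathbb{Q}_n}$ be the likelihood ratio of the spiked Wishart model $\mathsf{Wishart}(n,\gamma,\beta,\mathcal{X})$ (defined in the context). \begin{enumerate} \item Suppose $\beta^2 < \gamma$. Let $\mathcal{X} = \mathrm{trunc}_\beta(\mathsf{iid}(\pi/\sqrt{n}))$, where $\pi$ is a subgaussian distribution on $\mathbb{R}$ with $\mathbb{E}[\pi]=0$ and $\mathbb{E}[\pi^2]=1$. Then for any $D = D(n) = o(n/\log n)$, we have $\|L_n^{\le D}\|_{L^2(\mathbb{Q}_n)} = O(1)$ as $n \to \infty$. \item Suppose $\beta^2 > \gamma$. Let $\mathcal{X} = \mathsf{iid}(\pi/\sqrt{n})$ be $\beta$-good, where $\pi$ is symmetric about zero with $\mathbb{E}[\pi]=0$ and $\mathbb{E}[\pi^2]=1$. Then for any $D = D(n) = \omega(1)$, we have $\|L_n^{\le D}\|_{L^2(\mathbb{Q}_n)} = \omega(1)$ as $n\to\infty$. \end{enumerate}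
   Context: Asymptotic notation refers to $n\to\infty$ with $\gamma,\beta,\pi$ fixed. A real random variable $\pi$ with $\mathbb{E}[\pi]=0$ is subgaussian if there is $\sigma^2$ with $\mathbb{E}[e^{t\pi}] \le e^{\sigma^2t^2/2}$ for all $t\in\mathbb{R}$. A normalized spike prior is a sequence $\mathcal{X}=(\mathcal{X}_n)$ of probability distributions on $\mathbb{R}^n$ such that $\|\bm x\|\to 1$ in probability when $\bm x\sim\mathcal{X}_n$. $\mathcal{X}$ is $\beta$-good if $\beta\|\bm x\|^2 > -1$ almost surely for $\bm x\sim\mathcal{X}_n$, for every $n$. For a distribution $\pi$ on $\mathbb{R}$ (not depending on $n$) with mean $0$ and variance $1$, $\mathsf{iid}(\pi/\sqrt n)$ is the prior under which the entries of $\bm x\in\mathbb{R}^n$ are i.i.d.\ copies of $\pi/\sqrt n$. For a normalized spike prior $\mathcal{X}$, $\mathrm{trunc}_\beta(\mathcal{X})$ samples $\bm x'\sim\mathcal{X}_n$ and outputs $\bm x=\bm x'$ if $\beta\|\bm x'\|^2>-1$ and $\|\bm x'\|^2\le 2$, and $\bm x=\bm 0$ otherwise. Spiked Wishart model $\mathsf{Wishart}(n,\gamma,\beta,\mathcal{X})$, with $N=\lceil n/\gamma\rceil$: under the null $\mathbb{Q}_n$, $\bm y_1,\dots,\bm y_N \sim \mathcal{N}(\bm 0,\bm I_n)$ i.i.d.; under the planted $\mathbb{P}_n$, draw $\bm x\sim\mathcal{X}_n$, and if $\beta\|\bm x\|^2\ge -1$ draw $\bm y_1,\dots,\bm y_N\sim\mathcal{N}(\bm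 0,\bm I_n+\beta\bm x\bm x^\top)$ i.i.d., otherwise draw them i.i.d.\ $\mathcal{N}(\bm 0,\bm I_n)$. For $D\in\mathbb{N}$, $L_n^{\le D}$ denotes the orthogonal projection of $L_n$, in the Hilbert space $L^2(\mathbb{Q}_n)$ with inner product $\langle f,g\rangle = \mathbb{E}_{\mathbb{Q}_n}[fg]$, onto the subspace of polynomials of degree at most $D$ in the $nN$ coordinates of $(\bm y_1,\dots,\bm y_N)$; $\|\cdot\|_{L^2(\mathbb{Q}_n)}$ is the corresponding norm. *)

theory Defs
  imports "HOL-Probability.Probability" "HOL-Library.Landau_Symbols"
begin

text \<open>
  Since the dimension \<open>n\<close> tends to infinity, \<open>\<real>\<^sup>n\<close> is the product space over the index set
  \<open>{..<n}\<close> (functions \<open>nat \<Rightarrow> real\<close>, extensional outside the index set).  A prior is a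
  sequence of measures, the \<open>n\<close>-th one living on \<open>\<real>\<^sup>n\<close>.
\<close>

abbreviation Rn :: "nat \<Rightarrow> (nat \<Rightarrow> real) measure" where
  "Rn n \<equiv> Pi\<^sub>M {..<n} (\<lambda>_. borel)"

definition sqnorm :: "nat \<Rightarrow> (nat \<Rightarrow> real) \<Rightarrow> real" where
  "sqnorm n x = (\<Sum>i<n. (x i)\<^sup>2)"

definition standardized :: "real measure \<Rightarrow> bool" where
  "standardized \<pi> \<longleftrightarrow> real_distribution \<pi> \<and>
     has_bochner_integral \<pi> (\<lambda>x. x) 0 \<and> has_bochner_integral \<pi> (\<lambda>x. x\<^sup>2) 1"

definition subgaussian :: "real measure \<Rightarrow> bool" where
  "subgaussian \<pi> \<longleftrightarrow> real_distribution \<pi> \<and> has_bochner_integral \<pi> (\<lambda>x. x) 0 \<and>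
     (\<exists>\<sigma>::real. \<forall>t::real. integrable \<pi> (\<lambda>x. exp (t * x)) \<and>
        (\<integral>x. exp (t * x) \<partial>\<pi>) \<le> exp (\<sigma>\<^sup>2 * t\<^sup>2 / 2))"

definition symmetric_about_zero :: "real measure \<Rightarrow> bool" where
  "symmetric_about_zero \<pi> \<longleftrightarrow> distr \<pi> borel uminus = \<pi>"

definition iid_prior :: "real measure \<Rightarrow> nat \<Rightarrow> (nat \<Rightarrow> real) measure" where
  "iid_prior \<pi> n = Pi\<^sub>M {..<n} (\<lambda>_. distr \<pi> borel (\<lambda>t. t / sqrt (real n)))"

definition beta_good :: "real \<Rightarrow> (nat \<Rightarrow> (nat \<Rightarrow> real) measure) \<Rightarrow> bool" where
  "beta_good \<beta> X \<longleftrightarrow> (\<forall>n. AE x in X n. \<beta> * sqnorm n x > -1)"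

definition trunc_prior ::
  "real \<Rightarrow> (nat \<Rightarrow> (nat \<Rightarrow> real) measure) \<Rightarrow> nat \<Rightarrow> (nat \<Rightarrow> real) measure" where
  "trunc_prior \<beta> X n = distr (X n) (Rn n)
     (\<lambda>x. if \<beta> * sqnorm n x > -1 \<and> sqnorm n x \<le> 2 then x else (\<lambda>i\<in>{..<n}. 0))"

definition std_gaussian :: "nat \<Rightarrow> (nat \<Rightarrow> real) measure" where
  "std_gaussian n = Pi\<^sub>M {..<n} (\<lambda>_. std_normal_distribution)"

text \<open>
  An \<open>n \<times> n\<close> matrix is a function \<open>nat \<Rightarrow> nat \<Rightarrow> real\<close> of which only the entries with indices
  below \<open>n\<close> matter.  For positive semidefinite \<open>S\<close> the symmetric positive semidefinite square
  root has uniquely determined entries in that range.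
\<close>

definition is_psd_sqrt :: "nat \<Rightarrow> (nat \<Rightarrow> nat \<Rightarrow> real) \<Rightarrow> (nat \<Rightarrow> nat \<Rightarrow> real) \<Rightarrow> bool" where
  "is_psd_sqrt n S A \<longleftrightarrow>
     (\<forall>i<n. \<forall>j<n. A i j = A j i) \<and>
     (\<forall>v. (\<Sum>i<n. \<Sum>j<n. v i * A i j * v j) \<ge> 0) \<and>
     (\<forall>i<n. \<forall>j<n. (\<Sum>k<n. A i k * A k j) = S i j)"

definition psd_sqrt :: "nat \<Rightarrow> (nat \<Rightarrow> nat \<Rightarrow> real) \<Rightarrow> nat \<Rightarrow> nat \<Rightarrow> real" where
  "psd_sqrt n S = (SOME A. is_psd_sqrt n S A)"

text \<open>
  \<open>N(0, S)\<close>, possibly degenerate, as the law of \<open>S\<^bsup>1/2\<^esup> g\<close> with \<open>g\<close> standard Gaussian;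
  meaningful only for positive semidefinite \<open>S\<close>.
\<close>

definition gaussian :: "nat \<Rightarrow> (nat \<Rightarrow> nat \<Rightarrow> real) \<Rightarrow> (nat \<Rightarrow> real) measure" where
  "gaussian n S = distr (std_gaussian n) (Rn n)
     (\<lambda>g. \<lambda>i\<in>{..<n}. \<Sum>j<n. psd_sqrt n S i j * g j)"

definition num_samples :: "real \<Rightarrow> nat \<Rightarrow> nat" where
  "num_samples \<gamma> n = nat \<lceil>real n / \<gamma>\<rceil>"

text \<open>A data point \<open>y\<close> has \<open>y i j\<close> as the \<open>j\<close>-th coordinate of the \<open>i\<close>-th sample.\<close>

definition wishart_null :: "real \<Rightarrow> nat \<Rightarrow> (nat \<Rightarrow> nat \<Rightarrow> real) measure" where
  "wishart_null \<gamma> n = Pi\<^sub>M {..<num_samples \<gamma> n} (\<lambda>_. std_gaussian n)"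

definition spiked_cov :: "real \<Rightarrow> (nat \<Rightarrow> real) \<Rightarrow> nat \<Rightarrow> nat \<Rightarrow> real" where
  "spiked_cov \<beta> x i j = (if i = j then 1 else 0) + \<beta> * x i * x j"

definition wishart_planted ::
  "real \<Rightarrow> real \<Rightarrow> (nat \<Rightarrow> (nat \<Rightarrow> real) measure) \<Rightarrow> nat \<Rightarrow> (nat \<Rightarrow> nat \<Rightarrow> real) measure" where
  "wishart_planted \<gamma> \<beta> X n = X n \<bind> (\<lambda>x.
     if \<beta> * sqnorm n x \<ge> -1
     then Pi\<^sub>M {..<num_samples \<gamma> n} (\<lambda>_. gaussian n (spiked_cov \<beta> x))
     else wishart_null \<gamma> n)"

definition likelihood_ratio ::
  "real \<Rightarrow> real \<Rightarrow> (nat \<Rightarrow> (nat \<Rightarrow> real) measure) \<Rightarrow> nat \<Rightarrow> (nat \<Rightarrow> nat \<Rightarrow> real) \<Rightarrow> real" where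
  "likelihood_ratio \<gamma> \<beta> X n y =
     enn2real (RN_deriv (wishart_null \<gamma> n) (wishart_planted \<gamma> \<beta> X n) y)"

definition polys_upto :: "nat \<Rightarrow> nat \<Rightarrow> nat \<Rightarrow> ((nat \<Rightarrow> nat \<Rightarrow> real) \<Rightarrow> real) set" where
  "polys_upto N n D = {p. \<exists>(A :: (nat \<Rightarrow> nat \<Rightarrow> nat) set) (c :: (nat \<Rightarrow> nat \<Rightarrow> nat) \<Rightarrow> real).
     finite A \<and> (\<forall>\<alpha>\<in>A. (\<Sum>i<N. \<Sum>j<n. \<alpha> i j) \<le> D) \<and>
     p = (\<lambda>y. \<Sum>\<alpha>\<in>A. c \<alpha> * (\<Prod>i<N. \<Prod>j<n. y i j ^ \<alpha> i j))}"

text \<open>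
  \<open>p\<close> is the orthogonal projection of \<open>L\<close> onto the subspace \<open>V\<close>.  Only integrability of
  \<open>(L - p) q\<close> for \<open>q \<in> V\<close> is required, not square integrability of \<open>L\<close>: likelihood ratios
  of the spiked Wishart model need not be in \<open>L\<^sup>2\<close> of the null distribution.
\<close>

definition is_orth_proj :: "'a measure \<Rightarrow> ('a \<Rightarrow> real) set \<Rightarrow> ('a \<Rightarrow> real) \<Rightarrow> ('a \<Rightarrow> real) \<Rightarrow> bool" where
  "is_orth_proj Q V L p \<longleftrightarrow>
     p \<in> V \<and> (\<forall>q\<in>V. has_bochner_integral Q (\<lambda>y. (L y - p y) * q y) 0)"

definition L2_norm :: "'a measure \<Rightarrow> ('a \<Rightarrow> real) \<Rightarrow> real" where
  "L2_norm Q f = sqrt (\<integral>y. (f y)\<^sup>2 \<partial>Q)"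

text \<open>
  The norm of the projection.  It is infinite if there is no projection, which happens only if
  some polynomial in \<open>V\<close> has no finite expectation under the planted distribution.
\<close>

definition proj_norm :: "'a measure \<Rightarrow> ('a \<Rightarrow> real) set \<Rightarrow> ('a \<Rightarrow> real) \<Rightarrow> ennreal" where
  "proj_norm Q V L =
     (if \<exists>p. is_orth_proj Q V L p then ennreal (L2_norm Q (SOME p. is_orth_proj Q V L p)) else \<infinity>)"

definition low_degree_norm ::
  "real \<Rightarrow> real \<Rightarrow> (nat \<Rightarrow> (nat \<Rightarrow> real) measure) \<Rightarrow> nat \<Rightarrow> nat \<Rightarrow> ennreal" where
  "low_degree_norm \<gamma> \<beta> X D n =
     proj_norm (wishart_null \<gamma> n) (polys_upto (num_samples \<gamma> n) n D) (likelihood_ratio \<gamma> \<beta> X n)"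

end

theory Submission
  imports Defs "HOL-Computational_Algebra.Polynomial"
begin

text \<open>
  Given \<open>x\<close>, a sample is \<open>g + c (x \<bullet> g) x\<close> with \<open>g\<close> standard Gaussian and
  \<open>c = \<beta> / (1 + sqrt (1 + \<beta> |x|\<^sup>2))\<close>; Gaussian integration by parts shows that the
  Hermite moment of order \<open>a\<close> of such a sample vanishes for odd \<open>|a|\<close> and is
  \<open>\<beta>\<^bsup>|a|/2\<^esup> (|a| - 1)!! x\<^sup>a\<close> for even \<open>|a|\<close>.  Expanding the projection in Hermite polynomials and
  summing with the multinomial theorem and the Chu-Vandermonde identity, its squared norm is
  \<open>\<Sum>\<^sub>k \<beta>\<^bsup>2k\<^esup> (N/2)\<^sub>k / k! E[R\<^bsup>2k\<^esup>]\<close>, where \<open>2 k \<le> D\<close>, \<open>(a)\<^sub>k\<close> is the rising factorial, and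
  \<open>R = x \<bullet> x'\<close> is the overlap of two independent draws from the prior.

  For \<open>\<beta>\<^sup>2 < \<gamma>\<close>, a Chernoff bound controls \<open>E[R\<^bsup>2k\<^esup>]\<close>, since the product of two independent
  copies of \<open>\<pi>\<close> has moment generating function at most \<open>exp ((1 + \<delta>) t\<^sup>2 / 2)\<close> near 0.  Taking
  \<open>t\<^sup>2 = 2k / n\<close> bounds the \<open>k\<close>-th term by \<open>2 \<rho>\<^sup>k\<close> with \<open>\<rho> < 1\<close>, as long as \<open>k\<close> is at most a small
  multiple of \<open>n\<close>.

  For \<open>\<beta>\<^sup>2 > \<gamma>\<close>, one fixed \<open>k\<close> suffices: keeping only the monomials of \<open>x\<close> with exponents 0 and 2,
  the \<open>k\<close>-th term is bounded below by a sequence that converges to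
  \<open>(\<beta>\<^sup>2 / \<gamma>)\<^sup>k binom(2k,k) / 4\<^sup>k\<close>, which is unbounded in \<open>k\<close>.
\<close>

section \<open>Random variables with moments of all orders\<close>

definition all_moments :: "'a measure \<Rightarrow> ('a \<Rightarrow> real) \<Rightarrow> bool" where
  "all_moments M f \<longleftrightarrow> f \<in> borel_measurable M \<and> (\<forall>p::nat. integrable M (\<lambda>x. \<bar>f x\<bar> ^ p))"

lemma all_moments_measurable: "all_moments M f \<Longrightarrow> f \<in> borel_measurable M"
  by (simp add: all_moments_def)

lemma all_moments_integrable:
  assumes "all_moments M f" shows "integrable M f"
proof -
  have "integrable M (\<lambda>x. \<bar>f x\<bar> ^ 1)" using assms unfolding all_moments_def by blast
  hence "integrable M (\<lambda>x. \<bar>f x\<bar>)" by (simp only: power_one_right)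
  thus ?thesis by (rule integrable_abs_cancel) (rule all_moments_measurable[OF assms])
qed

lemma all_moments_bounded:
  assumes "finite_measure M" "f \<in> borel_measurable M" "AE x in M. \<bar>f x\<bar> \<le> B"
  shows "all_moments M f"
proof -
  interpret finite_measure M by fact
  have "integrable M (\<lambda>x. \<bar>f x\<bar> ^ p)" for p
  proof (rule integrable_const_bound[where B="\<bar>B\<bar>^p"])
    show "AE x in M. norm (\<bar>f x\<bar> ^ p) \<le> \<bar>B\<bar> ^ p"
      using assms(3) by eventually_elim (auto intro!: power_mono)
    show "(\<lambda>x. \<bar>f x\<bar> ^ p) \<in> borel_measurable M" using assms(2) by measurable
  qed
  thus ?thesis using assms by (simp add: all_moments_def)
qed

lemma all_moments_const: "finite_measure M \<Longrightarrow> all_moments M (\<lambda>_. c)"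
  by (rule all_moments_bounded[where B="\<bar>c\<bar>"]) auto

lemma power_add_le_two_power:
  fixes a b :: real assumes "a \<ge> 0" "b \<ge> 0"
  shows "(a + b) ^ p \<le> 2 ^ p * (a ^ p + b ^ p)"
proof -
  have "(a + b) ^ p \<le> (2 * max a b) ^ p" using assms by (intro power_mono) auto
  also have "\<dots> = 2 ^ p * max a b ^ p" by (simp add: power_mult_distrib)
  also have "max a b ^ p \<le> a ^ p + b ^ p" using assms by (auto simp: max_def)
  finally show ?thesis by simp
qed

lemma all_moments_add:
  assumes "all_moments M f" "all_moments M g"
  shows "all_moments M (\<lambda>x. f x + g x)"
proof -
  have [measurable]: "f \<in> borel_measurable M" "g \<in> borel_measurable M"
    using assms by (auto simp: all_moments_def)
  have "integrable M (\<lambda>x. \<bar>f x + g x\<bar> ^ p)" for p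
  proof (rule Bochner_Integration.integrable_bound)
    show "integrable M (\<lambda>x. 2 ^ p * (\<bar>f x\<bar> ^ p + \<bar>g x\<bar> ^ p))"
      using assms by (simp add: all_moments_def)
    have "\<bar>f x + g x\<bar> ^ p \<le> 2 ^ p * (\<bar>f x\<bar> ^ p + \<bar>g x\<bar> ^ p)" for x
      by (rule order_trans[OF power_mono power_add_le_two_power]) auto
    thus "AE x in M. norm (\<bar>f x + g x\<bar> ^ p) \<le> norm (2 ^ p * (\<bar>f x\<bar> ^ p + \<bar>g x\<bar> ^ p))"
      by (intro AE_I2) (auto intro: order_trans)
  qed measurable
  thus ?thesis by (simp add: all_moments_def)
qed

lemma all_moments_mult:
  assumes "all_moments M f" "all_moments M g"
  shows "all_moments M (\<lambda>x. f x * g x)"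
proof -
  have [measurable]: "f \<in> borel_measurable M" "g \<in> borel_measurable M"
    using assms by (auto simp: all_moments_def)
  have "integrable M (\<lambda>x. \<bar>f x * g x\<bar> ^ p)" for p
  proof (rule Bochner_Integration.integrable_bound)
    show "integrable M (\<lambda>x. (\<bar>f x\<bar> ^ (2 * p) + \<bar>g x\<bar> ^ (2 * p)) / 2)"
      using assms by (simp add: all_moments_def)
    have "\<bar>f x * g x\<bar> ^ p \<le> (\<bar>f x\<bar> ^ (2 * p) + \<bar>g x\<bar> ^ (2 * p)) / 2" for x
      using sum_squares_bound[of "\<bar>f x\<bar> ^ p" "\<bar>g x\<bar> ^ p"]
      by (simp add: abs_mult power_mult_distrib mult.commute[of 2] power_mult)
    thus "AE x in M. norm (\<bar>f x * g x\<bar> ^ p) \<le> norm ((\<bar>f x\<bar> ^ (2 * p) + \<bar>g x\<bar> ^ (2 * p)) / 2)"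
      by (intro AE_I2) (auto intro: order_trans)
  qed measurable
  thus ?thesis by (simp add: all_moments_def)
qed

lemma all_moments_sum:
  assumes "finite_measure M" "\<And>i. i \<in> I \<Longrightarrow> all_moments M (f i)"
  shows "all_moments M (\<lambda>x. \<Sum>i\<in>I. f i x)"
  using assms(2)
  by (induction I rule: infinite_finite_induct)
     (auto intro: all_moments_const all_moments_add assms(1))

lemma all_moments_prod:
  assumes "finite_measure M" "\<And>i. i \<in> I \<Longrightarrow> all_moments M (f i)"
  shows "all_moments M (\<lambda>x. \<Prod>i\<in>I. f i x)"
  using assms(2)
  by (induction I rule: infinite_finite_induct)
     (auto intro: all_moments_const all_moments_mult assms(1))

lemma all_moments_poly:
  assumes "finite_measure M" "all_moments M f"
  shows "all_moments M (\<lambda>x. poly p (f x))"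
  by (induction p) (auto intro!: all_moments_add all_moments_mult all_moments_const assms)

lemma all_moments_distr:
  assumes "T \<in> measurable M N" "all_moments (distr M N T) f"
  shows "all_moments M (\<lambda>x. f (T x))"
  using assms by (auto simp: all_moments_def integrable_distr_eq)

lemma all_moments_PiM_component:
  assumes "\<And>i. i \<in> I \<Longrightarrow> prob_space (M i)" "i \<in> I" "all_moments (M i) f"
  shows "all_moments (PiM I M) (\<lambda>x. f (x i))"
proof (rule all_moments_distr[where f=f])
  show "(\<lambda>x. x i) \<in> PiM I M \<rightarrow>\<^sub>M M i"
    using assms(2) by measurable
  show "all_moments (distr (PiM I M) (M i) (\<lambda>x. x i)) f"
    using assms by (simp add: distr_PiM_component)
qed

lemma pair_prob_spaceI: "prob_space M \<Longrightarrow> prob_space N \<Longrightarrow> pair_prob_space M N"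
  by (simp add: pair_prob_space_def pair_sigma_finite_def prob_space_imp_sigma_finite)

lemma (in pair_prob_space) distr_pair_snd: "distr (M1 \<Otimes>\<^sub>M M2) M2 snd = M2"
proof -
  have "distr (M1 \<Otimes>\<^sub>M M2) M2 snd = distr (M2 \<Otimes>\<^sub>M M1) M2 (snd \<circ> (\<lambda>(x, y). (y, x)))"
    by (subst distr_pair_swap) (simp add: distr_distr)
  also have "snd \<circ> (\<lambda>(x, y). (y, x)) = fst" by auto
  finally show ?thesis using M1.distr_pair_fst by simp
qed

lemma (in pair_prob_space) all_moments_fst:
  "all_moments M1 f \<Longrightarrow> all_moments (M1 \<Otimes>\<^sub>M M2) (\<lambda>z. f (fst z))"
  by (rule all_moments_distr[OF measurable_fst]) (simp add: M2.distr_pair_fst)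

lemma (in pair_prob_space) all_moments_snd:
  "all_moments M2 f \<Longrightarrow> all_moments (M1 \<Otimes>\<^sub>M M2) (\<lambda>z. f (snd z))"
  by (rule all_moments_distr[OF measurable_snd]) (simp add: distr_pair_snd)

section \<open>Hermite polynomials and Gaussian integration by parts\<close>

abbreviation gauss :: "real measure" where
  "gauss \<equiv> std_normal_distribution"

lemma prob_space_gauss: "prob_space gauss"
  using real_dist_normal_dist by (simp add: real_distribution_def)

lemma finite_measure_gauss: "finite_measure gauss"
  by (rule prob_space.finite_measure[OF prob_space_gauss])

lemma all_moments_gauss: "all_moments gauss (\<lambda>x. x)"
proof -
  have "integrable gauss (\<lambda>x. \<bar>x\<bar> ^ p)" for p
    using integrable_abs[OF integrable_std_normal_distribution_moment[of p]]
    by (simp add: power_abs)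
  thus ?thesis by (simp add: all_moments_def)
qed

lemma integrable_gauss_poly: "integrable gauss (poly p)"
  using all_moments_integrable[OF all_moments_poly[OF finite_measure_gauss all_moments_gauss]] .

lemma integrable_gauss_times_poly: "integrable gauss (\<lambda>x. x * poly p x)"
proof -
  have "poly (pCons 0 p) = (\<lambda>x. x * poly p x)" by auto
  thus ?thesis using integrable_gauss_poly[of "pCons 0 p"] by simp
qed

lemma gauss_stein_power:
  "(\<integral>x. x * x ^ m \<partial>gauss) = real m * (\<integral>x. x ^ (m - 1) \<partial>gauss)"
proof (cases "odd m")
  case True
  then obtain k where m_eq: "m = 2 * k + 1" by (auto elim: oddE)
  have "(\<integral>x. x * x ^ m \<partial>gauss) = (\<integral>x. x ^ (2 * (k + 1)) \<partial>gauss)"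
    by (simp add: m_eq)
  also have "\<dots> = fact (2 * (k + 1)) / (2^(k + 1) * fact (k + 1))"
    by (rule std_normal_distribution_even_moments)
  also have "\<dots> = real m * (fact (2 * k) / (2^k * fact k))"
    by (simp add: m_eq divide_simps)
  also have "fact (2 * k) / (2^k * fact k) = (\<integral>x. x ^ (m - 1) \<partial>gauss)"
    using std_normal_distribution_even_moments(1)[of k] by (simp add: m_eq)
  finally show ?thesis .
next
  case False
  have "(\<integral>x. x * x ^ m \<partial>gauss) = 0"
    using integral_std_normal_distribution_moment_odd[of "Suc m"] False by simp
  moreover have "real m * (\<integral>x. x ^ (m - 1) \<partial>gauss) = 0"
    using integral_std_normal_distribution_moment_odd[of "m - 1"] False by (cases m) auto
  ultimately show ?thesis by simp
qed

lemma gauss_stein_poly: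
  "(\<integral>x. x * poly p x \<partial>gauss) = (\<integral>x. poly (pderiv p) x \<partial>gauss)"
proof -
  have stein_monom: "(\<integral>x. x * poly (monom a m) x \<partial>gauss)
      = (\<integral>x. poly (pderiv (monom a m)) x \<partial>gauss)" for a m
    using gauss_stein_power[of m]
    by (simp add: poly_monom pderiv_monom mult.left_commute[of _ a])
  define q where "q i = monom (coeff p i) i" for i
  have p_eq_sum: "p = (\<Sum>i\<le>degree p. q i)"
    by (simp add: q_def poly_as_sum_of_monoms)
  have "(\<integral>x. x * poly p x \<partial>gauss) = (\<integral>x. (\<Sum>i\<le>degree p. x * poly (q i) x) \<partial>gauss)"
    by (subst (1) p_eq_sum) (simp add: poly_sum sum_distrib_left)
  also have "\<dots> = (\<Sum>i\<le>degree p. \<integral>x. x * poly (q i) x \<partial>gauss)"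
    by (intro Bochner_Integration.integral_sum integrable_gauss_times_poly)
  also have "\<dots> = (\<Sum>i\<le>degree p. \<integral>x. poly (pderiv (q i)) x \<partial>gauss)"
    by (simp only: q_def stein_monom)
  also have "\<dots> = (\<integral>x. (\<Sum>i\<le>degree p. poly (pderiv (q i)) x) \<partial>gauss)"
    by (intro Bochner_Integration.integral_sum[symmetric] integrable_gauss_poly)
  also have "\<dots> = (\<integral>x. poly (pderiv p) x \<partial>gauss)"
  proof (intro Bochner_Integration.integral_cong refl)
    show "(\<Sum>i\<le>degree p. poly (pderiv (q i)) x) = poly (pderiv p) x" for x
      using higher_pderiv_sum[of 1 q "{..degree p}"] by (subst (2) p_eq_sum) (simp add: poly_sum)
  qed
  finally show ?thesis .
qed

fun hermite :: "nat \<Rightarrow> real poly" where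
  "hermite 0 = 1"
| "hermite (Suc m) = [:0, 1:] * hermite m - pderiv (hermite m)"

lemma pderiv_hermite: "pderiv (hermite m) = smult (real m) (hermite (m - 1))"
proof (induction m)
  case (Suc m)
  show ?case
  proof (cases m)
    case (Suc k)
    have "pderiv (hermite (Suc m))
        = hermite m + [:0, 1:] * pderiv (hermite m) - pderiv (pderiv (hermite m))"
      by (simp add: pderiv_mult pderiv_diff pderiv_pCons)
    also have "\<dots> = hermite m + smult (real m) ([:0, 1:] * hermite k - pderiv (hermite k))"
      using Suc.IH by (simp add: Suc pderiv_smult smult_diff_right)
    also have "[:0, 1:] * hermite k - pderiv (hermite k) = hermite m" by (simp add: Suc)
    finally show ?thesis by (simp add: algebra_simps smult_add_left)
  qed (simp add: pderiv_mult pderiv_pCons)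
qed simp

lemma degree_hermite: "degree (hermite m) \<le> m"
proof (induction m)
  case (Suc m)
  have "degree ([:0, 1:] * hermite m) \<le> Suc m"
    using Suc by (intro order_trans[OF degree_mult_le]) auto
  moreover have "degree (pderiv (hermite m)) \<le> Suc m"
    using Suc by (simp add: degree_pderiv)
  ultimately show ?case by (simp add: degree_diff_le del: mult_pCons_left)
qed simp

lemma coeff_hermite_top: "coeff (hermite m) m = 1"
proof (induction m)
  case (Suc m)
  have "coeff (pderiv (hermite m)) (Suc m) = 0"
    using degree_hermite[of m] by (intro coeff_eq_0) (simp add: degree_pderiv)
  thus ?case using Suc by (simp add: coeff_pCons)
qed simp

lemma poly_eq_hermite_sum:
  assumes "degree p \<le> m"
  shows "\<exists>c. p = (\<Sum>k\<le>m. smult (c k) (hermite k))"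
  using assms
proof (induction m arbitrary: p)
  case 0
  thus ?case by (auto elim!: degree_eq_zeroE)
next
  case (Suc m)
  define a where "a = coeff p (Suc m)"
  have "degree (p - smult a (hermite (Suc m))) \<le> m"
  proof (rule degree_le, intro allI impI)
    fix i assume "i > m"
    thus "coeff (p - smult a (hermite (Suc m))) i = 0"
      using Suc.prems degree_hermite[of "Suc m"] coeff_hermite_top[of "Suc m"]
      by (cases "i = Suc m") (auto simp: a_def coeff_eq_0 simp del: hermite.simps)
  qed
  then obtain c where "p - smult a (hermite (Suc m)) = (\<Sum>k\<le>m. smult (c k) (hermite k))"
    using Suc.IH by blast
  hence "p = (\<Sum>k\<le>Suc m. smult ((c(Suc m := a)) k) (hermite k))"
    by (simp add: algebra_simps del: hermite.simps)
  thus ?case by blast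
qed

lemma power_eq_hermite_sum: "\<exists>c. \<forall>y. y ^ m = (\<Sum>k\<le>m. c k * poly (hermite k) y)"
proof -
  obtain c where monom_eq: "monom 1 m = (\<Sum>k\<le>m. smult (c k) (hermite k))"
    using poly_eq_hermite_sum[of "monom 1 m :: real poly" m] by (auto simp: degree_monom_le)
  have "y ^ m = poly (monom 1 m) y" for y :: real
    by (simp add: poly_monom)
  hence "y ^ m = (\<Sum>k\<le>m. c k * poly (hermite k) y)" for y
    by (simp only: monom_eq poly_sum poly_smult)
  thus ?thesis by blast
qed

lemma hermite_eq_power_sum: "\<exists>c. \<forall>y. poly (hermite m) y = (\<Sum>k\<le>m. c k * y ^ k)"
proof (intro exI allI)
  fix y
  show "poly (hermite m) y = (\<Sum>k\<le>m. coeff (hermite m) k * y ^ k)"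
    unfolding poly_altdef using degree_hermite[of m]
    by (intro sum.mono_neutral_left) (auto simp: coeff_eq_0)
qed

lemma gauss_hermite_Suc_mult:
  "(\<integral>x. poly (hermite (Suc m)) x * poly q x \<partial>gauss)
    = (\<integral>x. poly (hermite m) x * poly (pderiv q) x \<partial>gauss)"
proof -
  have "(\<integral>x. poly (hermite (Suc m)) x * poly q x \<partial>gauss)
      = (\<integral>x. x * poly (hermite m * q) x - poly (pderiv (hermite m) * q) x \<partial>gauss)"
    by (intro Bochner_Integration.integral_cong) (auto simp: algebra_simps)
  also have "\<dots> = (\<integral>x. x * poly (hermite m * q) x \<partial>gauss)
      - (\<integral>x. poly (pderiv (hermite m) * q) x \<partial>gauss)"
    by (intro Bochner_Integration.integral_diff integrable_gauss_poly integrable_gauss_times_poly)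
  also have "\<dots> = (\<integral>x. poly (pderiv (hermite m * q)) x - poly (pderiv (hermite m) * q) x \<partial>gauss)"
    unfolding gauss_stein_poly
    by (intro Bochner_Integration.integral_diff[symmetric] integrable_gauss_poly)
  also have "\<dots> = (\<integral>x. poly (hermite m) x * poly (pderiv q) x \<partial>gauss)"
    by (intro Bochner_Integration.integral_cong) (auto simp: pderiv_mult algebra_simps)
  finally show ?thesis .
qed

lemma gauss_hermite_orthogonal:
  "(\<integral>x. poly (hermite m) x * poly (hermite k) x \<partial>gauss) = (if m = k then fact m else 0)"
proof (induction m arbitrary: k)
  case 0
  interpret prob_space gauss by (rule prob_space_gauss)
  show ?case
  proof (cases k)
    case (Suc j)
    have "(\<integral>x. poly (hermite (Suc j)) x * poly 1 x \<partial>gauss) = 0"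
      by (subst gauss_hermite_Suc_mult) simp
    thus ?thesis using Suc by (simp del: hermite.simps(2))
  qed (use prob_space in simp)
next
  case (Suc m)
  have "(\<integral>x. poly (hermite (Suc m)) x * poly (hermite k) x \<partial>gauss)
     = real k * (\<integral>x. poly (hermite m) x * poly (hermite (k - 1)) x \<partial>gauss)"
    unfolding gauss_hermite_Suc_mult pderiv_hermite
    by (simp add: mult_ac flip: integral_mult_right_zero)
  thus ?case using Suc by (cases k) auto
qed

section \<open>Positive semidefinite square roots\<close>

definition dot :: "nat \<Rightarrow> (nat \<Rightarrow> real) \<Rightarrow> (nat \<Rightarrow> real) \<Rightarrow> real" where
  "dot n x y = (\<Sum>i<n. x i * y i)"

definition mat_vec :: "nat \<Rightarrow> (nat \<Rightarrow> nat \<Rightarrow> real) \<Rightarrow> (nat \<Rightarrow> real) \<Rightarrow> nat \<Rightarrow> real" where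
  "mat_vec n A v i = dot n (A i) v"

definition psd_matrix :: "nat \<Rightarrow> (nat \<Rightarrow> nat \<Rightarrow> real) \<Rightarrow> bool" where
  "psd_matrix n A \<longleftrightarrow> (\<forall>i<n. \<forall>j<n. A i j = A j i) \<and> (\<forall>v. dot n v (mat_vec n A v) \<ge> 0)"

lemma dot_commute: "dot n x y = dot n y x"
  by (simp add: dot_def mult.commute)

lemma dot_cong:
  "(\<And>i. i < n \<Longrightarrow> x i = x' i) \<Longrightarrow> (\<And>i. i < n \<Longrightarrow> y i = y' i) \<Longrightarrow> dot n x y = dot n x' y'"
  by (simp add: dot_def)

lemma dot_add_scaleR_right: "dot n x (\<lambda>i. y i + c * z i) = dot n x y + c * dot n x z"
  by (simp add: dot_def algebra_simps sum.distrib sum_distrib_left)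

lemma dot_add_scaleR_left: "dot n (\<lambda>i. y i + c * z i) x = dot n y x + c * dot n z x"
  by (simp only: dot_commute[of n _ x] dot_add_scaleR_right)

lemma sqnorm_eq_dot: "sqnorm n x = dot n x x"
  by (simp add: sqnorm_def dot_def power2_eq_square)

lemma sqnorm_nonneg: "sqnorm n x \<ge> 0"
  by (simp add: sqnorm_def sum_nonneg)

lemma sqnorm_eq_0_iff: "sqnorm n x = 0 \<longleftrightarrow> (\<forall>i<n. x i = 0)"
  by (auto simp: sqnorm_def sum_nonneg_eq_0_iff)

lemma dot_Cauchy_Schwarz: "(dot n x y)\<^sup>2 \<le> sqnorm n x * sqnorm n y"
  unfolding dot_def sqnorm_def by (rule Cauchy_Schwarz_ineq_sum)

lemma mat_vec_add_scaleR:
  "mat_vec n A (\<lambda>i. v i + c * w i) = (\<lambda>i. mat_vec n A v i + c * mat_vec n A w i)"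
  by (simp add: mat_vec_def dot_add_scaleR_right fun_eq_iff)

lemma dot_mat_vec_eq_sum: "dot n v (mat_vec n A w) = (\<Sum>i<n. \<Sum>j<n. v i * A i j * w j)"
  by (simp add: dot_def mat_vec_def sum_distrib_left mult.assoc)

lemma dot_mat_vec_symmetric:
  assumes "\<And>i j. i < n \<Longrightarrow> j < n \<Longrightarrow> A i j = A j i"
  shows "dot n v (mat_vec n A w) = dot n w (mat_vec n A v)"
proof -
  have "dot n v (mat_vec n A w) = (\<Sum>j<n. \<Sum>i<n. v i * A i j * w j)"
    unfolding dot_mat_vec_eq_sum by (rule sum.swap)
  also have "\<dots> = (\<Sum>j<n. \<Sum>i<n. w j * A j i * v i)"
    by (intro sum.cong refl) (simp add: assms mult_ac)
  finally show ?thesis by (simp only: dot_mat_vec_eq_sum)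
qed

lemma is_psd_sqrt_iff:
  "is_psd_sqrt n S A \<longleftrightarrow>
     psd_matrix n A \<and> (\<forall>i<n. \<forall>j<n. (\<Sum>k<n. A i k * A k j) = S i j)"
  by (auto simp: is_psd_sqrt_def psd_matrix_def dot_mat_vec_eq_sum)

lemma psd_matrix_isotropic_kernel:
  assumes psd: "psd_matrix n A" and isotropic: "dot n v (mat_vec n A v) = 0" and "i < n"
  shows "mat_vec n A v i = 0"
proof -
  define w where "w = mat_vec n A v"
  define s where "s = sqnorm n w"
  define q where "q = dot n w (mat_vec n A w)"
  have "q \<ge> 0" using psd by (simp add: q_def psd_matrix_def)
  have "dot n v (mat_vec n A w) = s"
    using psd dot_mat_vec_symmetric[of n A v w]
    by (simp add: psd_matrix_def s_def sqnorm_eq_dot flip: w_def)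
  hence form_line: "dot n (\<lambda>i. v i + t * w i) (mat_vec n A (\<lambda>i. v i + t * w i))
      = t * (2 * s + t * q)" for t
    using isotropic
    by (simp add: mat_vec_add_scaleR dot_add_scaleR_left dot_add_scaleR_right q_def algebra_simps)
       (simp add: s_def sqnorm_eq_dot flip: w_def)
  have "\<not> s > 0"
  proof
    assume "s > 0"
    define t where "t = - (s / (q + 1))"
    have "t < 0" using \<open>s > 0\<close> \<open>q \<ge> 0\<close> by (simp add: t_def)
    moreover have "- t * q \<le> s" using \<open>s > 0\<close> \<open>q \<ge> 0\<close> by (simp add: t_def divide_le_eq)
    hence "2 * s + t * q > 0" using \<open>s > 0\<close> by simp
    ultimately have "t * (2 * s + t * q) < 0" by (rule mult_neg_pos)
    moreover have "0 \<le> t * (2 * s + t * q)"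
      unfolding form_line[symmetric] using psd by (simp add: psd_matrix_def)
    ultimately show False by linarith
  qed
  hence "sqnorm n w = 0" using sqnorm_nonneg[of n w] by (simp add: s_def)
  thus ?thesis using \<open>i < n\<close> by (simp add: sqnorm_eq_0_iff w_def)
qed

text \<open>This says that \<open>tr(D M D) = - tr(D M D)\<close>.\<close>

lemma sum_form_columns_anticommuting:
  assumes sym: "\<And>i j. i < n \<Longrightarrow> j < n \<Longrightarrow> D i j = D j i"
    and anticommute: "\<And>i j. i < n \<Longrightarrow> j < n \<Longrightarrow> (\<Sum>k<n. M i k * D k j) = - (\<Sum>k<n. D i k * M k j)"
  shows "(\<Sum>j<n. dot n (\<lambda>i. D i j) (mat_vec n M (\<lambda>i. D i j))) = 0" (is "(\<Sum>j<n. ?form j) = 0")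
proof -
  have "(\<Sum>j<n. ?form j) = (\<Sum>j<n. \<Sum>i<n. D i j * (\<Sum>k<n. M i k * D k j))"
    by (simp add: dot_def mat_vec_def)
  also have "\<dots> = (\<Sum>j<n. \<Sum>i<n. - (D i j * (\<Sum>k<n. D i k * M k j)))"
    by (intro sum.cong refl) (simp add: anticommute)
  also have "\<dots> = - (\<Sum>i<n. \<Sum>j<n. \<Sum>k<n. D i j * D i k * M k j)"
    by (subst sum.swap) (simp add: sum_negf sum_distrib_left mult.assoc)
  also have "\<dots> = - (\<Sum>i<n. \<Sum>k<n. \<Sum>j<n. D k i * M k j * D j i)"
    by (subst (2) sum.swap) (auto intro!: sum.cong simp: sym mult_ac)
  also have "\<dots> = - (\<Sum>i<n. ?form i)"
    by (simp add: dot_mat_vec_eq_sum)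
  finally show ?thesis by simp
qed

text \<open>
  For two square roots \<open>A\<close> and \<open>B\<close>, the matrices \<open>M = A + B\<close> and \<open>D = A - B\<close> anticommute.  As
  \<open>D M D\<close> is positive semidefinite and has trace 0, \<open>A\<close> and \<open>B\<close> annihilate the columns of \<open>D\<close>,
  hence \<open>D\<^sup>2 = 0\<close>.
\<close>

lemma psd_sqrt_unique:
  assumes sqrt_A: "is_psd_sqrt n S A" and sqrt_B: "is_psd_sqrt n S B" and "i < n" "j < n"
  shows "A i j = B i j"
proof -
  define D where "D i j = A i j + (- 1) * B i j" for i j
  define M where "M i j = A i j + 1 * B i j" for i j
  have psd: "psd_matrix n A" "psd_matrix n B" using sqrt_A sqrt_B by (simp_all add: is_psd_sqrt_iff)
  have D_sym: "D i j = D j i" if "i < n" "j < n" for i j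
    using psd that by (simp add: psd_matrix_def D_def)
  have anticommute: "(\<Sum>k<n. M i k * D k j) = - (\<Sum>k<n. D i k * M k j)" if "i < n" "j < n" for i j
  proof -
    have "(\<Sum>k<n. M i k * D k j) + (\<Sum>k<n. D i k * M k j)
        = 2 * (\<Sum>k<n. A i k * A k j) - 2 * (\<Sum>k<n. B i k * B k j)"
      by (simp add: M_def D_def sum_distrib_left algebra_simps flip: sum.distrib sum_subtractf)
    also have "\<dots> = 0" using sqrt_A sqrt_B that by (simp add: is_psd_sqrt_iff)
    finally show ?thesis by linarith
  qed
  define form where "form E j = dot n (\<lambda>i. D i j) (mat_vec n E (\<lambda>i. D i j))" for E j
  have "mat_vec n M v = (\<lambda>i. mat_vec n A v i + 1 * mat_vec n B v i)" for v
    unfolding mat_vec_def M_def[abs_def] by (simp only: dot_add_scaleR_left)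
  hence form_M: "form M j = form A j + form B j" for j
    by (simp add: form_def dot_add_scaleR_right[where c=1, simplified])
  have form_nonneg: "form A j \<ge> 0" "form B j \<ge> 0" for j
    using psd by (simp_all add: form_def psd_matrix_def)
  have "(\<Sum>j<n. form M j) = 0"
    unfolding form_def by (rule sum_form_columns_anticommuting[OF D_sym anticommute])
  hence "form M j = 0"
    using form_nonneg \<open>j < n\<close> by (simp add: form_M sum_nonneg_eq_0_iff)
  hence "form A j = 0" "form B j = 0" using form_nonneg[of j] by (simp_all add: form_M)
  hence "mat_vec n A (\<lambda>i. D i j) j = 0" "mat_vec n B (\<lambda>i. D i j) j = 0"
    using psd \<open>j < n\<close> by (simp_all only: form_def psd_matrix_isotropic_kernel)
  hence "mat_vec n D (\<lambda>i. D i j) j = 0"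
    unfolding mat_vec_def D_def[abs_def] by (simp only: dot_add_scaleR_left)
  hence "sqnorm n (\<lambda>i. D i j) = 0"
    using \<open>j < n\<close> D_sym by (simp add: mat_vec_def sqnorm_eq_dot cong: dot_cong)
  thus ?thesis using \<open>i < n\<close> by (simp add: sqnorm_eq_0_iff D_def)
qed

lemma mat_vec_spiked_cov:
  assumes "i < n"
  shows "mat_vec n (spiked_cov c x) v i = v i + c * dot n x v * x i"
proof -
  have "mat_vec n (spiked_cov c x) v i = (\<Sum>j<n. (if i = j then v j else 0) + c * x i * (x j * v j))"
    unfolding mat_vec_def dot_def by (intro sum.cong) (auto simp: spiked_cov_def algebra_simps)
  thus ?thesis using assms by (simp add: sum.distrib sum_distrib_left dot_def mult_ac)
qed

lemma spiked_cov_sym: "spiked_cov c x i j = spiked_cov c x j i"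
  by (simp add: spiked_cov_def)

lemma psd_matrix_spiked_cov:
  assumes "c * sqnorm n x \<ge> -1"
  shows "psd_matrix n (spiked_cov c x)"
proof -
  have form_eq: "dot n v (mat_vec n (spiked_cov c x) v) = sqnorm n v + c * (dot n x v)\<^sup>2" for v
  proof -
    have "dot n v (mat_vec n (spiked_cov c x) v) = dot n v (\<lambda>i. v i + c * dot n x v * x i)"
      by (rule dot_cong) (simp_all add: mat_vec_spiked_cov)
    also have "\<dots> = dot n v v + (c * dot n x v) * dot n v x" by (rule dot_add_scaleR_right)
    finally show ?thesis by (simp add: sqnorm_eq_dot power2_eq_square dot_commute[of n v x])
  qed
  have "sqnorm n v + c * (dot n x v)\<^sup>2 \<ge> 0" for v
  proof (cases "c \<ge> 0")
    case False
    have "0 \<le> (1 + c * sqnorm n x) * sqnorm n v"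
      using assms by (intro mult_nonneg_nonneg sqnorm_nonneg) simp
    also have "\<dots> = sqnorm n v + c * (sqnorm n x * sqnorm n v)" by (simp add: algebra_simps)
    also have "\<dots> \<le> sqnorm n v + c * (dot n x v)\<^sup>2"
      using False dot_Cauchy_Schwarz by (intro add_left_mono mult_left_mono_neg) auto
    finally show ?thesis .
  qed (simp add: sqnorm_nonneg)
  thus ?thesis by (simp add: psd_matrix_def form_eq spiked_cov_sym)
qed

lemma spiked_cov_square:
  assumes "i < n" "j < n"
  shows "(\<Sum>k<n. spiked_cov c x i k * spiked_cov c x k j)
    = spiked_cov (2 * c + c\<^sup>2 * sqnorm n x) x i j"
proof -
  have "(\<Sum>k<n. spiked_cov c x i k * spiked_cov c x k j)
      = mat_vec n (spiked_cov c x) (\<lambda>k. spiked_cov c x j k) i"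
    by (simp add: mat_vec_def dot_def spiked_cov_sym[of c x _ j])
  also have "\<dots> = spiked_cov c x j i + c * mat_vec n (spiked_cov c x) x j * x i"
    using assms by (simp add: mat_vec_spiked_cov mat_vec_def[of n _ x] dot_commute[of n x])
  also have "\<dots> = spiked_cov (2 * c + c\<^sup>2 * sqnorm n x) x i j"
    using assms
    by (simp add: mat_vec_spiked_cov sqnorm_eq_dot spiked_cov_def algebra_simps power2_eq_square)
  finally show ?thesis .
qed

text \<open>
  The solution of \<open>2 c + c\<^sup>2 s = \<beta>\<close> that makes \<open>I + c x x\<^sup>T\<close> positive semidefinite for \<open>s = |x|\<^sup>2\<close>.
  It is set to 0 where \<open>I + \<beta> x x\<^sup>T\<close> is not positive semidefinite, to match the null branch of the
  planted model.
\<close>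

definition spike_coef :: "real \<Rightarrow> real \<Rightarrow> real" where
  "spike_coef \<beta> s = (if \<beta> * s \<ge> -1 then \<beta> / (1 + sqrt (1 + \<beta> * s)) else 0)"

lemma one_plus_spike_coef:
  assumes "\<beta> * s \<ge> -1"
  shows "1 + spike_coef \<beta> s * s = sqrt (1 + \<beta> * s)"
proof -
  define r where "r = sqrt (1 + \<beta> * s)"
  have "r \<ge> 0" and r_square: "r\<^sup>2 = 1 + \<beta> * s" using assms by (auto simp: r_def)
  have "spike_coef \<beta> s * s = (\<beta> * s) / (1 + r)" using assms by (simp add: spike_coef_def r_def)
  also have "\<beta> * s = (r - 1) * (1 + r)" using r_square by (simp add: algebra_simps power2_eq_square)
  finally show ?thesis using \<open>r \<ge> 0\<close> by (simp flip: r_def)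
qed

lemma spike_coef_quadratic:
  assumes "\<beta> * s \<ge> -1"
  shows "2 * spike_coef \<beta> s + (spike_coef \<beta> s)\<^sup>2 * s = \<beta>"
proof -
  have "2 * spike_coef \<beta> s + (spike_coef \<beta> s)\<^sup>2 * s
      = spike_coef \<beta> s * (1 + (1 + spike_coef \<beta> s * s))"
    by (simp add: algebra_simps power2_eq_square)
  also have "\<dots> = spike_coef \<beta> s * (1 + sqrt (1 + \<beta> * s))"
    by (simp only: one_plus_spike_coef[OF assms])
  also have "\<dots> = \<beta>"
  proof -
    have "1 + sqrt (1 + \<beta> * s) > 0" using assms by (intro add_pos_nonneg) auto
    thus ?thesis using assms by (simp add: spike_coef_def)
  qed
  finally show ?thesis .
qed

lemma abs_spike_coef_le: "\<bar>spike_coef \<beta> s\<bar> \<le> \<bar>\<beta>\<bar>"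
proof (cases "\<beta> * s \<ge> -1")
  case True
  have "\<bar>\<beta>\<bar> / (1 + sqrt (1 + \<beta> * s)) \<le> \<bar>\<beta>\<bar> / 1"
    using True by (intro divide_left_mono) (auto intro: add_pos_nonneg)
  thus ?thesis using True by (simp add: spike_coef_def)
qed (simp add: spike_coef_def)

lemma psd_sqrt_spiked_cov:
  assumes "\<beta> * sqnorm n x \<ge> -1" "i < n" "j < n"
  shows "psd_sqrt n (spiked_cov \<beta> x) i j = spiked_cov (spike_coef \<beta> (sqnorm n x)) x i j"
proof -
  let ?c = "spike_coef \<beta> (sqnorm n x)"
  have "1 + ?c * sqnorm n x \<ge> 0" using assms(1) by (simp add: one_plus_spike_coef)
  hence "psd_matrix n (spiked_cov ?c x)" by (intro psd_matrix_spiked_cov) simp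
  hence "is_psd_sqrt n (spiked_cov \<beta> x) (spiked_cov ?c x)"
    using assms(1) by (simp add: is_psd_sqrt_iff spiked_cov_square spike_coef_quadratic)
  moreover from this have "is_psd_sqrt n (spiked_cov \<beta> x) (psd_sqrt n (spiked_cov \<beta> x))"
    unfolding psd_sqrt_def by (rule someI[of "is_psd_sqrt n (spiked_cov \<beta> x)"])
  ultimately show ?thesis using assms(2,3) by (intro psd_sqrt_unique)
qed

section \<open>Hermite moments of Gaussian vectors\<close>

lemma prob_space_std_gaussian: "prob_space (std_gaussian n)"
  unfolding std_gaussian_def by (intro prob_space_PiM prob_space_gauss)

lemma finite_measure_std_gaussian: "finite_measure (std_gaussian n)"
  by (rule prob_space.finite_measure[OF prob_space_std_gaussian])

lemma sets_std_gaussian [measurable_cong]: "sets (std_gaussian n) = sets (Rn n)"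
  unfolding std_gaussian_def by (intro sets_PiM_cong) auto

lemma space_std_gaussian: "space (std_gaussian n) = space (Rn n)"
  by (rule sets_eq_imp_space_eq[OF sets_std_gaussian])

lemma all_moments_std_gaussian_component: "j < n \<Longrightarrow> all_moments (std_gaussian n) (\<lambda>g. g j)"
  unfolding std_gaussian_def
  by (rule all_moments_PiM_component) (auto intro: prob_space_gauss all_moments_gauss)

lemma all_moments_std_gaussian_dot: "all_moments (std_gaussian n) (\<lambda>g. dot n a g)"
  unfolding dot_def
  by (intro all_moments_sum all_moments_mult all_moments_const all_moments_std_gaussian_component
            finite_measure_std_gaussian) auto

lemma std_gaussian_stein_coordinate:
  assumes m_less: "m < n"
    and poly: "\<And>g. \<exists>q. \<forall>t. F (g(m := t)) = poly q t \<and> F' (g(m := t)) = poly (pderiv q) t"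
    and integrable_F: "integrable (std_gaussian n) (\<lambda>g. g m * F g)"
    and integrable_F': "integrable (std_gaussian n) F'"
  shows "(\<integral>g. g m * F g \<partial>std_gaussian n) = (\<integral>g. F' g \<partial>std_gaussian n)"
proof -
  interpret product_prob_space "\<lambda>_::nat. gauss" "{..<n}"
    by (intro product_prob_spaceI prob_space_gauss)
  define I where "I = {..<n} - {m}"
  have fresh: "finite I" "m \<notin> I" and std_gaussian: "std_gaussian n = PiM (insert m I) (\<lambda>_. gauss)"
    using m_less by (auto simp: I_def std_gaussian_def insert_absorb)
  have stein_m: "(\<integral>t. t * F (g(m := t)) \<partial>gauss) = (\<integral>t. F' (g(m := t)) \<partial>gauss)" for g
  proof -
    obtain q where "F (g(m := t)) = poly q t" "F' (g(m := t)) = poly (pderiv q) t" for t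
      using poly by blast
    thus ?thesis by (simp add: gauss_stein_poly)
  qed
  have "(\<integral>g. g m * F g \<partial>std_gaussian n) = (\<integral>g. \<integral>t. t * F (g(m := t)) \<partial>gauss \<partial>PiM I (\<lambda>_. gauss))"
    using product_integral_insert[OF fresh integrable_F[unfolded std_gaussian]]
    by (simp add: std_gaussian)
  also have "\<dots> = (\<integral>g. \<integral>t. F' (g(m := t)) \<partial>gauss \<partial>PiM I (\<lambda>_. gauss))"
    by (simp only: stein_m)
  also have "\<dots> = (\<integral>g. F' g \<partial>std_gaussian n)"
    using product_integral_insert[OF fresh integrable_F'[unfolded std_gaussian]]
    by (simp add: std_gaussian)
  finally show ?thesis .
qed

lemma dot_fun_upd:
  assumes "m < n" shows "dot n a (g(m := t)) = dot n a (g(m := 0)) + a m * t"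
  using assms by (simp add: dot_def sum.remove[of "{..<n}" m])

lemma std_gaussian_stein:
  fixes A :: "nat \<Rightarrow> nat \<Rightarrow> real" and P :: "nat \<Rightarrow> real poly"
  assumes m_less: "m < n" and "finite J"
  defines "G k g \<equiv> (\<Prod>j\<in>J - {k}. poly (P j) (dot n (A j) g)) * poly (pderiv (P k)) (dot n (A k) g)"
  shows "(\<integral>g. g m * (\<Prod>j\<in>J. poly (P j) (dot n (A j) g)) \<partial>std_gaussian n)
       = (\<Sum>k\<in>J. A k m * (\<integral>g. G k g \<partial>std_gaussian n))"
proof -
  note moments = all_moments_mult all_moments_prod all_moments_poly all_moments_std_gaussian_dot
    all_moments_std_gaussian_component finite_measure_std_gaussian
  have integrable_G: "integrable (std_gaussian n) (\<lambda>g. A k m * G k g)" for k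
    unfolding G_def by (intro integrable_mult_right all_moments_integrable moments)
  have "(\<integral>g. g m * (\<Prod>j\<in>J. poly (P j) (dot n (A j) g)) \<partial>std_gaussian n)
      = (\<integral>g. (\<Sum>k\<in>J. A k m * G k g) \<partial>std_gaussian n)"
  proof (rule std_gaussian_stein_coordinate[OF m_less])
    fix g
    define q where "q = (\<Prod>j\<in>J. pcompose (P j) [:dot n (A j) (g(m := 0)), A j m:])"
    have dot_line: "dot n (A j) (g(m := t)) = dot n (A j) (g(m := 0)) + t * A j m" for j t
      using dot_fun_upd[OF m_less, of "A j" g t] by (simp only: mult.commute)
    have "(\<Prod>j\<in>J. poly (P j) (dot n (A j) (g(m := t)))) = poly q t" for t
      by (simp add: q_def poly_prod poly_pcompose dot_line[of _ t])
    moreover have "(\<Sum>k\<in>J. A k m * G k (g(m := t))) = poly (pderiv q) t" for t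
      by (simp add: G_def q_def pderiv_prod poly_sum poly_prod poly_pcompose pderiv_pcompose
            pderiv_pCons dot_line[of _ t] mult_ac)
    ultimately show "\<exists>q. \<forall>t. (\<Prod>j\<in>J. poly (P j) (dot n (A j) (g(m := t)))) = poly q t \<and>
        (\<Sum>k\<in>J. A k m * G k (g(m := t))) = poly (pderiv q) t" by blast
  next
    show "integrable (std_gaussian n) (\<lambda>g. g m * (\<Prod>j\<in>J. poly (P j) (dot n (A j) g)))"
      by (intro all_moments_integrable moments m_less)
    show "integrable (std_gaussian n) (\<lambda>g. \<Sum>k\<in>J. A k m * G k g)"
      by (intro Bochner_Integration.integrable_sum integrable_G)
  qed
  also have "\<dots> = (\<Sum>k\<in>J. A k m * (\<integral>g. G k g \<partial>std_gaussian n))"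
    using integrable_G by (simp add: Bochner_Integration.integral_sum)
  finally show ?thesis .
qed

definition multi_hermite :: "nat \<Rightarrow> (nat \<Rightarrow> nat) \<Rightarrow> (nat \<Rightarrow> real) \<Rightarrow> real" where
  "multi_hermite n a v = (\<Prod>j<n. poly (hermite (a j)) (v j))"

lemma multi_hermite_remove:
  assumes "k < n"
  shows "multi_hermite n a v
    = (\<Prod>j\<in>{..<n} - {k}. poly (hermite (a j)) (v j)) * poly (hermite (a k)) (v k)"
  using assms by (simp add: multi_hermite_def prod.remove[of "{..<n}" k])

lemma multi_hermite_derivative:
  assumes "k < n"
  shows "(\<Prod>j\<in>{..<n} - {k}. poly (hermite (a j)) (v j)) * poly (pderiv (hermite (a k))) (v k)
    = real (a k) * multi_hermite n (a(k := a k - 1)) v"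
  using assms by (simp add: multi_hermite_remove pderiv_hermite)

lemma multi_hermite_Suc:
  assumes "j < n"
  shows "multi_hermite n (a(j := Suc (a j))) v
    = v j * multi_hermite n a v - real (a j) * multi_hermite n (a(j := a j - 1)) v"
  using assms by (simp add: multi_hermite_remove pderiv_hermite algebra_simps)

lemma all_moments_multi_hermite:
  assumes "finite_measure M" "\<And>j. j < n \<Longrightarrow> all_moments M (\<lambda>z. v z j)"
  shows "all_moments M (\<lambda>z. multi_hermite n a (v z))"
  unfolding multi_hermite_def by (intro all_moments_prod all_moments_poly assms) auto

lemma all_moments_multi_hermite_mat_vec:
  "all_moments (std_gaussian n) (\<lambda>g. multi_hermite n a (mat_vec n A g))"
  by (intro all_moments_multi_hermite finite_measure_std_gaussian)
     (simp add: mat_vec_def all_moments_std_gaussian_dot)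

text \<open>The recurrence exhibits the covariance of \<open>A g\<close> minus the identity.\<close>

lemma std_gaussian_multi_hermite_Suc:
  assumes j_less: "j < n"
  shows "(\<integral>g. multi_hermite n (a(j := Suc (a j))) (mat_vec n A g) \<partial>std_gaussian n)
    = (\<Sum>k<n. (dot n (A j) (A k) - (if j = k then 1 else 0)) * real (a k) *
         (\<integral>g. multi_hermite n (a(k := a k - 1)) (mat_vec n A g) \<partial>std_gaussian n))"
proof -
  let ?E = "\<lambda>F. \<integral>g. F g \<partial>std_gaussian n" and ?y = "mat_vec n A"
  define h where "h k = real (a k) * ?E (\<lambda>g. multi_hermite n (a(k := a k - 1)) (?y g))" for k
  have stein: "?E (\<lambda>g. g m * multi_hermite n a (?y g)) = (\<Sum>k<n. A k m * h k)" if "m < n" for m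
  proof -
    have "?E (\<lambda>g. g m * multi_hermite n a (?y g))
        = (\<Sum>k<n. A k m * ?E (\<lambda>g. real (a k) * multi_hermite n (a(k := a k - 1)) (?y g)))"
      using std_gaussian_stein[OF that finite_lessThan[of n], where P="\<lambda>k. hermite (a k)" and A=A]
      by (simp add: multi_hermite_def[of n a] mat_vec_def[abs_def]
            multi_hermite_derivative[where v="?y g" for g, unfolded mat_vec_def])
    thus ?thesis by (simp add: h_def)
  qed
  have moments: "all_moments (std_gaussian n) (\<lambda>g. g m * multi_hermite n a (?y g))"
    if "m < n" for m
    using that
    by (intro all_moments_mult all_moments_multi_hermite_mat_vec all_moments_std_gaussian_component)
  have "?E (\<lambda>g. multi_hermite n (a(j := Suc (a j))) (?y g))
      = ?E (\<lambda>g. (\<Sum>m<n. A j m * (g m * multi_hermite n a (?y g)))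
            - real (a j) * multi_hermite n (a(j := a j - 1)) (?y g))"
    using j_less
    by (simp add: multi_hermite_Suc mat_vec_def[of n A _ j] dot_def sum_distrib_right mult.assoc)
  also have "\<dots> = ?E (\<lambda>g. \<Sum>m<n. A j m * (g m * multi_hermite n a (?y g))) - h j"
    unfolding h_def integral_mult_right_zero[symmetric]
    by (intro Bochner_Integration.integral_diff Bochner_Integration.integrable_sum
          integrable_mult_right all_moments_integrable moments all_moments_multi_hermite_mat_vec) auto
  also have "?E (\<lambda>g. \<Sum>m<n. A j m * (g m * multi_hermite n a (?y g)))
      = (\<Sum>m<n. A j m * (\<Sum>k<n. A k m * h k))"
    using stein all_moments_integrable[OF moments] by (simp add: Bochner_Integration.integral_sum)
  also have "\<dots> = (\<Sum>k<n. dot n (A j) (A k) * h k)"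
    by (simp add: dot_def sum_distrib_left sum_distrib_right mult_ac) (rule sum.swap)
  also have "\<dots> - h j = (\<Sum>k<n. (dot n (A j) (A k) - (if j = k then 1 else 0)) * h k)"
    using j_less by (simp add: left_diff_distrib sum_subtractf mult_delta_left)
  finally show ?thesis by (simp only: h_def mult.assoc)
qed

text \<open>For \<open>\<beta> \<ge> 0\<close> this is the \<open>d\<close>-th moment of a centred Gaussian of variance \<open>\<beta>\<close>.\<close>

fun wick :: "real \<Rightarrow> nat \<Rightarrow> real" where
  "wick \<beta> 0 = 1"
| "wick \<beta> (Suc 0) = 0"
| "wick \<beta> (Suc (Suc d)) = \<beta> * real (Suc d) * wick \<beta> d"

abbreviation power_prod :: "nat \<Rightarrow> (nat \<Rightarrow> nat) \<Rightarrow> (nat \<Rightarrow> real) \<Rightarrow> real" where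
  "power_prod n a x \<equiv> (\<Prod>j<n. x j ^ a j)"

definition spiked_hermite_moment :: "real \<Rightarrow> nat \<Rightarrow> (nat \<Rightarrow> nat) \<Rightarrow> (nat \<Rightarrow> real) \<Rightarrow> real" where
  "spiked_hermite_moment \<beta> n a x = wick \<beta> (\<Sum>j<n. a j) * power_prod n a x"

lemma spiked_hermite_moment_Suc:
  assumes j_less: "j < n"
  shows "spiked_hermite_moment \<beta> n (a(j := Suc (a j))) x
    = \<beta> * x j * (\<Sum>k<n. real (a k) * (x k * spiked_hermite_moment \<beta> n (a(k := a k - 1)) x))"
proof -
  define s where "s = (\<Sum>i<n. a i)"
  have lowered: "real (a k) * (x k * spiked_hermite_moment \<beta> n (a(k := a k - 1)) x)
      = real (a k) * (wick \<beta> (s - 1) * power_prod n a x)" if "k < n" for k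
  proof (cases "a k")
    case (Suc d)
    have "(\<Sum>i<n. (a(k := d)) i) = s - 1"
      using that Suc by (simp add: s_def sum.remove[of "{..<n}" k])
    moreover have "x k * power_prod n (a(k := d)) x = power_prod n a x"
      using that Suc by (simp add: prod.remove[of "{..<n}" k])
    ultimately show ?thesis
      using Suc by (simp add: spiked_hermite_moment_def mult.left_commute del: fun_upd_apply)
  qed simp
  have "(\<Sum>k<n. real (a k) * (x k * spiked_hermite_moment \<beta> n (a(k := a k - 1)) x))
      = (\<Sum>k<n. real (a k) * (wick \<beta> (s - 1) * power_prod n a x))"
    by (intro sum.cong refl) (simp only: lowered lessThan_iff)
  hence "\<beta> * x j * (\<Sum>k<n. real (a k) * (x k * spiked_hermite_moment \<beta> n (a(k := a k - 1)) x))
      = \<beta> * real s * wick \<beta> (s - 1) * (x j * power_prod n a x)"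
    by (simp add: s_def sum_distrib_right[symmetric])
  also have "\<beta> * real s * wick \<beta> (s - 1) = wick \<beta> (Suc s)" by (cases s) simp_all
  also have "Suc s = (\<Sum>i<n. (a(j := Suc (a j))) i)"
    using j_less by (simp add: s_def sum.remove[of "{..<n}" j])
  also have "x j * power_prod n a x = power_prod n (a(j := Suc (a j))) x"
    using j_less by (simp add: prod.remove[of "{..<n}" j])
  finally show ?thesis by (simp only: spiked_hermite_moment_def)
qed

lemma std_gaussian_multi_hermite_spiked:
  assumes cov: "\<And>j k. j < n \<Longrightarrow> k < n \<Longrightarrow> dot n (A j) (A k) = spiked_cov \<beta> x j k"
  shows "(\<integral>g. multi_hermite n a (mat_vec n A g) \<partial>std_gaussian n) = spiked_hermite_moment \<beta> n a x"
proof (induction "\<Sum>j<n. a j" arbitrary: a rule: less_induct)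
  case less
  let ?E = "\<lambda>a. \<integral>g. multi_hermite n a (mat_vec n A g) \<partial>std_gaussian n"
  show ?case
  proof (cases "\<forall>j<n. a j = 0")
    case True
    interpret prob_space "std_gaussian n" by (rule prob_space_std_gaussian)
    show ?thesis using True by (simp add: multi_hermite_def spiked_hermite_moment_def prob_space)
  next
    case False
    then obtain j c where a_j: "j < n" "a j = Suc c" using not0_implies_Suc by blast
    define b where "b = a(j := c)"
    have a_eq: "a = b(j := Suc (b j))" using a_j by (simp add: b_def fun_eq_iff)
    have lower: "real (b k) * ?E (b(k := b k - 1))
        = real (b k) * spiked_hermite_moment \<beta> n (b(k := b k - 1)) x" if "k < n" for k
    proof (cases "b k")
      case (Suc d)
      have "(\<Sum>i<n. (b(k := d)) i) < (\<Sum>i<n. b i)"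
        using that Suc by (simp add: sum.remove[of "{..<n}" k])
      also have "\<dots> < (\<Sum>i<n. a i)"
        using a_j by (simp add: sum.remove[of "{..<n}" j] b_def)
      finally show ?thesis using less[of "b(k := d)"] Suc by simp
    qed simp
    have "?E a = (\<Sum>k<n. \<beta> * x j * (x k * (real (b k) * ?E (b(k := b k - 1)))))"
      unfolding a_eq std_gaussian_multi_hermite_Suc[OF a_j(1)]
      using a_j by (intro sum.cong refl) (simp add: cov spiked_cov_def)
    also have "\<dots>
        = (\<Sum>k<n. \<beta> * x j * (x k * (real (b k) * spiked_hermite_moment \<beta> n (b(k := b k - 1)) x)))"
      by (intro sum.cong refl) (simp only: lower lessThan_iff)
    also have "\<dots> = spiked_hermite_moment \<beta> n a x"
      unfolding a_eq spiked_hermite_moment_Suc[OF a_j(1)] sum_distrib_left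
      by (intro sum.cong refl) (simp only: mult_ac)
    finally show ?thesis .
  qed
qed

section \<open>Absolute continuity of spiked Gaussian vectors\<close>

definition nonsingular :: "'a measure \<Rightarrow> ('a \<Rightarrow> 'a) \<Rightarrow> bool" where
  "nonsingular M T \<longleftrightarrow> T \<in> M \<rightarrow>\<^sub>M M \<and> (\<forall>A\<in>null_sets M. T -` A \<inter> space M \<in> null_sets M)"

lemma nonsingular_comp:
  assumes "nonsingular M S" "nonsingular M T"
  shows "nonsingular M (\<lambda>x. S (T x))"
  unfolding nonsingular_def
proof (intro conjI ballI)
  have [measurable]: "S \<in> M \<rightarrow>\<^sub>M M" "T \<in> M \<rightarrow>\<^sub>M M" using assms by (auto simp: nonsingular_def)
  show "(\<lambda>x. S (T x)) \<in> M \<rightarrow>\<^sub>M M" by measurable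
  fix A assume "A \<in> null_sets M"
  hence "T -` (S -` A \<inter> space M) \<inter> space M \<in> null_sets M"
    using assms unfolding nonsingular_def by blast
  also have "T -` (S -` A \<inter> space M) \<inter> space M = (\<lambda>x. S (T x)) -` A \<inter> space M"
    using measurable_space[OF \<open>T \<in> M \<rightarrow>\<^sub>M M\<close>] by auto
  finally show "(\<lambda>x. S (T x)) -` A \<inter> space M \<in> null_sets M" .
qed

lemma nonsingular_cong:
  assumes "\<And>x. x \<in> space M \<Longrightarrow> S x = T x" "nonsingular M S"
  shows "nonsingular M T"
proof -
  have "T \<in> M \<rightarrow>\<^sub>M M" using assms measurable_cong[of M S T M] by (auto simp: nonsingular_def)
  moreover have "T -` A \<inter> space M = S -` A \<inter> space M" for A using assms(1) by auto
  ultimately show ?thesis using assms(2) by (auto simp: nonsingular_def)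
qed

lemma nonsingular_id: "nonsingular M (\<lambda>x. x)"
  by (auto simp: nonsingular_def intro: null_set_Int1)

lemma nonsingular_imp_absolutely_continuous:
  assumes "nonsingular M T" shows "absolutely_continuous M (distr M M T)"
  using assms by (auto simp: absolutely_continuous_def nonsingular_def null_sets_distr_iff)

lemma (in product_sigma_finite) null_PiM_insert_iff:
  assumes fresh: "finite I" "i \<notin> I" and A_sets[measurable]: "A \<in> sets (PiM (insert i I) M)"
  shows "emeasure (PiM (insert i I) M) A = 0 \<longleftrightarrow> (AE g in PiM I M. AE t in M i. g(i := t) \<notin> A)"
proof -
  have indicator_meas:
    "(\<lambda>(g, t). indicator A (g(i := t)) :: ennreal) \<in> borel_measurable (PiM I M \<Otimes>\<^sub>M M i)"
    using measurable_compose[OF measurable_add_dim borel_measurable_indicator[OF A_sets]]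
    by (simp add: case_prod_unfold)
  have "emeasure (PiM (insert i I) M) A = (\<integral>\<^sup>+g. indicator A g \<partial>PiM (insert i I) M)" by simp
  also have "\<dots> = (\<integral>\<^sup>+g. \<integral>\<^sup>+t. indicator A (g(i := t)) \<partial>M i \<partial>PiM I M)"
    using fresh by (intro product_nn_integral_insert) auto
  also have "\<dots> = 0 \<longleftrightarrow> (AE g in PiM I M. (\<integral>\<^sup>+t. indicator A (g(i := t)) \<partial>M i) = 0)"
    using borel_measurable_nn_integral[OF indicator_meas] by (rule nn_integral_0_iff_AE)
  also have "\<dots> \<longleftrightarrow> (AE g in PiM I M. AE t in M i. g(i := t) \<notin> A)"
  proof (rule AE_cong)
    fix g assume g: "g \<in> space (PiM I M)"
    have "(\<lambda>t. indicator A (g(i := t)) :: ennreal) \<in> borel_measurable (M i)"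
      using measurable_compose[OF measurable_Pair1'[OF g] indicator_meas] by simp
    hence "(\<integral>\<^sup>+t. indicator A (g(i := t)) \<partial>M i) = 0
        \<longleftrightarrow> (AE t in M i. indicator A (g(i := t)) = (0::ennreal))"
      by (rule nn_integral_0_iff_AE)
    thus "(\<integral>\<^sup>+t. indicator A (g(i := t)) \<partial>M i) = 0 \<longleftrightarrow> (AE t in M i. g(i := t) \<notin> A)"
      by (simp add: indicator_eq_0_iff)
  qed
  finally show ?thesis .
qed

lemma absolutely_continuous_PiM:
  assumes prob_M: "\<And>i. prob_space (M i)" and prob_M': "\<And>i. prob_space (M' i)"
    and sets: "\<And>i. sets (M' i) = sets (M i)"
    and abs_cont: "\<And>i. absolutely_continuous (M i) (M' i)" and "finite I"
  shows "absolutely_continuous (PiM I M) (PiM I M')"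
  using \<open>finite I\<close>
proof (induction I rule: finite_induct)
  case empty
  thus ?case by (simp add: absolutely_continuous_def PiM_empty)
next
  case (insert i I)
  interpret M: product_sigma_finite M
    by (simp add: product_sigma_finite_def prob_M prob_space_imp_sigma_finite)
  interpret M': product_sigma_finite M'
    by (simp add: product_sigma_finite_def prob_M' prob_space_imp_sigma_finite)
  have sets_PiM: "sets (PiM J M') = sets (PiM J M)" for J by (intro sets_PiM_cong sets refl)
  show ?case unfolding absolutely_continuous_def
  proof
    fix A assume A_sets: "A \<in> null_sets (PiM (insert i I) M)"
    hence "AE g in PiM I M. AE t in M i. g(i := t) \<notin> A"
      using insert M.null_PiM_insert_iff[of I i A] by auto
    hence "AE g in PiM I M. AE t in M' i. g(i := t) \<notin> A"
      by eventually_elim (rule absolutely_continuous_AE[OF sets abs_cont])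
    hence "AE g in PiM I M'. AE t in M' i. g(i := t) \<notin> A"
      by (rule absolutely_continuous_AE[OF sets_PiM insert.IH])
    moreover have A_sets': "A \<in> sets (PiM (insert i I) M')" using A_sets by (auto simp: sets_PiM)
    ultimately have "emeasure (PiM (insert i I) M') A = 0"
      using M'.null_PiM_insert_iff[OF insert.hyps A_sets'] by blast
    thus "A \<in> null_sets (PiM (insert i I) M')" using A_sets' by (rule null_setsI)
  qed
qed

lemma AE_gauss_affine:
  assumes "c \<noteq> 0" and P_measurable: "Measurable.pred borel P" and AE_P: "AE t in gauss. P t"
  shows "AE t in gauss. P (a + c * t)"
proof -
  have AE_gauss_iff: "(AE t in gauss. Q t) \<longleftrightarrow> (AE t in lborel. Q t)" for Q
    by (subst AE_density) (auto simp: normal_density_pos)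
  show ?thesis using AE_P AE_borel_affine[OF \<open>c \<noteq> 0\<close> P_measurable, of a] by (simp add: AE_gauss_iff)
qed

lemma measurable_Rn_component: "j < n \<Longrightarrow> (\<lambda>x. x j) \<in> borel_measurable (Rn n)"
  by (intro measurable_component_singleton) auto

lemma measurable_dot:
  assumes "x \<in> M \<rightarrow>\<^sub>M Rn n" "y \<in> M \<rightarrow>\<^sub>M Rn n"
  shows "(\<lambda>z. dot n (x z) (y z)) \<in> borel_measurable M"
proof -
  have "(\<lambda>z. x z j) \<in> borel_measurable M" "(\<lambda>z. y z j) \<in> borel_measurable M"
    if "j < n" for j
    using assms measurable_compose[OF _ measurable_Rn_component[OF that]] by blast+
  thus ?thesis unfolding dot_def by (intro borel_measurable_sum borel_measurable_times) auto
qed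

lemma measurable_sqnorm [measurable]: "sqnorm n \<in> borel_measurable (Rn n)"
  unfolding sqnorm_eq_dot[abs_def] by (intro measurable_dot) auto

lemma measurable_fun_upd_Rn:
  assumes "j < n" "f \<in> borel_measurable (Rn n)"
  shows "(\<lambda>g. g(j := f g)) \<in> Rn n \<rightarrow>\<^sub>M Rn n"
proof (rule measurable_PiM_single')
  show "(\<lambda>g. (g(j := f g)) i) \<in> borel_measurable (Rn n)" if "i \<in> {..<n}" for i
    using assms measurable_Rn_component[of i n] that by (cases "i = j") simp_all
  show "(\<lambda>g. g(j := f g)) \<in> space (Rn n) \<rightarrow> ({..<n} \<rightarrow>\<^sub>E space borel)"
    using assms by (auto simp: space_PiM PiE_def extensional_def)
qed

lemma null_std_gaussian_iff:
  assumes "j < n" "A \<in> sets (std_gaussian n)"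
  shows "A \<in> null_sets (std_gaussian n)
    \<longleftrightarrow> (AE g in PiM ({..<n} - {j}) (\<lambda>_. gauss). AE t in gauss. g(j := t) \<notin> A)"
proof -
  interpret product_prob_space "\<lambda>_::nat. gauss" "{..<n}"
    by (intro product_prob_spaceI prob_space_gauss)
  have "insert j ({..<n} - {j}) = {..<n}" using assms(1) by auto
  thus ?thesis
    using assms(2) null_PiM_insert_iff[of "{..<n} - {j}" j A]
    by (simp add: null_sets_def std_gaussian_def)
qed

lemma measurable_fun_upd_std_gaussian:
  assumes "j < n" "g \<in> space (PiM ({..<n} - {j}) (\<lambda>_. gauss))"
  shows "(\<lambda>t. g(j := t)) \<in> borel \<rightarrow>\<^sub>M std_gaussian n"
proof -
  have "insert j ({..<n} - {j}) = {..<n}" using assms(1) by auto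
  thus ?thesis
    using measurable_compose[OF measurable_Pair1'[OF assms(2)]
        measurable_add_dim[of j "{..<n} - {j}" "\<lambda>_. gauss"]]
    by (simp add: std_gaussian_def)
qed

lemma nonsingular_coordinate_affine:
  assumes j_less: "j < n"
    and c_nonzero: "c \<noteq> 0" and [measurable]: "f \<in> borel_measurable (Rn n)"
    and f_upd: "\<And>g t. f (g(j := t)) = f g"
  shows "nonsingular (std_gaussian n) (\<lambda>g. g(j := f g + c * g j))"
proof -
  let ?G = "std_gaussian n"
  define T where "T g = g(j := f g + c * g j)" for g
  have "T \<in> Rn n \<rightarrow>\<^sub>M Rn n"
    unfolding T_def[abs_def] using j_less measurable_Rn_component[OF j_less]
    by (intro measurable_fun_upd_Rn) simp_all
  hence T_measurable[measurable]: "T \<in> ?G \<rightarrow>\<^sub>M ?G"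
    by (simp add: measurable_cong_sets[OF sets_std_gaussian sets_std_gaussian])
  have "T -` A \<inter> space ?G \<in> null_sets ?G" if A_null: "A \<in> null_sets ?G" for A
  proof -
    have A_sets[measurable]: "A \<in> sets ?G" using A_null by auto
    have "AE g in PiM ({..<n} - {j}) (\<lambda>_. gauss). AE t in gauss. g(j := t) \<notin> A"
      using A_null null_std_gaussian_iff[OF j_less A_sets] by blast
    with AE_space
    have "AE g in PiM ({..<n} - {j}) (\<lambda>_. gauss). AE t in gauss. g(j := t) \<notin> T -` A \<inter> space ?G"
    proof eventually_elim
      case (elim g)
      note measurable_fun_upd_std_gaussian[OF j_less elim(1), measurable]
      have "Measurable.pred borel (\<lambda>t. g(j := t) \<notin> A)" by measurable
      from AE_gauss_affine[OF c_nonzero this elim(2)]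
      have "AE t in gauss. g(j := f g + c * t) \<notin> A" .
      thus ?case by eventually_elim (auto simp: T_def f_upd)
    qed
    thus ?thesis by (subst null_std_gaussian_iff[OF j_less]) auto
  qed
  hence "nonsingular ?G T" using T_measurable by (auto simp: nonsingular_def)
  thus ?thesis by (simp add: T_def[abs_def])
qed

definition shear :: "(nat \<Rightarrow> real) \<Rightarrow> nat \<Rightarrow> nat set \<Rightarrow> (nat \<Rightarrow> real) \<Rightarrow> nat \<Rightarrow> real" where
  "shear a j J g = (\<lambda>i. if i \<in> J then g i + a i * g j else g i)"

lemma nonsingular_shear:
  assumes "j < n" "finite J" "J \<subseteq> {..<n} - {j}"
  shows "nonsingular (std_gaussian n) (shear a j J)"
  using assms(2,3)
proof (induction J rule: finite_induct)
  case empty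
  thus ?case using nonsingular_id by (simp add: shear_def)
next
  case (insert k J)
  have "nonsingular (std_gaussian n) (\<lambda>g. g(k := a k * g j + 1 * g k))"
    using insert.prems assms(1) measurable_Rn_component[OF assms(1)]
    by (intro nonsingular_coordinate_affine) auto
  from nonsingular_comp[OF this insert.IH]
  have "nonsingular (std_gaussian n)
      (\<lambda>g. (shear a j J g)(k := a k * shear a j J g j + 1 * shear a j J g k))"
    using insert.prems by auto
  also have "(\<lambda>g. (shear a j J g)(k := a k * shear a j J g j + 1 * shear a j J g k))
      = shear a j (insert k J)"
    using insert.hyps insert.prems by (auto simp: shear_def fun_eq_iff)
  finally show ?case .
qed

definition rank_one_map :: "nat \<Rightarrow> real \<Rightarrow> (nat \<Rightarrow> real) \<Rightarrow> (nat \<Rightarrow> real) \<Rightarrow> nat \<Rightarrow> real" where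
  "rank_one_map n c x g = (\<lambda>i\<in>{..<n}. g i + c * dot n x g * x i)"

lemma rank_one_map_zero:
  assumes "g \<in> space (Rn n)" "c = 0 \<or> (\<forall>i<n. x i = 0)"
  shows "rank_one_map n c x g = g"
  using assms by (auto simp: rank_one_map_def space_PiM PiE_def extensional_def fun_eq_iff)

text \<open>
  The shear removes the multiple of \<open>x\<close> that cancels the \<open>j\<close>-th coordinate; in the new coordinates
  \<open>x\<close> is a multiple of the \<open>j\<close>-th unit vector, so that only the \<open>j\<close>-th coordinate changes.
\<close>

lemma rank_one_map_conjugate_shear:
  fixes x g :: "nat \<Rightarrow> real"
  assumes j_nonzero: "j < n" "x j \<noteq> 0" and g_space: "g \<in> space (Rn n)"
  defines "J \<equiv> {..<n} - {j}" and "a \<equiv> \<lambda>i. x i / x j"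
  defines "u \<equiv> shear (\<lambda>i. - a i) j J g"
  shows "shear a j J (u(j := c * x j * (\<Sum>i\<in>J. x i * u i) + (1 + c * sqnorm n x) * u j))
    = rank_one_map n c x g"
proof -
  have J_insert: "{..<n} = insert j J" "j \<notin> J" "finite J" using j_nonzero by (auto simp: J_def)
  have u_j: "u j = g j" using J_insert by (simp add: u_def shear_def)
  have "dot n x g = x j * g j + (\<Sum>i\<in>J. x i * u i + (x i)\<^sup>2 * (g j / x j))"
    using J_insert j_nonzero(2)
    by (simp add: dot_def u_def shear_def a_def field_simps power2_eq_square)
  also have "x j * g j = (x j)\<^sup>2 * (g j / x j)" using j_nonzero(2) by (simp add: power2_eq_square)
  also have "(x j)\<^sup>2 * (g j / x j) + (\<Sum>i\<in>J. x i * u i + (x i)\<^sup>2 * (g j / x j))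
      = (\<Sum>i\<in>J. x i * u i) + ((x j)\<^sup>2 + (\<Sum>i\<in>J. (x i)\<^sup>2)) * (g j / x j)"
    by (simp only: sum.distrib sum_distrib_right distrib_right add_ac)
  finally have dot_eq: "dot n x g = (\<Sum>i\<in>J. x i * u i) + sqnorm n x * (g j / x j)"
    using J_insert by (simp add: sqnorm_def)
  have image_j: "c * x j * (\<Sum>i\<in>J. x i * u i) + (1 + c * sqnorm n x) * u j
      = g j + c * dot n x g * x j"
    unfolding dot_eq u_j using j_nonzero(2) by (simp add: field_simps)
  show ?thesis unfolding image_j
  proof
    fix i
    consider "i = j" | "i \<in> J" "i \<noteq> j" | "i \<notin> {..<n}" "i \<notin> J" "i \<noteq> j" using J_insert by blast
    thus "shear a j J (u(j := g j + c * dot n x g * x j)) i = rank_one_map n c x g i"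
      using J_insert j_nonzero g_space
      by cases (auto simp: shear_def rank_one_map_def u_def a_def field_simps
            space_PiM PiE_def extensional_def)
  qed
qed

lemma nonsingular_rank_one_map:
  assumes det: "1 + c * sqnorm n x \<noteq> 0"
  shows "nonsingular (std_gaussian n) (rank_one_map n c x)"
proof (cases "\<forall>j<n. x j = 0")
  case True
  thus ?thesis
    by (intro nonsingular_cong[OF _ nonsingular_id])
       (simp add: rank_one_map_zero space_std_gaussian)
next
  case False
  then obtain j where j_nonzero: "j < n" "x j \<noteq> 0" by blast
  define J where "J = {..<n} - {j}"
  define a where "a i = x i / x j" for i
  define f where "f u = c * x j * (\<Sum>i\<in>J. x i * u i)" for u :: "nat \<Rightarrow> real"
  have nonsingular_shear_J: "nonsingular (std_gaussian n) (shear b j J)" for b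
    using j_nonzero by (intro nonsingular_shear) (auto simp: J_def)
  have "nonsingular (std_gaussian n) (\<lambda>u. u(j := f u + (1 + c * sqnorm n x) * u j))"
  proof (rule nonsingular_coordinate_affine[OF j_nonzero(1) det])
    show "f \<in> borel_measurable (Rn n)"
      unfolding f_def
      by (intro borel_measurable_times borel_measurable_sum measurable_Rn_component)
         (auto simp: J_def)
    show "f (g(j := t)) = f g" for g t
      unfolding f_def by (intro arg_cong2[where f="(*)"] sum.cong refl) (auto simp: J_def)
  qed
  from nonsingular_comp[OF nonsingular_shear_J[of a]
      nonsingular_comp[OF this nonsingular_shear_J[of "\<lambda>i. - a i"]]]
  show ?thesis
    by (rule nonsingular_cong[rotated])
       (simp add: f_def J_def a_def[abs_def] rank_one_map_conjugate_shear[where x=x, OF j_nonzero]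
          space_std_gaussian)
qed

section \<open>The planted distribution as an image measure\<close>

definition gaussian_samples :: "nat \<Rightarrow> nat \<Rightarrow> (nat \<Rightarrow> nat \<Rightarrow> real) measure" where
  "gaussian_samples N n = Pi\<^sub>M {..<N} (\<lambda>_. std_gaussian n)"

definition spike_map :: "real \<Rightarrow> nat \<Rightarrow> (nat \<Rightarrow> real) \<Rightarrow> (nat \<Rightarrow> real) \<Rightarrow> nat \<Rightarrow> real" where
  "spike_map \<beta> n x = rank_one_map n (spike_coef \<beta> (sqnorm n x)) x"

definition planted_map ::
  "real \<Rightarrow> nat \<Rightarrow> nat \<Rightarrow> (nat \<Rightarrow> real) \<Rightarrow> (nat \<Rightarrow> nat \<Rightarrow> real) \<Rightarrow> nat \<Rightarrow> nat \<Rightarrow> real" where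
  "planted_map \<beta> N n x y = (\<lambda>i\<in>{..<N}. spike_map \<beta> n x (y i))"

definition planted_samples ::
  "real \<Rightarrow> nat \<Rightarrow> nat \<Rightarrow> (nat \<Rightarrow> real) measure \<Rightarrow> (nat \<Rightarrow> nat \<Rightarrow> real) measure" where
  "planted_samples \<beta> N n X =
     distr (X \<Otimes>\<^sub>M gaussian_samples N n) (gaussian_samples N n) (\<lambda>(x, y). planted_map \<beta> N n x y)"

lemma wishart_null_eq: "wishart_null \<gamma> n = gaussian_samples (num_samples \<gamma> n) n"
  by (simp add: wishart_null_def gaussian_samples_def)

lemma sets_gaussian_samples [measurable_cong]:
  "sets (gaussian_samples N n) = sets (PiM {..<N} (\<lambda>_. Rn n))"
  unfolding gaussian_samples_def by (intro sets_PiM_cong sets_std_gaussian refl)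

lemma prob_space_gaussian_samples: "prob_space (gaussian_samples N n)"
  unfolding gaussian_samples_def by (intro prob_space_PiM prob_space_std_gaussian)

lemma finite_measure_gaussian_samples: "finite_measure (gaussian_samples N n)"
  by (rule prob_space.finite_measure[OF prob_space_gaussian_samples])

lemma measurable_spike_coef [measurable]: "spike_coef \<beta> \<in> borel_measurable borel"
  unfolding spike_coef_def[abs_def] by measurable

lemma measurable_spike_map_pair:
  assumes x_measurable: "x \<in> M \<rightarrow>\<^sub>M Rn n" and g_measurable: "g \<in> M \<rightarrow>\<^sub>M Rn n"
  shows "(\<lambda>z. spike_map \<beta> n (x z) (g z)) \<in> M \<rightarrow>\<^sub>M Rn n"
  unfolding spike_map_def rank_one_map_def
proof (rule measurable_restrict)
  fix i assume "i \<in> {..<n}"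
  hence [measurable]: "(\<lambda>z. x z i) \<in> borel_measurable M" "(\<lambda>z. g z i) \<in> borel_measurable M"
    using measurable_compose[OF x_measurable measurable_Rn_component]
      measurable_compose[OF g_measurable measurable_Rn_component]
    by auto
  note x_measurable[measurable] measurable_dot[OF x_measurable g_measurable, measurable]
  show "(\<lambda>z. g z i + spike_coef \<beta> (sqnorm n (x z)) * dot n (x z) (g z) * x z i)
      \<in> borel_measurable M"
    by measurable
qed

lemma measurable_spike_map:
  "x \<in> space (Rn n) \<Longrightarrow> spike_map \<beta> n x \<in> std_gaussian n \<rightarrow>\<^sub>M std_gaussian n"
  using measurable_spike_map_pair[of "\<lambda>_. x" "std_gaussian n" n "\<lambda>g. g" \<beta>]
  by (simp add: measurable_cong_sets[OF sets_std_gaussian sets_std_gaussian])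

lemma measurable_planted_map_pair:
  assumes "sets X = sets (Rn n)"
  shows "(\<lambda>(x, y). planted_map \<beta> N n x y)
    \<in> X \<Otimes>\<^sub>M gaussian_samples N n \<rightarrow>\<^sub>M gaussian_samples N n"
proof -
  have [measurable_cong]: "sets X = sets (Rn n)" by fact
  have "(\<lambda>z. \<lambda>i\<in>{..<N}. spike_map \<beta> n (fst z) (snd z i))
      \<in> X \<Otimes>\<^sub>M gaussian_samples N n \<rightarrow>\<^sub>M PiM {..<N} (\<lambda>_. Rn n)"
  proof (rule measurable_restrict, rule measurable_spike_map_pair)
    fix i assume i: "i \<in> {..<N}"
    show "(\<lambda>z. fst z) \<in> X \<Otimes>\<^sub>M gaussian_samples N n \<rightarrow>\<^sub>M Rn n" by measurable
    have "(\<lambda>y. y i) \<in> gaussian_samples N n \<rightarrow>\<^sub>M Rn n"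
      using measurable_component_singleton[OF i, of "\<lambda>_. Rn n"] by measurable
    thus "(\<lambda>z. snd z i) \<in> X \<Otimes>\<^sub>M gaussian_samples N n \<rightarrow>\<^sub>M Rn n" by measurable
  qed
  thus ?thesis
    by (simp add: planted_map_def[abs_def] case_prod_unfold
          measurable_cong_sets[OF refl sets_gaussian_samples])
qed

lemma gaussian_spiked_cov:
  assumes "\<beta> * sqnorm n x \<ge> -1"
  shows "gaussian n (spiked_cov \<beta> x) = distr (std_gaussian n) (std_gaussian n) (spike_map \<beta> n x)"
  unfolding gaussian_def
proof (rule distr_cong)
  fix g
  have "(\<Sum>j<n. psd_sqrt n (spiked_cov \<beta> x) i j * g j)
      = mat_vec n (spiked_cov (spike_coef \<beta> (sqnorm n x)) x) g i" if "i < n" for i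
    using that by (simp add: psd_sqrt_spiked_cov[OF assms] mat_vec_def dot_def)
  thus "(\<lambda>i\<in>{..<n}. \<Sum>j<n. psd_sqrt n (spiked_cov \<beta> x) i j * g j) = spike_map \<beta> n x g"
    by (auto simp: spike_map_def rank_one_map_def mat_vec_spiked_cov)
qed (simp_all add: sets_std_gaussian)

lemma distr_planted_map_eq_PiM:
  assumes "x \<in> space (Rn n)"
  shows "distr (gaussian_samples N n) (gaussian_samples N n) (planted_map \<beta> N n x)
       = PiM {..<N} (\<lambda>_. distr (std_gaussian n) (std_gaussian n) (spike_map \<beta> n x))"
proof -
  have "planted_map \<beta> N n x = compose {..<N} (spike_map \<beta> n x)"
    by (simp add: planted_map_def compose_def fun_eq_iff)
  thus ?thesis
    unfolding gaussian_samples_def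
    by (simp only:) (rule distr_PiM_finite_prob_space',
        auto intro: prob_space_std_gaussian measurable_spike_map assms)
qed

lemma planted_kernel_eq_distr:
  assumes x_space: "x \<in> space (Rn n)"
  shows "(if \<beta> * sqnorm n x \<ge> -1 then PiM {..<N} (\<lambda>_. gaussian n (spiked_cov \<beta> x))
      else gaussian_samples N n)
    = distr (gaussian_samples N n) (gaussian_samples N n) (planted_map \<beta> N n x)"
proof (cases "\<beta> * sqnorm n x \<ge> -1")
  case True
  thus ?thesis using x_space by (simp add: distr_planted_map_eq_PiM gaussian_spiked_cov)
next
  case False
  have "distr (std_gaussian n) (std_gaussian n) (spike_map \<beta> n x)
      = distr (std_gaussian n) (std_gaussian n) (\<lambda>g. g)"
    using False
    by (intro distr_cong refl)
       (simp add: spike_map_def spike_coef_def rank_one_map_zero space_std_gaussian)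
  thus ?thesis
    using False
    by (simp add: distr_planted_map_eq_PiM[OF x_space] distr_id2) (simp add: gaussian_samples_def)
qed

lemma (in pair_prob_space) emeasure_distr_pair:
  assumes F_measurable[measurable]: "(\<lambda>(x, y). F x y) \<in> M1 \<Otimes>\<^sub>M M2 \<rightarrow>\<^sub>M R"
    and [measurable]: "A \<in> sets R"
  shows "emeasure (distr (M1 \<Otimes>\<^sub>M M2) R (\<lambda>(x, y). F x y)) A
    = (\<integral>\<^sup>+x. emeasure (distr M2 R (F x)) A \<partial>M1)"
proof -
  let ?B = "(\<lambda>(x, y). F x y) -` A \<inter> space (M1 \<Otimes>\<^sub>M M2)"
  have "emeasure (distr (M1 \<Otimes>\<^sub>M M2) R (\<lambda>(x, y). F x y)) A = emeasure (M1 \<Otimes>\<^sub>M M2) ?B"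
    by (rule emeasure_distr) measurable
  also have "\<dots> = (\<integral>\<^sup>+x. emeasure M2 (Pair x -` ?B) \<partial>M1)"
    by (rule M2.emeasure_pair_measure_alt) measurable
  also have "\<dots> = (\<integral>\<^sup>+x. emeasure (distr M2 R (F x)) A \<partial>M1)"
  proof (rule nn_integral_cong)
    fix x assume x: "x \<in> space M1"
    have "F x \<in> M2 \<rightarrow>\<^sub>M R" using measurable_compose[OF measurable_Pair1'[OF x] F_measurable] by simp
    moreover have "Pair x -` ?B = F x -` A \<inter> space M2" using x by (auto simp: space_pair_measure)
    ultimately show "emeasure M2 (Pair x -` ?B) = emeasure (distr M2 R (F x)) A"
      by (simp add: emeasure_distr)
  qed
  finally show ?thesis .
qed

lemma (in pair_prob_space) bind_distr_eq_distr_pair: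
  assumes F_measurable: "(\<lambda>(x, y). F x y) \<in> M1 \<Otimes>\<^sub>M M2 \<rightarrow>\<^sub>M R"
  shows "M1 \<bind> (\<lambda>x. distr M2 R (F x)) = distr (M1 \<Otimes>\<^sub>M M2) R (\<lambda>(x, y). F x y)"
proof (rule measure_eqI)
  have kernel: "(\<lambda>x. distr M2 R (F x)) \<in> M1 \<rightarrow>\<^sub>M subprob_algebra R"
    by (rule measurable_distr2[OF F_measurable])
       (auto simp: space_subprob_algebra intro: M2.subprob_space_axioms)
  have "sets (M1 \<bind> (\<lambda>x. distr M2 R (F x))) = sets R"
    using M1.not_empty by (intro sets_bind) auto
  thus "sets (M1 \<bind> (\<lambda>x. distr M2 R (F x))) = sets (distr (M1 \<Otimes>\<^sub>M M2) R (\<lambda>(x, y). F x y))"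
    and "A \<in> sets (M1 \<bind> (\<lambda>x. distr M2 R (F x))) \<Longrightarrow>
      emeasure (M1 \<bind> (\<lambda>x. distr M2 R (F x))) A
        = emeasure (distr (M1 \<Otimes>\<^sub>M M2) R (\<lambda>(x, y). F x y)) A" for A
    by (simp_all only: sets_distr emeasure_distr_pair[OF F_measurable]
          emeasure_bind[OF M1.not_empty kernel])
qed

lemma (in pair_prob_space) absolutely_continuous_distr_pair:
  assumes F_measurable: "(\<lambda>(x, y). F x y) \<in> M1 \<Otimes>\<^sub>M M2 \<rightarrow>\<^sub>M R"
    and abs_cont: "AE x in M1. absolutely_continuous R (distr M2 R (F x))"
  shows "absolutely_continuous R (distr (M1 \<Otimes>\<^sub>M M2) R (\<lambda>(x, y). F x y))"
  unfolding absolutely_continuous_def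
proof
  fix A assume A_null: "A \<in> null_sets R"
  have "emeasure (distr (M1 \<Otimes>\<^sub>M M2) R (\<lambda>(x, y). F x y)) A
      = (\<integral>\<^sup>+x. emeasure (distr M2 R (F x)) A \<partial>M1)"
    using A_null by (intro emeasure_distr_pair[OF F_measurable]) auto
  also have "\<dots> = (\<integral>\<^sup>+x. 0 \<partial>M1)"
    using abs_cont
    by (intro nn_integral_cong_AE, eventually_elim)
       (use A_null in \<open>auto simp: absolutely_continuous_def\<close>)
  finally show "A \<in> null_sets (distr (M1 \<Otimes>\<^sub>M M2) R (\<lambda>(x, y). F x y))"
    using A_null by (intro null_setsI) auto
qed

lemma wishart_planted_eq:
  assumes prob_X: "prob_space (X n)" and sets_X: "sets (X n) = sets (Rn n)"
  shows "wishart_planted \<gamma> \<beta> X n = planted_samples \<beta> (num_samples \<gamma> n) n (X n)"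
proof -
  let ?N = "num_samples \<gamma> n"
  let ?Q = "gaussian_samples ?N n"
  interpret pair_prob_space "X n" ?Q
    by (intro pair_prob_spaceI prob_X prob_space_gaussian_samples)
  have "wishart_planted \<gamma> \<beta> X n = X n \<bind> (\<lambda>x. distr ?Q ?Q (planted_map \<beta> ?N n x))"
    unfolding wishart_planted_def wishart_null_eq
    by (rule bind_cong) (auto simp: sets_eq_imp_space_eq[OF sets_X] planted_kernel_eq_distr)
  thus ?thesis
    unfolding planted_samples_def
    by (simp only: bind_distr_eq_distr_pair[OF measurable_planted_map_pair[OF sets_X]])
qed

locale spiked_model =
  fixes \<beta> :: real and N n :: nat and X :: "(nat \<Rightarrow> real) measure"
  assumes prob_space_prior: "prob_space X" and sets_prior: "sets X = sets (Rn n)"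
    and AE_prior: "AE x in X. \<beta> * sqnorm n x > -1"
begin

abbreviation null :: "(nat \<Rightarrow> nat \<Rightarrow> real) measure" where
  "null \<equiv> gaussian_samples N n"

abbreviation planted :: "(nat \<Rightarrow> nat \<Rightarrow> real) measure" where
  "planted \<equiv> planted_samples \<beta> N n X"

lemma space_prior: "space X = space (Rn n)"
  by (rule sets_eq_imp_space_eq[OF sets_prior])

sublocale null: prob_space null
  by (rule prob_space_gaussian_samples)

sublocale joint: pair_prob_space X null
  by (intro pair_prob_spaceI prob_space_prior null.prob_space_axioms)

lemmas measurable_planted_map = measurable_planted_map_pair[OF sets_prior, of \<beta> N]

sublocale planted: prob_space planted
  unfolding planted_samples_def by (rule joint.prob_space_distr[OF measurable_planted_map])

lemma sets_planted: "sets planted = sets null"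
  by (simp add: planted_samples_def)

lemma absolutely_continuous_planted: "absolutely_continuous null planted"
  unfolding planted_samples_def
proof (rule joint.absolutely_continuous_distr_pair[OF measurable_planted_map])
  show "AE x in X. absolutely_continuous null (distr null null (planted_map \<beta> N n x))"
    using AE_prior AE_space
  proof eventually_elim
    case (elim x)
    hence x_space: "x \<in> space (Rn n)" by (simp add: space_prior)
    have "1 + spike_coef \<beta> (sqnorm n x) * sqnorm n x \<noteq> 0"
      using elim by (simp add: one_plus_spike_coef)
    hence "nonsingular (std_gaussian n) (spike_map \<beta> n x)"
      unfolding spike_map_def by (rule nonsingular_rank_one_map)
    hence "absolutely_continuous (PiM {..<N} (\<lambda>_. std_gaussian n))
        (PiM {..<N} (\<lambda>_. distr (std_gaussian n) (std_gaussian n) (spike_map \<beta> n x)))"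
      by (intro absolutely_continuous_PiM nonsingular_imp_absolutely_continuous
          prob_space_std_gaussian prob_space.prob_space_distr measurable_spike_map x_space) auto
    thus ?case by (simp add: distr_planted_map_eq_PiM[OF x_space]) (simp add: gaussian_samples_def)
  qed
qed

end

section \<open>Projections onto the span of an orthogonal family\<close>

definition lin_span :: "'i set \<Rightarrow> ('i \<Rightarrow> 'a \<Rightarrow> real) \<Rightarrow> ('a \<Rightarrow> real) set" where
  "lin_span I h = {q. \<exists>c. q = (\<lambda>y. \<Sum>\<alpha>\<in>I. c \<alpha> * h \<alpha> y)}"

lemma lin_spanI: "(\<And>y. q y = (\<Sum>\<alpha>\<in>I. c \<alpha> * h \<alpha> y)) \<Longrightarrow> q \<in> lin_span I h"
  unfolding lin_span_def by blast

lemma lin_spanE: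
  assumes "q \<in> lin_span I h"
  obtains c where "q = (\<lambda>y. \<Sum>\<alpha>\<in>I. c \<alpha> * h \<alpha> y)"
  using assms unfolding lin_span_def by blast

lemma lin_span_base:
  assumes "finite I" "\<alpha> \<in> I"
  shows "h \<alpha> \<in> lin_span I h"
proof (rule lin_spanI)
  show "h \<alpha> y = (\<Sum>\<alpha>'\<in>I. (if \<alpha>' = \<alpha> then 1 else 0) * h \<alpha>' y)" for y
    using assms by (simp add: mult_delta_left)
qed

lemma lin_span_combination:
  assumes "\<And>a. a \<in> A \<Longrightarrow> f a \<in> lin_span I h"
  shows "(\<lambda>y. \<Sum>a\<in>A. c a * f a y) \<in> lin_span I h"
proof -
  have "\<forall>a\<in>A. \<exists>e. f a = (\<lambda>y. \<Sum>\<alpha>\<in>I. e \<alpha> * h \<alpha> y)" using assms by (auto elim: lin_spanE)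
  then obtain e where f_eq: "\<And>a. a \<in> A \<Longrightarrow> f a = (\<lambda>y. \<Sum>\<alpha>\<in>I. e a \<alpha> * h \<alpha> y)" by metis
  show ?thesis
  proof (rule lin_spanI)
    fix y
    have "(\<Sum>a\<in>A. c a * f a y) = (\<Sum>a\<in>A. \<Sum>\<alpha>\<in>I. c a * e a \<alpha> * h \<alpha> y)"
      by (intro sum.cong refl) (simp add: f_eq sum_distrib_left mult.assoc)
    also have "\<dots> = (\<Sum>\<alpha>\<in>I. (\<Sum>a\<in>A. c a * e a \<alpha>) * h \<alpha> y)"
      by (subst sum.swap) (simp add: sum_distrib_right)
    finally show "(\<Sum>a\<in>A. c a * f a y) = (\<Sum>\<alpha>\<in>I. (\<Sum>a\<in>A. c a * e a \<alpha>) * h \<alpha> y)" .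
  qed
qed

lemma lin_span_subset:
  assumes "\<And>a. a \<in> A \<Longrightarrow> f a \<in> lin_span I h"
  shows "lin_span A f \<subseteq> lin_span I h"
  using assms by (auto elim!: lin_spanE intro: lin_span_combination)

locale orthogonal_family =
  fixes Q :: "'a measure" and I :: "'i set" and h :: "'i \<Rightarrow> 'a \<Rightarrow> real" and w :: "'i \<Rightarrow> real"
  assumes finite_family: "finite I"
    and integrable_product: "\<alpha> \<in> I \<Longrightarrow> \<alpha>' \<in> I \<Longrightarrow> integrable Q (\<lambda>y. h \<alpha> y * h \<alpha>' y)"
    and orthogonal: "\<alpha> \<in> I \<Longrightarrow> \<alpha>' \<in> I \<Longrightarrow>
      (\<integral>y. h \<alpha> y * h \<alpha>' y \<partial>Q) = (if \<alpha> = \<alpha>' then w \<alpha> else 0)"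
    and weight_pos: "\<alpha> \<in> I \<Longrightarrow> w \<alpha> > 0"
begin

definition combination :: "('i \<Rightarrow> real) \<Rightarrow> 'a \<Rightarrow> real" where
  "combination c y = (\<Sum>\<alpha>\<in>I. c \<alpha> * h \<alpha> y)"

lemma lin_span_iff: "q \<in> lin_span I h \<longleftrightarrow> (\<exists>c. q = combination c)"
  by (simp add: lin_span_def combination_def[abs_def])

lemma has_bochner_integral_combination_mult:
  assumes "\<alpha> \<in> I"
  shows "has_bochner_integral Q (\<lambda>y. combination c y * h \<alpha> y) (c \<alpha> * w \<alpha>)"
proof -
  have "has_bochner_integral Q (\<lambda>y. \<Sum>\<alpha>'\<in>I. c \<alpha>' * (h \<alpha>' y * h \<alpha> y))
      (\<Sum>\<alpha>'\<in>I. c \<alpha>' * (if \<alpha>' = \<alpha> then w \<alpha>' else 0))"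
    using assms
    by (intro has_bochner_integral_sum has_bochner_integral_mult_right)
       (simp add: has_bochner_integral_iff integrable_product orthogonal)
  thus ?thesis
    using assms finite_family
    by (simp add: combination_def sum_distrib_right mult.assoc mult_delta_right)
qed

lemma is_orth_projE:
  assumes "is_orth_proj Q (lin_span I h) L p"
  obtains c where "p = combination c"
  using assms by (auto simp: is_orth_proj_def lin_span_iff)

lemma has_bochner_integral_orth_proj_mult:
  assumes proj: "is_orth_proj Q (lin_span I h) L p" and "\<alpha> \<in> I"
  shows "has_bochner_integral Q (\<lambda>y. L y * h \<alpha> y) (\<integral>y. p y * h \<alpha> y \<partial>Q)"
proof -
  have "has_bochner_integral Q (\<lambda>y. (L y - p y) * h \<alpha> y) 0"
    using proj lin_span_base[OF finite_family \<open>\<alpha> \<in> I\<close>] by (auto simp: is_orth_proj_def)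
  moreover obtain c where "p = combination c" using proj by (rule is_orth_projE)
  hence "has_bochner_integral Q (\<lambda>y. p y * h \<alpha> y) (\<integral>y. p y * h \<alpha> y \<partial>Q)"
    using has_bochner_integral_combination_mult[OF \<open>\<alpha> \<in> I\<close>] by (auto simp: has_bochner_integral_iff)
  ultimately have "has_bochner_integral Q (\<lambda>y. (L y - p y) * h \<alpha> y + p y * h \<alpha> y)
      (0 + (\<integral>y. p y * h \<alpha> y \<partial>Q))"
    by (rule has_bochner_integral_add)
  thus ?thesis by (simp add: algebra_simps)
qed

lemma L2_norm_orth_proj:
  assumes proj: "is_orth_proj Q (lin_span I h) L p"
  shows "L2_norm Q p = sqrt (\<Sum>\<alpha>\<in>I. (\<integral>y. L y * h \<alpha> y \<partial>Q)\<^sup>2 / w \<alpha>)"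
proof -
  obtain c where p_eq: "p = combination c" using proj by (rule is_orth_projE)
  have coefficient: "(\<integral>y. L y * h \<alpha> y \<partial>Q) = c \<alpha> * w \<alpha>" if "\<alpha> \<in> I" for \<alpha>
    using has_bochner_integral_orth_proj_mult[OF proj that]
      has_bochner_integral_combination_mult[OF that, of c]
    by (simp add: p_eq has_bochner_integral_iff)
  have "has_bochner_integral Q (\<lambda>y. \<Sum>\<alpha>\<in>I. c \<alpha> * (p y * h \<alpha> y)) (\<Sum>\<alpha>\<in>I. c \<alpha> * (c \<alpha> * w \<alpha>))"
    unfolding p_eq
    by (intro has_bochner_integral_sum has_bochner_integral_mult_right
          has_bochner_integral_combination_mult)
  moreover have "(\<Sum>\<alpha>\<in>I. c \<alpha> * (p y * h \<alpha> y)) = (p y)\<^sup>2" for y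
    unfolding power2_eq_square
    by (subst (3) p_eq) (simp add: combination_def sum_distrib_left mult_ac)
  ultimately have "(\<integral>y. (p y)\<^sup>2 \<partial>Q) = (\<Sum>\<alpha>\<in>I. c \<alpha> * (c \<alpha> * w \<alpha>))"
    by (simp add: has_bochner_integral_iff)
  also have "\<dots> = (\<Sum>\<alpha>\<in>I. (\<integral>y. L y * h \<alpha> y \<partial>Q)\<^sup>2 / w \<alpha>)"
    using weight_pos by (intro sum.cong refl) (fastforce simp: coefficient power2_eq_square)
  finally show ?thesis by (simp add: L2_norm_def)
qed

lemma is_orth_proj_combination:
  assumes integrable_L: "\<And>\<alpha>. \<alpha> \<in> I \<Longrightarrow> integrable Q (\<lambda>y. L y * h \<alpha> y)"
  defines "c \<equiv> \<lambda>\<alpha>. (\<integral>y. L y * h \<alpha> y \<partial>Q) / w \<alpha>"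
  shows "is_orth_proj Q (lin_span I h) L (combination c)"
  unfolding is_orth_proj_def
proof (intro conjI ballI)
  show "combination c \<in> lin_span I h" by (auto simp: lin_span_iff)
  fix q assume "q \<in> lin_span I h"
  then obtain e where q_eq: "q = combination e" by (auto simp: lin_span_iff)
  have "has_bochner_integral Q (\<lambda>y. L y * h \<alpha> y - combination c y * h \<alpha> y) (c \<alpha> * w \<alpha> - c \<alpha> * w \<alpha>)"
    if "\<alpha> \<in> I" for \<alpha>
    using integrable_L[OF that] weight_pos[OF that] has_bochner_integral_combination_mult[OF that, of c]
    by (intro has_bochner_integral_diff) (simp_all add: has_bochner_integral_iff c_def)
  hence "has_bochner_integral Q (\<lambda>y. \<Sum>\<alpha>\<in>I. e \<alpha> * (L y * h \<alpha> y - combination c y * h \<alpha> y))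
      (\<Sum>\<alpha>\<in>I. e \<alpha> * 0)"
    by (intro has_bochner_integral_sum has_bochner_integral_mult_right) simp
  moreover have "(\<Sum>\<alpha>\<in>I. e \<alpha> * (L y * h \<alpha> y - combination c y * h \<alpha> y))
      = (L y - combination c y) * q y" for y
    unfolding q_eq combination_def[of e] by (simp add: sum_distrib_left algebra_simps)
  ultimately show "has_bochner_integral Q (\<lambda>y. (L y - combination c y) * q y) 0" by simp
qed

lemma proj_norm_eq:
  assumes "\<And>\<alpha>. \<alpha> \<in> I \<Longrightarrow> integrable Q (\<lambda>y. L y * h \<alpha> y)"
  shows "proj_norm Q (lin_span I h) L = ennreal (sqrt (\<Sum>\<alpha>\<in>I. (\<integral>y. L y * h \<alpha> y \<partial>Q)\<^sup>2 / w \<alpha>))"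
proof -
  have proj_exists: "\<exists>p. is_orth_proj Q (lin_span I h) L p"
    using is_orth_proj_combination[OF assms] by blast
  show ?thesis
    using proj_exists L2_norm_orth_proj[OF someI_ex[OF proj_exists]] by (simp add: proj_norm_def)
qed

lemma proj_norm_infinite:
  assumes "\<alpha> \<in> I" "\<not> integrable Q (\<lambda>y. L y * h \<alpha> y)"
  shows "proj_norm Q (lin_span I h) L = \<infinity>"
  using assms has_bochner_integral_orth_proj_mult
  by (auto simp: proj_norm_def has_bochner_integral_iff)

end

section \<open>Polynomials in terms of Hermite products\<close>

definition exponents :: "nat \<Rightarrow> nat \<Rightarrow> nat \<Rightarrow> (nat \<Rightarrow> nat \<Rightarrow> nat) set" where
  "exponents N n D = {\<alpha> \<in> {..<N} \<rightarrow>\<^sub>E ({..<n} \<rightarrow>\<^sub>E UNIV). (\<Sum>i<N. \<Sum>j<n. \<alpha> i j) \<le> D}"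

lemma finite_exponents: "finite (exponents N n D)"
proof (rule finite_subset)
  show "exponents N n D \<subseteq> {..<N} \<rightarrow>\<^sub>E ({..<n} \<rightarrow>\<^sub>E {..D})"
  proof
    fix \<alpha> assume \<alpha>: "\<alpha> \<in> exponents N n D"
    have "\<alpha> i j \<le> D" if "i < N" "j < n" for i j
    proof -
      have "\<alpha> i j \<le> (\<Sum>j<n. \<alpha> i j)" using that by (intro member_le_sum) auto
      also have "\<dots> \<le> (\<Sum>i<N. \<Sum>j<n. \<alpha> i j)"
        using that by (intro member_le_sum[of i "{..<N}" "\<lambda>i. \<Sum>j<n. \<alpha> i j"]) auto
      finally show ?thesis using \<alpha> by (simp add: exponents_def)
    qed
    thus "\<alpha> \<in> {..<N} \<rightarrow>\<^sub>E ({..<n} \<rightarrow>\<^sub>E {..D})"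
      using \<alpha> by (auto simp: exponents_def PiE_iff)
  qed
qed (intro finite_PiE finite_lessThan finite_atMost)

lemma triangular_product_in_span:
  fixes f g :: "nat \<Rightarrow> real \<Rightarrow> real"
  assumes triangular: "\<And>m. \<exists>c. \<forall>t. f m t = (\<Sum>k\<le>m. c k * g k t)"
    and \<alpha>_exponents: "\<alpha> \<in> exponents N n D"
  shows "(\<lambda>y. \<Prod>i<N. \<Prod>j<n. f (\<alpha> i j) (y i j))
    \<in> lin_span (exponents N n D) (\<lambda>\<kappa> y. \<Prod>i<N. \<Prod>j<n. g (\<kappa> i j) (y i j))"
proof -
  let ?box = "PiE {..<N} (\<lambda>i. PiE {..<n} (\<lambda>j. {..\<alpha> i j}))"
  let ?g = "\<lambda>\<kappa> y. \<Prod>i<N. \<Prod>j<n. g (\<kappa> i j) (y i j)"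
  from triangular obtain c where expansion: "\<And>m t. f m t = (\<Sum>k\<le>m. c m k * g k t)" by metis
  let ?c = "\<lambda>\<kappa>. \<Prod>i<N. \<Prod>j<n. c (\<alpha> i j) (\<kappa> i j)"
  have box_subset: "?box \<subseteq> exponents N n D"
  proof
    fix \<kappa> assume \<kappa>: "\<kappa> \<in> ?box"
    have "(\<Sum>i<N. \<Sum>j<n. \<kappa> i j) \<le> (\<Sum>i<N. \<Sum>j<n. \<alpha> i j)"
      using \<kappa> by (intro sum_mono) (fastforce simp: PiE_iff)
    thus "\<kappa> \<in> exponents N n D" using \<kappa> \<alpha>_exponents by (auto simp: exponents_def PiE_iff)
  qed
  show ?thesis
  proof (rule lin_spanI)
    fix y :: "nat \<Rightarrow> nat \<Rightarrow> real"
    have "(\<Prod>i<N. \<Prod>j<n. f (\<alpha> i j) (y i j)) = (\<Sum>\<kappa>\<in>?box. ?c \<kappa> * ?g \<kappa> y)"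
      by (simp add: expansion prod_sum_PiE finite_PiE prod.distrib)
    also have "\<dots> = (\<Sum>\<kappa>\<in>exponents N n D. (if \<kappa> \<in> ?box then ?c \<kappa> else 0) * ?g \<kappa> y)"
      using box_subset finite_exponents by (intro sum.mono_neutral_cong_left) auto
    finally show "(\<Prod>i<N. \<Prod>j<n. f (\<alpha> i j) (y i j))
      = (\<Sum>\<kappa>\<in>exponents N n D. (if \<kappa> \<in> ?box then ?c \<kappa> else 0) * ?g \<kappa> y)" .
  qed
qed

definition hermite_prod :: "nat \<Rightarrow> nat \<Rightarrow> (nat \<Rightarrow> nat \<Rightarrow> nat) \<Rightarrow> (nat \<Rightarrow> nat \<Rightarrow> real) \<Rightarrow> real" where
  "hermite_prod N n \<alpha> y = (\<Prod>i<N. multi_hermite n (\<alpha> i) (y i))"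

lemma polys_upto_eq_monomial_span:
  "polys_upto N n D = lin_span (exponents N n D) (\<lambda>\<alpha> y. \<Prod>i<N. \<Prod>j<n. y i j ^ \<alpha> i j)"
proof (intro equalityI subsetI)
  let ?monomial = "\<lambda>\<alpha> y. \<Prod>i<N. \<Prod>j<n. y i j ^ \<alpha> i j :: real"
  fix q assume "q \<in> polys_upto N n D"
  then obtain A c where degree_A: "\<forall>\<alpha>\<in>A. (\<Sum>i<N. \<Sum>j<n. \<alpha> i j) \<le> D"
    and q_eq: "q = (\<lambda>y. \<Sum>\<alpha>\<in>A. c \<alpha> * ?monomial \<alpha> y)"
    by (auto simp: polys_upto_def)
  have "?monomial \<alpha> \<in> lin_span (exponents N n D) ?monomial" if "\<alpha> \<in> A" for \<alpha>
  proof -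
    define \<alpha>' where "\<alpha>' = (\<lambda>i\<in>{..<N}. \<lambda>j\<in>{..<n}. \<alpha> i j)"
    have "\<alpha>' \<in> exponents N n D" using degree_A that by (simp add: exponents_def \<alpha>'_def)
    moreover have "?monomial \<alpha> = ?monomial \<alpha>'" by (simp add: \<alpha>'_def)
    ultimately show ?thesis
      using lin_span_base[OF finite_exponents, of \<alpha>' N n D ?monomial] by (simp only:)
  qed
  thus "q \<in> lin_span (exponents N n D) ?monomial" unfolding q_eq by (rule lin_span_combination)
next
  fix q :: "(nat \<Rightarrow> nat \<Rightarrow> real) \<Rightarrow> real"
  assume "q \<in> lin_span (exponents N n D) (\<lambda>\<alpha> y. \<Prod>i<N. \<Prod>j<n. y i j ^ \<alpha> i j)"
  then obtain c where q_eq: "q = (\<lambda>y. \<Sum>\<alpha>\<in>exponents N n D. c \<alpha> * (\<Prod>i<N. \<Prod>j<n. y i j ^ \<alpha> i j))"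
    by (rule lin_spanE)
  show "q \<in> polys_upto N n D"
    unfolding polys_upto_def mem_Collect_eq
    by (intro exI[of _ "exponents N n D"] exI[of _ c] conjI finite_exponents q_eq)
       (simp add: exponents_def)
qed

lemma polys_upto_eq_hermite_span:
  "polys_upto N n D = lin_span (exponents N n D) (hermite_prod N n)"
  unfolding polys_upto_eq_monomial_span
proof
  have hermite_prod_eq: "hermite_prod N n = (\<lambda>\<alpha> y. \<Prod>i<N. \<Prod>j<n. poly (hermite (\<alpha> i j)) (y i j))"
    by (simp add: hermite_prod_def multi_hermite_def fun_eq_iff)
  show "lin_span (exponents N n D) (\<lambda>\<alpha> y. \<Prod>i<N. \<Prod>j<n. y i j ^ \<alpha> i j)
      \<subseteq> lin_span (exponents N n D) (hermite_prod N n)"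
    unfolding hermite_prod_eq
    by (intro lin_span_subset triangular_product_in_span[where f="\<lambda>m t. t ^ m"] power_eq_hermite_sum)
  show "lin_span (exponents N n D) (hermite_prod N n)
      \<subseteq> lin_span (exponents N n D) (\<lambda>\<alpha> y. \<Prod>i<N. \<Prod>j<n. y i j ^ \<alpha> i j)"
    unfolding hermite_prod_eq
    by (intro lin_span_subset triangular_product_in_span[where g="\<lambda>m t. t ^ m"] hermite_eq_power_sum)
qed

section \<open>Compositions and the multinomial theorem\<close>

definition compositions :: "'i set \<Rightarrow> nat \<Rightarrow> ('i \<Rightarrow> nat) set" where
  "compositions I m = {a \<in> I \<rightarrow>\<^sub>E UNIV. (\<Sum>i\<in>I. a i) = m}"

lemma sum_compositions: "a \<in> compositions I m \<Longrightarrow> (\<Sum>i\<in>I. a i) = m"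
  by (simp add: compositions_def)

lemma finite_compositions:
  assumes "finite I" shows "finite (compositions I m)"
proof (rule finite_subset)
  show "compositions I m \<subseteq> I \<rightarrow>\<^sub>E {..m}"
  proof
    fix a assume a: "a \<in> compositions I m"
    have "a i \<le> m" if "i \<in> I" for i
      using a that assms member_le_sum[of i I a] by (auto simp: compositions_def)
    thus "a \<in> I \<rightarrow>\<^sub>E {..m}" using a by (auto simp: compositions_def PiE_iff)
  qed
qed (intro finite_PiE assms finite_atMost)

lemma compositions_empty: "compositions {} m = (if m = 0 then {\<lambda>_. undefined} else {})"
  by (auto simp: compositions_def)

lemma compositions_insert:
  assumes fresh: "finite I" "i \<notin> I"
  shows "compositions (insert i I) m
    = (\<lambda>(k, b). b(i := k)) ` (SIGMA k:{..m}. compositions I (m - k))"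
proof (intro equalityI subsetI)
  fix a assume a_compositions: "a \<in> compositions (insert i I) m"
  define b where "b = restrict a I"
  have "a = b(i := a i)" using a_compositions
    by (auto simp: b_def compositions_def PiE_iff extensional_def fun_eq_iff)
  moreover have "(a i, b) \<in> (SIGMA k:{..m}. compositions I (m - k))"
    using a_compositions fresh by (auto simp: b_def compositions_def)
  ultimately show "a \<in> (\<lambda>(k, b). b(i := k)) ` (SIGMA k:{..m}. compositions I (m - k))"
    by (metis (no_types, lifting) case_prod_conv image_eqI)
next
  fix a assume "a \<in> (\<lambda>(k, b). b(i := k)) ` (SIGMA k:{..m}. compositions I (m - k))"
  then obtain k b where decomposition: "k \<le> m" "b \<in> compositions I (m - k)" "a = b(i := k)" by auto
  have "(\<Sum>j\<in>I. a j) = (\<Sum>j\<in>I. b j)" using decomposition fresh by (intro sum.cong) auto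
  thus "a \<in> compositions (insert i I) m"
    using decomposition fresh by (auto simp: compositions_def PiE_iff extensional_def)
qed

lemma sum_prod_compositions_insert:
  fixes f :: "'i \<Rightarrow> nat \<Rightarrow> 'a::comm_semiring_1"
  assumes fresh: "finite I" "i \<notin> I"
  shows "(\<Sum>a\<in>compositions (insert i I) m. \<Prod>j\<in>insert i I. f j (a j))
    = (\<Sum>k\<le>m. f i k * (\<Sum>a\<in>compositions I (m - k). \<Prod>j\<in>I. f j (a j)))"
proof -
  have "inj_on (\<lambda>(k, b). b(i := k)) (UNIV \<times> (I \<rightarrow>\<^sub>E (UNIV :: nat set)))"
    using inj_combinator[OF fresh(2), of "\<lambda>_. UNIV :: nat set"] by simp
  hence inj: "inj_on (\<lambda>(k, b). b(i := k)) (SIGMA k:{..m}. compositions I (m - k))"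
    by (rule inj_on_subset) (auto simp: compositions_def)
  have "(\<Sum>a\<in>compositions (insert i I) m. \<Prod>j\<in>insert i I. f j (a j))
      = (\<Sum>(k, b)\<in>(SIGMA k:{..m}. compositions I (m - k)). f i k * (\<Prod>j\<in>I. f j (b j)))"
    unfolding compositions_insert[OF fresh] using fresh
    by (subst sum.reindex[OF inj]) (auto intro!: sum.cong arg_cong2[where f="(*)"] prod.cong)
  thus ?thesis
    using fresh by (simp add: sum.Sigma[symmetric] finite_compositions sum_distrib_left)
qed

lemma multinomial_compositions:
  fixes u :: "'i \<Rightarrow> 'a::field_char_0"
  assumes "finite I"
  shows "(\<Sum>a\<in>compositions I m. \<Prod>i\<in>I. u i ^ a i / fact (a i)) = (\<Sum>i\<in>I. u i) ^ m / fact m"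
  using assms
proof (induction I arbitrary: m rule: finite_induct)
  case empty
  thus ?case by (simp add: compositions_empty)
next
  case (insert i I)
  have "(\<Sum>a\<in>compositions (insert i I) m. \<Prod>j\<in>insert i I. u j ^ a j / fact (a j))
      = (\<Sum>k\<le>m. u i ^ k / fact k * ((\<Sum>j\<in>I. u j) ^ (m - k) / fact (m - k)))"
    using insert sum_prod_compositions_insert[of I i "\<lambda>j k. u j ^ k / fact k"] by simp
  also have "\<dots> = (\<Sum>k\<le>m. of_nat (m choose k) * u i ^ k * (\<Sum>j\<in>I. u j) ^ (m - k)) / fact m"
    by (simp add: sum_divide_distrib, intro sum.cong refl) (simp add: binomial_fact divide_simps)
  also have "\<dots> = (u i + (\<Sum>j\<in>I. u j)) ^ m / fact m" by (simp add: binomial_ring)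
  finally show ?case using insert by simp
qed

lemma wick_odd: "odd d \<Longrightarrow> wick \<beta> d = 0"
  by (induction \<beta> d rule: wick.induct) auto

lemma wick_even_nonzero: "\<beta> \<noteq> 0 \<Longrightarrow> even d \<Longrightarrow> wick \<beta> d \<noteq> 0"
  by (induction \<beta> d rule: wick.induct) (auto simp del: of_nat_Suc)

definition wick_weight :: "real \<Rightarrow> nat \<Rightarrow> real" where
  "wick_weight \<beta> d = (wick \<beta> d)\<^sup>2 / fact d"

lemma wick_weight_odd: "odd d \<Longrightarrow> wick_weight \<beta> d = 0"
  by (simp add: wick_weight_def wick_odd)

definition overlap_coef :: "real \<Rightarrow> nat \<Rightarrow> nat \<Rightarrow> real" where
  "overlap_coef \<beta> N k = (\<beta>\<^sup>2) ^ k * (pochhammer (real N / 2) k / fact k)"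

lemma overlap_coef_nonneg: "overlap_coef \<beta> N k \<ge> 0"
  by (simp add: overlap_coef_def pochhammer_prod prod_nonneg)

lemma wick_weight_even: "wick_weight \<beta> (2 * k) = overlap_coef \<beta> 1 k"
proof (induction k)
  case (Suc k)
  have "wick_weight \<beta> (2 * Suc k)
      = \<beta>\<^sup>2 * ((2 * real k + 1) / (2 * real k + 2)) * wick_weight \<beta> (2 * k)"
    by (simp add: wick_weight_def divide_simps)
       (simp add: power2_eq_square algebra_simps)
  also have "\<dots> = overlap_coef \<beta> 1 (Suc k)"
    unfolding Suc.IH
    by (simp add: overlap_coef_def pochhammer_Suc divide_simps) (simp add: algebra_simps)
  finally show ?case .
qed (simp add: wick_weight_def overlap_coef_def)

lemma sum_overlap_coef_convolution:
  "(\<Sum>j\<le>k. overlap_coef \<beta> M j * overlap_coef \<beta> N (k - j)) = overlap_coef \<beta> (M + N) k"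
proof -
  have "overlap_coef \<beta> M j * overlap_coef \<beta> N (k - j)
      = (\<beta>\<^sup>2) ^ k
        * (of_nat (k choose j) * pochhammer (real M / 2) j * pochhammer (real N / 2) (k - j)) / fact k"
    if "j \<le> k" for j
  proof -
    have "overlap_coef \<beta> M j * overlap_coef \<beta> N (k - j)
        = ((\<beta>\<^sup>2) ^ j * (\<beta>\<^sup>2) ^ (k - j)) *
          (1 / (fact j * fact (k - j))
            * (pochhammer (real M / 2) j * pochhammer (real N / 2) (k - j)))"
      by (simp add: overlap_coef_def)
    also have "(\<beta>\<^sup>2) ^ j * (\<beta>\<^sup>2) ^ (k - j) = (\<beta>\<^sup>2) ^ k"
      using that by (simp flip: power_add)
    also have "1 / (fact j * fact (k - j)) = real (k choose j) / fact k"
      using that by (simp add: binomial_fact)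
    finally show ?thesis by simp
  qed
  hence "(\<Sum>j\<le>k. overlap_coef \<beta> M j * overlap_coef \<beta> N (k - j))
      = (\<beta>\<^sup>2) ^ k * (pochhammer (real M / 2 + real N / 2) k / fact k)"
    by (simp add: pochhammer_binomial_sum sum_distrib_left sum_divide_distrib)
  thus ?thesis by (simp add: overlap_coef_def add_divide_distrib)
qed

definition degree_weight :: "real \<Rightarrow> 'i set \<Rightarrow> nat \<Rightarrow> real" where
  "degree_weight \<beta> I m = (\<Sum>d\<in>compositions I m. \<Prod>i\<in>I. wick_weight \<beta> (d i))"

lemma degree_weight_odd:
  assumes "odd m" shows "degree_weight \<beta> I m = 0"
  unfolding degree_weight_def
proof (intro sum.neutral ballI)
  fix d assume "d \<in> compositions I m"
  hence odd_sum: "odd (\<Sum>i\<in>I. d i)" using assms by (simp add: sum_compositions)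
  then obtain i where "i \<in> I" "odd (d i)" by (metis dvd_sum)
  moreover have "finite I" using odd_sum by (metis even_zero sum.infinite)
  ultimately show "(\<Prod>i\<in>I. wick_weight \<beta> (d i)) = 0"
    by (intro prod_zero) (auto intro!: bexI[of _ i] simp: wick_weight_odd)
qed

lemma sum_atMost_double:
  fixes f :: "nat \<Rightarrow> 'a::comm_monoid_add"
  assumes "\<And>i. odd i \<Longrightarrow> f i = 0"
  shows "(\<Sum>i\<le>n. f i) = (\<Sum>k\<le>n div 2. f (2 * k))"
proof (induction n)
  case (Suc n)
  show ?case
  proof (cases "odd (Suc n)")
    case True
    thus ?thesis using Suc assms[of "Suc n"] by simp
  next
    case False
    then obtain k where "Suc n = 2 * k" by (metis evenE)
    moreover from this obtain j where "k = Suc j" by (cases k) auto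
    ultimately show ?thesis using Suc by simp
  qed
qed simp

text \<open>Both sides are the coefficient of \<open>z\<^bsup>2k\<^esup>\<close> in \<open>(1 - \<beta>\<^sup>2 z\<^sup>2)\<^bsup>-N/2\<^esup>\<close>, where \<open>N\<close> is the size of \<open>I\<close>.\<close>

lemma degree_weight_even:
  assumes "finite I"
  shows "degree_weight \<beta> I (2 * k) = overlap_coef \<beta> (card I) k"
  using assms
proof (induction I arbitrary: k rule: finite_induct)
  case empty
  thus ?case
    by (simp add: degree_weight_def compositions_empty overlap_coef_def pochhammer_0_left)
next
  case (insert i I)
  have "degree_weight \<beta> (insert i I) (2 * k)
      = (\<Sum>e\<le>2 * k. wick_weight \<beta> e * degree_weight \<beta> I (2 * k - e))"
    unfolding degree_weight_def using insert.hyps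
    by (rule sum_prod_compositions_insert[of I i "\<lambda>_. wick_weight \<beta>"])
  also have "\<dots> = (\<Sum>j\<le>k. wick_weight \<beta> (2 * j) * degree_weight \<beta> I (2 * k - 2 * j))"
    by (subst sum_atMost_double) (simp_all add: wick_weight_odd)
  also have "\<dots> = (\<Sum>j\<le>k. overlap_coef \<beta> 1 j * overlap_coef \<beta> (card I) (k - j))"
    by (simp only: wick_weight_even insert.IH flip: diff_mult_distrib2)
  also have "\<dots> = overlap_coef \<beta> (card (insert i I)) k"
    using insert.hyps by (simp add: sum_overlap_coef_convolution)
  finally show ?case .
qed

section \<open>Replicas\<close>

lemma (in pair_prob_space) has_bochner_integral_mult_fst_snd:
  fixes f :: "'a \<Rightarrow> real" and g :: "'b \<Rightarrow> real"
  assumes f_integral: "has_bochner_integral M1 f u" and g_integral: "has_bochner_integral M2 g v"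
  shows "has_bochner_integral (M1 \<Otimes>\<^sub>M M2) (\<lambda>z. f (fst z) * g (snd z)) (u * v)"
proof -
  have integrable: "integrable M1 f" "integrable M2 g"
    and [measurable]: "f \<in> borel_measurable M1" "g \<in> borel_measurable M2"
    using f_integral g_integral by (auto simp: has_bochner_integral_iff)
  have "integrable (M1 \<Otimes>\<^sub>M M2) (\<lambda>z. f (fst z) * g (snd z))"
  proof (rule Fubini_integrable)
    show "(\<lambda>z. f (fst z) * g (snd z)) \<in> borel_measurable (M1 \<Otimes>\<^sub>M M2)" by measurable
    show "integrable M1 (\<lambda>x. \<integral>y. norm (f (fst (x, y)) * g (snd (x, y))) \<partial>M2)"
      using integrable by (simp add: abs_mult)
    show "AE x in M1. integrable M2 (\<lambda>y. f (fst (x, y)) * g (snd (x, y)))" using integrable by simp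
  qed
  moreover from integral_fst'[OF this]
  have "(\<integral>z. f (fst z) * g (snd z) \<partial>(M1 \<Otimes>\<^sub>M M2)) = u * v"
    using f_integral g_integral by (simp add: has_bochner_integral_iff)
  ultimately show ?thesis by (simp add: has_bochner_integral_iff)
qed

lemma sum_square_integral_eq_replicas:
  fixes f :: "'i \<Rightarrow> 'a \<Rightarrow> real"
  assumes prob_X: "prob_space X" and integrable: "\<And>a. a \<in> A \<Longrightarrow> integrable X (f a)"
  shows "(\<Sum>a\<in>A. c a * (\<integral>x. f a x \<partial>X)\<^sup>2)
    = (\<integral>z. (\<Sum>a\<in>A. c a * (f a (fst z) * f a (snd z))) \<partial>(X \<Otimes>\<^sub>M X))"
proof -
  interpret pair_prob_space X X by (rule pair_prob_spaceI[OF prob_X prob_X])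
  have "has_bochner_integral (X \<Otimes>\<^sub>M X) (\<lambda>z. \<Sum>a\<in>A. c a * (f a (fst z) * f a (snd z)))
      (\<Sum>a\<in>A. c a * ((\<integral>x. f a x \<partial>X) * (\<integral>x. f a x \<partial>X)))"
    by (intro has_bochner_integral_sum has_bochner_integral_mult_right
          has_bochner_integral_mult_fst_snd has_bochner_integral_integrable integrable)
  thus ?thesis by (simp add: has_bochner_integral_iff power2_eq_square)
qed

definition overlap_moment :: "nat \<Rightarrow> (nat \<Rightarrow> real) measure \<Rightarrow> nat \<Rightarrow> real" where
  "overlap_moment n X m = (\<integral>z. dot n (fst z) (snd z) ^ m \<partial>(X \<Otimes>\<^sub>M X))"

abbreviation fact_prod :: "nat \<Rightarrow> (nat \<Rightarrow> nat) \<Rightarrow> real" where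
  "fact_prod n a \<equiv> (\<Prod>j<n. fact (a j))"

lemma sum_power_prod_eq_dot_power:
  "(\<Sum>a\<in>compositions {..<n} m. power_prod n a x * power_prod n a y / fact_prod n a)
    = dot n x y ^ m / fact m"
  using multinomial_compositions[of "{..<n}" "\<lambda>j. x j * y j" m]
  by (simp add: dot_def prod_dividef power_mult_distrib prod.distrib)

lemma overlap_moment_eq:
  assumes "prob_space X" "\<And>a. a \<in> compositions {..<n} m \<Longrightarrow> integrable X (power_prod n a)"
  shows "overlap_moment n X m
    = fact m * (\<Sum>a\<in>compositions {..<n} m. (\<integral>x. power_prod n a x \<partial>X)\<^sup>2 / fact_prod n a)"
proof -
  have "(\<Sum>a\<in>compositions {..<n} m. (\<integral>x. power_prod n a x \<partial>X)\<^sup>2 / fact_prod n a)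
      = (\<integral>z. dot n (fst z) (snd z) ^ m / fact m \<partial>(X \<Otimes>\<^sub>M X))"
    using sum_square_integral_eq_replicas[OF assms, where c="\<lambda>a. 1 / fact_prod n a"]
    by (simp flip: sum_power_prod_eq_dot_power)
  thus ?thesis by (simp add: overlap_moment_def)
qed

lemma sum_PiE_compositions_eq_overlap_moment:
  fixes N :: nat
  assumes prob_X: "prob_space X"
    and integrable: "\<And>\<alpha>. \<alpha> \<in> PiE {..<N} (\<lambda>i. compositions {..<n} (d i)) \<Longrightarrow>
      integrable X (\<lambda>x. \<Prod>i<N. power_prod n (\<alpha> i) x)"
  shows "(\<Sum>\<alpha>\<in>PiE {..<N} (\<lambda>i. compositions {..<n} (d i)).
      (\<integral>x. (\<Prod>i<N. power_prod n (\<alpha> i) x) \<partial>X)\<^sup>2 / (\<Prod>i<N. fact_prod n (\<alpha> i)))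
    = overlap_moment n X (\<Sum>i<N. d i) / (\<Prod>i<N. fact (d i))"
proof -
  let ?A = "PiE {..<N} (\<lambda>i. compositions {..<n} (d i))"
  have "(\<Sum>\<alpha>\<in>?A. (1 / (\<Prod>i<N. fact_prod n (\<alpha> i))) *
        ((\<Prod>i<N. power_prod n (\<alpha> i) x) * (\<Prod>i<N. power_prod n (\<alpha> i) y)))
      = dot n x y ^ (\<Sum>i<N. d i) / (\<Prod>i<N. fact (d i))" for x y
  proof -
    have "(\<Sum>\<alpha>\<in>?A. \<Prod>i<N. power_prod n (\<alpha> i) x * power_prod n (\<alpha> i) y / fact_prod n (\<alpha> i))
        = (\<Prod>i<N. \<Sum>a\<in>compositions {..<n} (d i).
            power_prod n a x * power_prod n a y / fact_prod n a)"
      by (rule prod_sum_PiE[symmetric]) (simp_all add: finite_compositions)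
    also have "\<dots> = dot n x y ^ (\<Sum>i<N. d i) / (\<Prod>i<N. fact (d i))"
      by (simp add: sum_power_prod_eq_dot_power prod_dividef power_sum)
    finally show ?thesis by (simp add: prod_dividef prod.distrib)
  qed
  thus ?thesis
    using sum_square_integral_eq_replicas[OF prob_X integrable,
        where c="\<lambda>\<alpha>. 1 / (\<Prod>i<N. fact_prod n (\<alpha> i))"]
    by (simp add: overlap_moment_def)
qed

section \<open>The low-degree norm\<close>

lemma prod_if_eq_PiE:
  fixes c :: "'i \<Rightarrow> 'a::comm_semiring_1"
  assumes finite_I: "finite I" and f_PiE: "f \<in> PiE I A" and g_PiE: "g \<in> PiE I B"
  shows "(\<Prod>i\<in>I. if f i = g i then c i else 0) = (if f = g then \<Prod>i\<in>I. c i else 0)"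
proof (cases "f = g")
  case False
  then obtain i where "i \<in> I" "f i \<noteq> g i"
    using f_PiE g_PiE by (metis PiE_arb ext)
  thus ?thesis using False finite_I by (simp add: prod_zero) (auto intro!: prod_zero)
qed simp

lemma std_gaussian_multi_hermite_orthogonal:
  assumes a_extensional: "a \<in> {..<n} \<rightarrow>\<^sub>E UNIV" "a' \<in> {..<n} \<rightarrow>\<^sub>E UNIV"
  shows "(\<integral>g. multi_hermite n a g * multi_hermite n a' g \<partial>std_gaussian n)
    = (if a = a' then fact_prod n a else 0)"
proof -
  interpret product_prob_space "\<lambda>_::nat. gauss" "{..<n}"
    by (intro product_prob_spaceI prob_space_gauss)
  let ?f = "\<lambda>j t. poly (hermite (a j)) t * poly (hermite (a' j)) t"
  have "integrable gauss (?f j)" for j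
    by (intro all_moments_integrable all_moments_mult all_moments_poly all_moments_gauss
          finite_measure_gauss)
  hence "(\<integral>g. (\<Prod>j<n. ?f j (g j)) \<partial>std_gaussian n) = (\<Prod>j<n. \<integral>t. ?f j t \<partial>gauss)"
    unfolding std_gaussian_def by (intro product_integral_prod) auto
  also have "\<dots> = (if a = a' then fact_prod n a else 0)"
    using prod_if_eq_PiE[OF _ a_extensional, of "\<lambda>j. fact (a j) :: real"]
    by (simp add: gauss_hermite_orthogonal)
  finally show ?thesis by (simp add: multi_hermite_def prod.distrib)
qed

lemma all_moments_gaussian_samples_component:
  assumes "i < N" "j < n"
  shows "all_moments (gaussian_samples N n) (\<lambda>y. y i j)"
  unfolding gaussian_samples_def
  using assms
    all_moments_PiM_component[where f="\<lambda>g. g j" and M="\<lambda>_. std_gaussian n" and I="{..<N}" and i=i]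
  by (simp add: prob_space_std_gaussian all_moments_std_gaussian_component)

lemma all_moments_hermite_prod:
  assumes "finite_measure M" "\<And>i j. i < N \<Longrightarrow> j < n \<Longrightarrow> all_moments M (\<lambda>z. y z i j)"
  shows "all_moments M (\<lambda>z. hermite_prod N n \<alpha> (y z))"
  unfolding hermite_prod_def by (intro all_moments_prod all_moments_multi_hermite assms) auto

lemma all_moments_gaussian_samples_hermite_prod:
  "all_moments (gaussian_samples N n) (hermite_prod N n \<alpha>)"
  using all_moments_hermite_prod[of "gaussian_samples N n" N n "\<lambda>y. y" \<alpha>]
  by (simp add: finite_measure_gaussian_samples all_moments_gaussian_samples_component)

lemma gaussian_samples_hermite_orthogonal:
  assumes \<alpha>_extensional: "\<alpha> \<in> {..<N} \<rightarrow>\<^sub>E ({..<n} \<rightarrow>\<^sub>E UNIV)" "\<alpha>' \<in> {..<N} \<rightarrow>\<^sub>E ({..<n} \<rightarrow>\<^sub>E UNIV)"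
  shows "(\<integral>y. hermite_prod N n \<alpha> y * hermite_prod N n \<alpha>' y \<partial>gaussian_samples N n)
       = (if \<alpha> = \<alpha>' then \<Prod>i<N. fact_prod n (\<alpha> i) else 0)"
proof -
  interpret product_prob_space "\<lambda>_::nat. std_gaussian n" "{..<N}"
    by (intro product_prob_spaceI prob_space_std_gaussian)
  let ?f = "\<lambda>i g. multi_hermite n (\<alpha> i) g * multi_hermite n (\<alpha>' i) g"
  have "integrable (std_gaussian n) (?f i)" for i
    by (intro all_moments_integrable all_moments_mult all_moments_multi_hermite
          all_moments_std_gaussian_component finite_measure_std_gaussian)
  hence "(\<integral>y. (\<Prod>i<N. ?f i (y i)) \<partial>gaussian_samples N n) = (\<Prod>i<N. \<integral>g. ?f i g \<partial>std_gaussian n)"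
    unfolding gaussian_samples_def by (intro product_integral_prod) auto
  also have "\<dots> = (\<Prod>i<N. if \<alpha> i = \<alpha>' i then fact_prod n (\<alpha> i) else 0)"
    using \<alpha>_extensional
    by (intro prod.cong refl std_gaussian_multi_hermite_orthogonal) (auto simp: PiE_iff)
  also have "\<dots> = (if \<alpha> = \<alpha>' then \<Prod>i<N. fact_prod n (\<alpha> i) else 0)"
    by (rule prod_if_eq_PiE[OF finite_lessThan \<alpha>_extensional])
  finally show ?thesis by (simp add: hermite_prod_def prod.distrib)
qed

lemma gaussian_samples_hermite_planted_map:
  assumes "\<beta> * sqnorm n x \<ge> -1"
  shows "(\<integral>y. hermite_prod N n \<alpha> (planted_map \<beta> N n x y) \<partial>gaussian_samples N n)
    = (\<Prod>i<N. spiked_hermite_moment \<beta> n (\<alpha> i) x)"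
proof -
  interpret product_prob_space "\<lambda>_::nat. std_gaussian n" "{..<N}"
    by (intro product_prob_spaceI prob_space_std_gaussian)
  define A where "A = spiked_cov (spike_coef \<beta> (sqnorm n x)) x"
  have cov: "dot n (A j) (A k) = spiked_cov \<beta> x j k" if "j < n" "k < n" for j k
    using spiked_cov_square[OF that, of "spike_coef \<beta> (sqnorm n x)" x] assms
    by (simp add: A_def dot_def spiked_cov_sym[of _ _ k] spike_coef_quadratic)
  have "multi_hermite n a (spike_map \<beta> n x g) = multi_hermite n a (mat_vec n A g)" for a g
    by (simp add: multi_hermite_def spike_map_def rank_one_map_def A_def mat_vec_spiked_cov)
  hence "(\<integral>y. hermite_prod N n \<alpha> (planted_map \<beta> N n x y) \<partial>gaussian_samples N n)
      = (\<integral>y. (\<Prod>i<N. multi_hermite n (\<alpha> i) (mat_vec n A (y i))) \<partial>gaussian_samples N n)"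
    by (simp add: hermite_prod_def planted_map_def)
  also have "\<dots> = (\<Prod>i<N. \<integral>g. multi_hermite n (\<alpha> i) (mat_vec n A g) \<partial>std_gaussian n)"
    unfolding gaussian_samples_def
    by (intro product_integral_prod all_moments_integrable all_moments_multi_hermite_mat_vec) auto
  also have "\<dots> = (\<Prod>i<N. spiked_hermite_moment \<beta> n (\<alpha> i) x)"
    by (simp only: std_gaussian_multi_hermite_spiked[where x=x, OF cov])
  finally show ?thesis .
qed

definition hermite_integrable :: "nat \<Rightarrow> nat \<Rightarrow> nat \<Rightarrow> (nat \<Rightarrow> nat \<Rightarrow> real) measure \<Rightarrow> bool" where
  "hermite_integrable N n D P \<longleftrightarrow> (\<forall>\<alpha>\<in>exponents N n D. integrable P (hermite_prod N n \<alpha>))"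

lemma exponents_with_row_sums:
  assumes "m \<le> D" and d_compositions: "d \<in> compositions {..<N} m"
  shows "{\<alpha> \<in> exponents N n D.
      (\<Sum>i<N. \<Sum>j<n. \<alpha> i j) = m \<and> (\<lambda>i\<in>{..<N}. \<Sum>j<n. \<alpha> i j) = d}
    = PiE {..<N} (\<lambda>i. compositions {..<n} (d i))" (is "?L = ?R")
proof (intro equalityI subsetI)
  fix \<alpha> assume "\<alpha> \<in> ?L"
  thus "\<alpha> \<in> ?R" by (auto simp: exponents_def compositions_def PiE_iff)
next
  fix \<alpha> assume \<alpha>_rows: "\<alpha> \<in> ?R"
  hence row_sum: "(\<Sum>j<n. \<alpha> i j) = d i" if "i < N" for i
    using that by (auto simp: compositions_def)
  hence "(\<Sum>i<N. \<Sum>j<n. \<alpha> i j) = m" using sum_compositions[OF d_compositions] by simp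
  moreover have "(\<lambda>i\<in>{..<N}. \<Sum>j<n. \<alpha> i j) = d"
    using d_compositions row_sum by (auto simp: compositions_def PiE_iff extensional_def fun_eq_iff)
  ultimately show "\<alpha> \<in> ?L"
    using \<alpha>_rows assms by (auto simp: exponents_def compositions_def PiE_iff)
qed

lemma sum_exponents_by_row_sums:
  fixes F :: "(nat \<Rightarrow> nat \<Rightarrow> nat) \<Rightarrow> real"
  shows "(\<Sum>\<alpha>\<in>exponents N n D. F \<alpha>)
    = (\<Sum>m\<le>D. \<Sum>d\<in>compositions {..<N} m. \<Sum>\<alpha>\<in>PiE {..<N} (\<lambda>i. compositions {..<n} (d i)). F \<alpha>)"
proof -
  define rows where "rows \<alpha> = (\<Sum>i<N. \<Sum>j<n. \<alpha> i j, \<lambda>i\<in>{..<N}. \<Sum>j<n. \<alpha> i j)"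
    for \<alpha> :: "nat \<Rightarrow> nat \<Rightarrow> nat"
  let ?S = "SIGMA m:{..D}. compositions {..<N} m"
  have "(\<Sum>\<alpha>\<in>exponents N n D. F \<alpha>) = (\<Sum>p\<in>?S. \<Sum>\<alpha>\<in>{\<alpha> \<in> exponents N n D. rows \<alpha> = p}. F \<alpha>)"
    by (rule sum.group[OF finite_exponents finite_SigmaI[OF finite_atMost finite_compositions],
          symmetric])
       (auto simp: exponents_def compositions_def rows_def)
  also have "\<dots> = (\<Sum>(m, d)\<in>?S. \<Sum>\<alpha>\<in>PiE {..<N} (\<lambda>i. compositions {..<n} (d i)). F \<alpha>)"
    by (intro sum.cong refl) (auto simp: rows_def exponents_with_row_sums)
  finally show ?thesis by (simp add: sum.Sigma[symmetric] finite_compositions)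
qed

context spiked_model
begin

definition likelihood :: "(nat \<Rightarrow> nat \<Rightarrow> real) \<Rightarrow> real" where
  "likelihood y = enn2real (RN_deriv null planted y)"

lemma likelihood_ratio_eq:
  assumes "num_samples \<gamma> n = N" "Y n = X"
  shows "likelihood_ratio \<gamma> \<beta> Y n = likelihood"
  using assms prob_space_prior sets_prior
  by (simp add: likelihood_ratio_def likelihood_def fun_eq_iff wishart_null_eq wishart_planted_eq)

lemma
  assumes h_measurable: "h \<in> borel_measurable null"
  shows integrable_likelihood_mult_iff:
      "integrable null (\<lambda>y. likelihood y * h y) \<longleftrightarrow> integrable planted h"
    and integral_likelihood_mult: "(\<integral>y. likelihood y * h y \<partial>null) = (\<integral>y. h y \<partial>planted)"
proof -
  note RN =
    planted.sigma_finite_measure_axioms absolutely_continuous_planted sets_planted h_measurable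
  show "integrable null (\<lambda>y. likelihood y * h y) \<longleftrightarrow> integrable planted h"
    unfolding likelihood_def by (rule null.RN_deriv_integrable[OF RN, symmetric])
  show "(\<integral>y. likelihood y * h y \<partial>null) = (\<integral>y. h y \<partial>planted)"
    unfolding likelihood_def by (rule null.RN_deriv_integral[OF RN, symmetric])
qed

lemmas measurable_hermite_prod =
  all_moments_measurable[OF all_moments_gaussian_samples_hermite_prod[of N n]]

lemma has_bochner_integral_prior_hermite:
  assumes integrable_planted: "integrable planted (hermite_prod N n \<alpha>)"
  shows "has_bochner_integral X (\<lambda>x. \<Prod>i<N. spiked_hermite_moment \<beta> n (\<alpha> i) x)
    (\<integral>y. hermite_prod N n \<alpha> y \<partial>planted)"
proof -
  let ?conditional = "\<lambda>x. \<integral>y. hermite_prod N n \<alpha> (planted_map \<beta> N n x y) \<partial>null"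
  note distr_rules = measurable_planted_map measurable_hermite_prod[of \<alpha>]
  have integrable_joint:
    "integrable (X \<Otimes>\<^sub>M null) (\<lambda>z. hermite_prod N n \<alpha> (planted_map \<beta> N n (fst z) (snd z)))"
    using integrable_planted unfolding planted_samples_def
    by (subst (asm) integrable_distr_eq[OF distr_rules]) (simp add: case_prod_unfold)
  have "(\<integral>y. hermite_prod N n \<alpha> y \<partial>planted) = (\<integral>x. ?conditional x \<partial>X)"
    unfolding planted_samples_def integral_distr[OF distr_rules]
    using joint.integral_fst'[OF integrable_joint] by (simp add: case_prod_unfold)
  hence fubini: "has_bochner_integral X ?conditional (\<integral>y. hermite_prod N n \<alpha> y \<partial>planted)"
    using joint.integrable_fst'[OF integrable_joint] by (simp add: has_bochner_integral_iff)
  have "(\<lambda>x. x j) \<in> borel_measurable X" if "j < n" for j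
    using measurable_Rn_component[OF that] by (simp add: measurable_cong_sets[OF sets_prior refl])
  hence moment_measurable: "(\<lambda>x. \<Prod>i<N. spiked_hermite_moment \<beta> n (\<alpha> i) x) \<in> borel_measurable X"
    unfolding spiked_hermite_moment_def
    by (intro borel_measurable_times borel_measurable_prod borel_measurable_power) auto
  have "AE x in X. (\<Prod>i<N. spiked_hermite_moment \<beta> n (\<alpha> i) x) = ?conditional x"
    using AE_prior by eventually_elim (simp add: gaussian_samples_hermite_planted_map)
  thus ?thesis
    using fubini by (subst has_bochner_integral_cong_AE[OF moment_measurable]) auto
qed

lemma orthogonal_family_hermite_prod:
  "orthogonal_family null (exponents N n D) (hermite_prod N n) (\<lambda>\<alpha>. \<Prod>i<N. fact_prod n (\<alpha> i))"
proof
  show "integrable null (\<lambda>y. hermite_prod N n \<alpha> y * hermite_prod N n \<alpha>' y)" for \<alpha> \<alpha>'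
    by (intro all_moments_integrable all_moments_mult all_moments_gaussian_samples_hermite_prod)
  show "(\<integral>y. hermite_prod N n \<alpha> y * hermite_prod N n \<alpha>' y \<partial>null)
      = (if \<alpha> = \<alpha>' then \<Prod>i<N. fact_prod n (\<alpha> i) else 0)"
    if "\<alpha> \<in> exponents N n D" "\<alpha>' \<in> exponents N n D" for \<alpha> \<alpha>'
    using that by (intro gaussian_samples_hermite_orthogonal) (auto simp: exponents_def)
qed (auto simp: finite_exponents intro!: prod_pos)

lemma has_bochner_integral_prior_power_prods:
  assumes hermite: "hermite_integrable N n D planted" and "m \<le> D"
    and d_compositions: "d \<in> compositions {..<N} m"
    and \<alpha>_rows: "\<alpha> \<in> PiE {..<N} (\<lambda>i. compositions {..<n} (d i))"
  shows "has_bochner_integral X (\<lambda>x. (\<Prod>i<N. wick \<beta> (d i)) * (\<Prod>i<N. power_prod n (\<alpha> i) x))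
    (\<integral>y. hermite_prod N n \<alpha> y \<partial>planted)"
proof -
  have "\<alpha> \<in> exponents N n D"
    using exponents_with_row_sums[OF \<open>m \<le> D\<close> d_compositions, of n] \<alpha>_rows by blast
  moreover have "(\<Prod>i<N. spiked_hermite_moment \<beta> n (\<alpha> i) x)
      = (\<Prod>i<N. wick \<beta> (d i)) * (\<Prod>i<N. power_prod n (\<alpha> i) x)" for x
    unfolding prod.distrib[symmetric] spiked_hermite_moment_def using \<alpha>_rows
    by (intro prod.cong) (auto simp: compositions_def PiE_iff)
  ultimately show ?thesis
    using has_bochner_integral_prior_hermite[of \<alpha>] hermite by (simp add: hermite_integrable_def)
qed

lemma sum_hermite_moments_with_row_sums:
  assumes hermite: "hermite_integrable N n D planted" and "m \<le> D"
    and d_compositions: "d \<in> compositions {..<N} m"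
  shows "(\<Sum>\<alpha>\<in>PiE {..<N} (\<lambda>i. compositions {..<n} (d i)).
      (\<integral>y. hermite_prod N n \<alpha> y \<partial>planted)\<^sup>2 / (\<Prod>i<N. fact_prod n (\<alpha> i)))
    = (\<Prod>i<N. wick_weight \<beta> (d i)) * overlap_moment n X m"
proof -
  let ?A = "PiE {..<N} (\<lambda>i. compositions {..<n} (d i))"
  let ?monomial = "\<lambda>\<alpha> x. \<Prod>i<N. power_prod n (\<alpha> i) x"
  let ?moment = "\<lambda>\<alpha>. \<integral>y. hermite_prod N n \<alpha> y \<partial>planted"
  define w where "w = (\<Prod>i<N. wick \<beta> (d i))"
  note moment =
    has_bochner_integral_prior_power_prods[OF hermite \<open>m \<le> D\<close> d_compositions, folded w_def]
  have "(\<Sum>\<alpha>\<in>?A. (?moment \<alpha>)\<^sup>2 / (\<Prod>i<N. fact_prod n (\<alpha> i)))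
      = w\<^sup>2 * (overlap_moment n X m / (\<Prod>i<N. fact (d i)))"
  proof (cases "w = 0")
    case True
    have "?moment \<alpha> = 0" if "\<alpha> \<in> ?A" for \<alpha>
      using moment[OF that] True by (simp add: has_bochner_integral_iff)
    thus ?thesis using True by simp
  next
    case False
    have "integrable X (?monomial \<alpha>)" if "\<alpha> \<in> ?A" for \<alpha>
      using moment[OF that] False by (simp add: has_bochner_integral_iff)
    note overlap = sum_PiE_compositions_eq_overlap_moment[OF prob_space_prior this]
    have "?moment \<alpha> = w * (\<integral>x. ?monomial \<alpha> x \<partial>X)" if "\<alpha> \<in> ?A" for \<alpha>
      using moment[OF that] by (simp add: has_bochner_integral_iff)
    hence "(\<Sum>\<alpha>\<in>?A. (?moment \<alpha>)\<^sup>2 / (\<Prod>i<N. fact_prod n (\<alpha> i)))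
        = w\<^sup>2 * (\<Sum>\<alpha>\<in>?A. (\<integral>x. ?monomial \<alpha> x \<partial>X)\<^sup>2 / (\<Prod>i<N. fact_prod n (\<alpha> i)))"
      unfolding sum_distrib_left
      by (intro sum.cong refl) (simp only: power_mult_distrib times_divide_eq_right)
    thus ?thesis by (simp only: overlap sum_compositions[OF d_compositions])
  qed
  thus ?thesis by (simp add: w_def wick_weight_def prod_dividef prod_power_distrib)
qed

lemma sum_hermite_moments_eq_overlap_sum:
  assumes "hermite_integrable N n D planted"
  shows "(\<Sum>\<alpha>\<in>exponents N n D.
      (\<integral>y. hermite_prod N n \<alpha> y \<partial>planted)\<^sup>2 / (\<Prod>i<N. fact_prod n (\<alpha> i)))
    = (\<Sum>k\<le>D div 2. overlap_coef \<beta> N k * overlap_moment n X (2 * k))"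
proof -
  have "(\<Sum>\<alpha>\<in>exponents N n D.
      (\<integral>y. hermite_prod N n \<alpha> y \<partial>planted)\<^sup>2 / (\<Prod>i<N. fact_prod n (\<alpha> i)))
      = (\<Sum>m\<le>D. degree_weight \<beta> {..<N} m * overlap_moment n X m)"
    unfolding sum_exponents_by_row_sums degree_weight_def sum_distrib_right
    by (intro sum.cong refl sum_hermite_moments_with_row_sums[OF assms]) auto
  also have "\<dots> = (\<Sum>k\<le>D div 2. degree_weight \<beta> {..<N} (2 * k) * overlap_moment n X (2 * k))"
    by (rule sum_atMost_double) (simp add: degree_weight_odd)
  finally show ?thesis by (simp add: degree_weight_even)
qed

lemma low_degree_norm_eq_proj_norm:
  assumes "num_samples \<gamma> n = N" "Y n = X"
  shows "low_degree_norm \<gamma> \<beta> Y D n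
    = proj_norm null (lin_span (exponents N n D) (hermite_prod N n)) likelihood"
  by (simp only: low_degree_norm_def likelihood_ratio_eq[where Y=Y, OF assms] wishart_null_eq assms
        polys_upto_eq_hermite_span)

lemma low_degree_norm_eq:
  assumes model: "num_samples \<gamma> n = N" "Y n = X" and hermite: "hermite_integrable N n D planted"
  shows "low_degree_norm \<gamma> \<beta> Y D n
    = ennreal (sqrt (\<Sum>k\<le>D div 2. overlap_coef \<beta> N k * overlap_moment n X (2 * k)))"
proof -
  interpret orthogonal_family null "exponents N n D" "hermite_prod N n" "\<lambda>\<alpha>. \<Prod>i<N. fact_prod n (\<alpha> i)"
    by (rule orthogonal_family_hermite_prod)
  have "low_degree_norm \<gamma> \<beta> Y D n = ennreal (sqrt (\<Sum>\<alpha>\<in>exponents N n D.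
      (\<integral>y. likelihood y * hermite_prod N n \<alpha> y \<partial>null)\<^sup>2 / (\<Prod>i<N. fact_prod n (\<alpha> i))))"
    unfolding low_degree_norm_eq_proj_norm[where Y=Y, OF model] using hermite
    by (intro proj_norm_eq)
       (simp add: hermite_integrable_def integrable_likelihood_mult_iff[OF measurable_hermite_prod])
  thus ?thesis
    by (simp only: integral_likelihood_mult[OF measurable_hermite_prod]
          sum_hermite_moments_eq_overlap_sum[OF hermite])
qed

lemma low_degree_norm_infinite:
  assumes model: "num_samples \<gamma> n = N" "Y n = X" and "\<not> hermite_integrable N n D planted"
  shows "low_degree_norm \<gamma> \<beta> Y D n = \<infinity>"
proof -
  interpret orthogonal_family null "exponents N n D" "hermite_prod N n" "\<lambda>\<alpha>. \<Prod>i<N. fact_prod n (\<alpha> i)"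
    by (rule orthogonal_family_hermite_prod)
  obtain \<alpha> where "\<alpha> \<in> exponents N n D" "\<not> integrable planted (hermite_prod N n \<alpha>)"
    using assms(3) by (auto simp: hermite_integrable_def)
  thus ?thesis
    unfolding low_degree_norm_eq_proj_norm[where Y=Y, OF model]
    by (intro proj_norm_infinite)
       (simp_all add: integrable_likelihood_mult_iff[OF measurable_hermite_prod])
qed

lemma low_degree_norm_ge_term:
  assumes model: "num_samples \<gamma> n = N" "Y n = X" and hermite: "hermite_integrable N n D planted"
    and "2 * k \<le> D"
  shows "low_degree_norm \<gamma> \<beta> Y D n
    \<ge> ennreal (sqrt (overlap_coef \<beta> N k * overlap_moment n X (2 * k)))"
proof -
  have "overlap_moment n X (2 * k) \<ge> 0" for k
    unfolding overlap_moment_def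
    by (intro Bochner_Integration.integral_nonneg) (simp add: zero_le_even_power)
  hence "overlap_coef \<beta> N k * overlap_moment n X (2 * k)
      \<le> (\<Sum>k\<le>D div 2. overlap_coef \<beta> N k * overlap_moment n X (2 * k))"
    using \<open>2 * k \<le> D\<close>
    by (intro member_le_sum[of k _ "\<lambda>k. overlap_coef \<beta> N k * overlap_moment n X (2 * k)"]
          mult_nonneg_nonneg overlap_coef_nonneg) auto
  thus ?thesis
    unfolding low_degree_norm_eq[where Y=Y, OF model hermite]
    by (intro ennreal_leI real_sqrt_le_mono)
qed

lemma integrable_power_prod_prior:
  assumes hermite: "hermite_integrable N n D planted" and "\<beta> \<noteq> 0" "N > 0"
    and a_compositions: "a \<in> compositions {..<n} m" and "even m" "m \<le> D"
  shows "integrable X (power_prod n a)"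
proof -
  define \<alpha> where "\<alpha> = (\<lambda>i\<in>{..<N}. if i = 0 then a else (\<lambda>j\<in>{..<n}. 0))"
  have first_row: "{..<N} = insert 0 {0<..<N}" using \<open>N > 0\<close> by auto
  have "(\<Sum>i<N. \<Sum>j<n. \<alpha> i j) = m"
    unfolding first_row using \<open>N > 0\<close> sum_compositions[OF a_compositions] by (simp add: \<alpha>_def)
  hence "\<alpha> \<in> exponents N n D"
    using a_compositions \<open>m \<le> D\<close> by (auto simp: exponents_def \<alpha>_def compositions_def)
  hence "integrable X (\<lambda>x. \<Prod>i<N. spiked_hermite_moment \<beta> n (\<alpha> i) x)"
    using has_bochner_integral_prior_hermite[of \<alpha>] hermite
    by (simp add: hermite_integrable_def has_bochner_integral_iff)
  moreover have "(\<Prod>i<N. spiked_hermite_moment \<beta> n (\<alpha> i) x) = wick \<beta> m * power_prod n a x" for x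
    unfolding first_row using \<open>N > 0\<close> sum_compositions[OF a_compositions]
    by (simp add: \<alpha>_def spiked_hermite_moment_def)
  ultimately show ?thesis using wick_even_nonzero[OF \<open>\<beta> \<noteq> 0\<close> \<open>even m\<close>] by simp
qed

end

section \<open>The lower bound\<close>

definition twos :: "'i set \<Rightarrow> 'i set \<Rightarrow> 'i \<Rightarrow> nat" where
  "twos I K = (\<lambda>i\<in>I. if i \<in> K then 2 else 0)"

lemma twos_mem_compositions:
  assumes "finite I" "K \<subseteq> I" shows "twos I K \<in> compositions I (2 * card K)"
proof -
  have "(\<Sum>i\<in>I. twos I K i) = (\<Sum>i\<in>K. 2)"
    using assms by (intro sum.mono_neutral_cong_right) (auto simp: twos_def)
  thus ?thesis by (auto simp: compositions_def twos_def)
qed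

lemma prod_twos:
  fixes f :: "'i \<Rightarrow> nat \<Rightarrow> 'a::comm_monoid_mult"
  assumes "finite I" "K \<subseteq> I" "\<And>i. f i 0 = 1"
  shows "(\<Prod>i\<in>I. f i (twos I K i)) = (\<Prod>i\<in>K. f i 2)"
  using assms by (intro prod.mono_neutral_cong_right) (auto simp: twos_def)

lemma inj_on_twos: "inj_on (twos I) (Pow I)"
proof (rule inj_onI)
  fix K K' assume subsets: "K \<in> Pow I" "K' \<in> Pow I" and twos_eq: "twos I K = twos I K'"
  have "i \<in> K \<longleftrightarrow> i \<in> K'" if "i \<in> I" for i
    using fun_cong[OF twos_eq, of i] that by (auto simp: twos_def split: if_splits)
  thus "K = K'" using subsets by auto
qed

lemma sum_compositions_ge_twos:
  fixes F :: "('i \<Rightarrow> nat) \<Rightarrow> real"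
  assumes "finite I" and nonneg: "\<And>a. a \<in> compositions I (2 * k) \<Longrightarrow> F a \<ge> 0"
    and twos: "\<And>K. K \<subseteq> I \<Longrightarrow> card K = k \<Longrightarrow> F (twos I K) = v"
  shows "(\<Sum>a\<in>compositions I (2 * k). F a) \<ge> real (card I choose k) * v"
proof -
  let ?S = "{K. K \<subseteq> I \<and> card K = k}"
  have "inj_on (twos I) ?S" by (rule inj_on_subset[OF inj_on_twos]) auto
  hence "(\<Sum>a\<in>twos I ` ?S. F a) = real (card I choose k) * v"
    using n_subsets[OF \<open>finite I\<close>, of k] twos by (simp add: sum.reindex)
  moreover have "(\<Sum>a\<in>twos I ` ?S. F a) \<le> (\<Sum>a\<in>compositions I (2 * k). F a)"
    using \<open>finite I\<close> nonneg
    by (intro sum_mono2 finite_compositions) (auto intro: twos_mem_compositions)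
  ultimately show ?thesis by simp
qed

lemma prob_space_standardized: "standardized \<pi> \<Longrightarrow> prob_space \<pi>"
  by (simp add: standardized_def real_distribution_def)

lemma measurable_standardized:
  "standardized \<pi> \<Longrightarrow> f \<in> borel_measurable borel \<Longrightarrow> f \<in> borel_measurable \<pi>"
  by (simp add: standardized_def real_distribution_def real_distribution_axioms_def
        measurable_cong_sets[of \<pi> borel])

lemma measurable_standardized_scale:
  "standardized \<pi> \<Longrightarrow> (\<lambda>t. t / sqrt (real n)) \<in> borel_measurable \<pi>"
  by (rule measurable_standardized) measurable

lemma prob_space_scaled:
  "standardized \<pi> \<Longrightarrow> prob_space (distr \<pi> borel (\<lambda>t. t / sqrt (real n)))"
  by (intro prob_space.prob_space_distr prob_space_standardized measurable_standardized_scale)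

lemma prob_space_iid_prior: "standardized \<pi> \<Longrightarrow> prob_space (iid_prior \<pi> n)"
  unfolding iid_prior_def by (intro prob_space_PiM prob_space_scaled)

lemma sets_iid_prior: "sets (iid_prior \<pi> n) = sets (Rn n)"
  unfolding iid_prior_def by (intro sets_PiM_cong) auto

lemma iid_prior_twos_moment:
  assumes standardized: "standardized \<pi>" and K_subset: "K \<subseteq> {..<n}" and "n > 0"
  shows "(\<integral>x. power_prod n (twos {..<n} K) x \<partial>iid_prior \<pi> n) = (1 / real n) ^ card K"
proof -
  let ?\<mu> = "distr \<pi> borel (\<lambda>t. t / sqrt (real n))"
  note scale = measurable_standardized_scale[OF standardized]
  interpret \<mu>: prob_space ?\<mu> by (rule prob_space_scaled[OF standardized])
  interpret product_prob_space "\<lambda>_::nat. ?\<mu>" "{..<n}" ..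
  have "has_bochner_integral \<pi> (\<lambda>t. t\<^sup>2) 1" using standardized by (simp add: standardized_def)
  from has_bochner_integral_divide_zero[OF this, of "real n"]
  have second_moment: "integrable ?\<mu> (\<lambda>t. t\<^sup>2)" "(\<integral>t. t\<^sup>2 \<partial>?\<mu>) = 1 / real n"
    by (simp_all add: integrable_distr_eq[OF scale] integral_distr[OF scale] power_divide
          has_bochner_integral_iff)
  have "integrable ?\<mu> (\<lambda>t. t ^ twos {..<n} K j)" if "j < n" for j
    using that second_moment by (auto simp: twos_def)
  hence "(\<integral>x. power_prod n (twos {..<n} K) x \<partial>iid_prior \<pi> n) = (\<Prod>j<n. \<integral>t. t ^ twos {..<n} K j \<partial>?\<mu>)"
    unfolding iid_prior_def
    using product_integral_prod[of "{..<n}" "\<lambda>j t. t ^ twos {..<n} K j"] by simp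
  also have "\<dots> = (\<Prod>j\<in>K. \<integral>t. t ^ 2 \<partial>?\<mu>)"
    using \<mu>.prob_space K_subset by (intro prod_twos[of _ _ "\<lambda>j m. \<integral>t. t ^ m \<partial>?\<mu>"]) simp_all
  finally show ?thesis using second_moment by simp
qed

lemma iid_overlap_moment_ge:
  assumes standardized: "standardized \<pi>" and "n > 0"
    and integrable:
      "\<And>a. a \<in> compositions {..<n} (2 * k) \<Longrightarrow> integrable (iid_prior \<pi> n) (power_prod n a)"
  shows "overlap_moment n (iid_prior \<pi> n) (2 * k)
    \<ge> fact (2 * k) * (real (n choose k) * ((1 / real n) ^ (2 * k) / 2 ^ k))"
proof -
  let ?X = "iid_prior \<pi> n"
  have "(\<integral>x. power_prod n (twos {..<n} K) x \<partial>?X)\<^sup>2 / fact_prod n (twos {..<n} K)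
      = (1 / real n) ^ (2 * k) / 2 ^ k"
    if K_subset: "K \<subseteq> {..<n}" and card_K: "card K = k" for K
  proof -
    have "fact_prod n (twos {..<n} K) = 2 ^ k"
      using prod_twos[OF _ K_subset, of "\<lambda>_. fact :: nat \<Rightarrow> real"] card_K by simp
    thus ?thesis
      using iid_prior_twos_moment[OF standardized K_subset \<open>n > 0\<close>] card_K
      by (simp only: power_mult[symmetric] mult.commute)
  qed
  hence sum_ge:
    "(\<Sum>a\<in>compositions {..<n} (2 * k). (\<integral>x. power_prod n a x \<partial>?X)\<^sup>2 / fact_prod n a)
      \<ge> real (card {..<n} choose k) * ((1 / real n) ^ (2 * k) / 2 ^ k)"
    by (intro sum_compositions_ge_twos) (auto intro!: divide_nonneg_nonneg prod_nonneg)
  have "overlap_moment n ?X (2 * k) = fact (2 * k)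
      * (\<Sum>a\<in>compositions {..<n} (2 * k). (\<integral>x. power_prod n a x \<partial>?X)\<^sup>2 / fact_prod n a)"
    by (intro overlap_moment_eq prob_space_iid_prior standardized integrable)
  thus ?thesis using mult_left_mono[OF sum_ge, of "fact (2 * k)"] by simp
qed

lemma num_samples_ge:
  assumes "\<gamma> > 0" shows "real (num_samples \<gamma> n) \<ge> real n / \<gamma>"
proof -
  have "real n / \<gamma> \<ge> 0" using assms by simp
  thus ?thesis unfolding num_samples_def by linarith
qed

lemma num_samples_pos: "\<gamma> > 0 \<Longrightarrow> n > 0 \<Longrightarrow> num_samples \<gamma> n > 0"
  by (simp add: num_samples_def)

lemma power_le_pochhammer:
  fixes x :: real assumes "x \<ge> 0" shows "x ^ k \<le> pochhammer x k"
proof -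
  have "(\<Prod>i<k. x) \<le> (\<Prod>i<k. x + real i)" using assms by (intro prod_mono) auto
  thus ?thesis by (simp add: pochhammer_prod atLeast0LessThan)
qed

lemma overlap_coef_ge:
  assumes "\<gamma> > 0"
  shows "(\<beta>\<^sup>2) ^ k * ((real n / \<gamma> / 2) ^ k / fact k) \<le> overlap_coef \<beta> (num_samples \<gamma> n) k"
proof -
  have "(real n / \<gamma> / 2) ^ k \<le> (real (num_samples \<gamma> n) / 2) ^ k"
    using assms num_samples_ge[OF assms, of n] by (intro power_mono) auto
  also have "\<dots> \<le> pochhammer (real (num_samples \<gamma> n) / 2) k"
    by (rule power_le_pochhammer) simp
  finally show ?thesis
    unfolding overlap_coef_def by (intro mult_left_mono divide_right_mono) auto
qed

lemma low_degree_norm_iid_ge: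
  assumes \<gamma>_pos: "\<gamma> > 0" and standardized: "standardized \<pi>"
    and good: "AE x in iid_prior \<pi> n. \<beta> * sqnorm n x > -1"
    and "\<beta> \<noteq> 0" "n > 0" "2 * k \<le> D"
  shows "low_degree_norm \<gamma> \<beta> (iid_prior \<pi>) D n \<ge> ennreal (sqrt
    ((\<beta>\<^sup>2 / \<gamma>) ^ k * (fact (2 * k) / (4 ^ k * fact k)) * (real (n choose k) / real n ^ k)))"
proof -
  define N where "N = num_samples \<gamma> n"
  let ?X = "iid_prior \<pi> n"
  interpret spiked_model \<beta> N n ?X
    by (rule spiked_model.intro[OF prob_space_iid_prior[OF standardized] sets_iid_prior good])
  show ?thesis
  proof (cases "hermite_integrable N n D planted")
    case False
    thus ?thesis by (simp add: low_degree_norm_infinite[where Y="iid_prior \<pi>"] N_def)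
  next
    case True
    have "N > 0" using num_samples_pos[OF \<gamma>_pos \<open>n > 0\<close>] by (simp add: N_def)
    hence moment_ge: "overlap_moment n ?X (2 * k)
        \<ge> fact (2 * k) * (real (n choose k) * ((1 / real n) ^ (2 * k) / 2 ^ k))"
      using True \<open>\<beta> \<noteq> 0\<close> \<open>2 * k \<le> D\<close>
      by (intro iid_overlap_moment_ge[OF standardized \<open>n > 0\<close>] integrable_power_prod_prior) auto
    have "(\<beta>\<^sup>2) ^ k * ((real n / \<gamma> / 2) ^ k / fact k)
        * (fact (2 * k) * (real (n choose k) * ((1 / real n) ^ (2 * k) / 2 ^ k)))
        \<le> overlap_coef \<beta> N k * overlap_moment n ?X (2 * k)"
      unfolding N_def
      by (intro mult_mono overlap_coef_ge \<gamma>_pos moment_ge overlap_coef_nonneg) simp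
    also have "(\<beta>\<^sup>2) ^ k * ((real n / \<gamma> / 2) ^ k / fact k)
        * (fact (2 * k) * (real (n choose k) * ((1 / real n) ^ (2 * k) / 2 ^ k)))
      = (\<beta>\<^sup>2 / \<gamma>) ^ k * (fact (2 * k) / (4 ^ k * fact k)) * (real (n choose k) / real n ^ k)"
    proof -
      have "(4::real) ^ k = 2 ^ k * 2 ^ k" by (simp flip: power_mult_distrib)
      thus ?thesis
        using \<open>n > 0\<close> by (simp add: power_divide mult_2 power_add) (simp add: mult_ac)
    qed
    finally show ?thesis
      using low_degree_norm_ge_term[where Y="iid_prior \<pi>", OF _ _ True \<open>2 * k \<le> D\<close>]
      by (rule order_trans[OF ennreal_leI[OF real_sqrt_le_mono]]) (simp_all add: N_def)
  qed
qed

lemma binomial_over_power_tendsto: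
  "(\<lambda>n. real (n choose k) / real n ^ k) \<longlonglongrightarrow> 1 / fact k"
proof (rule Lim_transform_eventually)
  have "(\<lambda>n. \<Prod>i<k. 1 - real i / real n) \<longlonglongrightarrow> (\<Prod>i<k. 1 - 0)"
    by (intro tendsto_prod tendsto_diff tendsto_const lim_const_over_n)
  thus "(\<lambda>n. (\<Prod>i<k. 1 - real i / real n) / fact k) \<longlonglongrightarrow> 1 / fact k"
    by (intro tendsto_divide tendsto_const) auto
  show "\<forall>\<^sub>F n in sequentially. (\<Prod>i<k. 1 - real i / real n) / fact k
      = real (n choose k) / real n ^ k"
    using eventually_gt_at_top[of 0]
  proof eventually_elim
    case (elim n)
    have "(\<Prod>i<k. 1 - real i / real n) = (\<Prod>i<k. (real n - real i) / real n)"
      using elim by (intro prod.cong) (auto simp: field_simps)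
    also have "\<dots> = (\<Prod>i<k. real n - real i) / real n ^ k" by (simp add: prod_dividef)
    also have "(\<Prod>i<k. real n - real i) = fact k * real (n choose k)"
      by (simp add: binomial_gbinomial gbinomial_mult_fact atLeast0LessThan)
    finally show ?case by simp
  qed
qed

lemma power_over_index_unbounded:
  fixes \<rho> :: real assumes "\<rho> > 1"
  shows "\<exists>k>0. \<rho> ^ k / real k > C"
proof -
  have "(\<lambda>k. real k * (1 / \<rho>) ^ k) \<longlonglongrightarrow> 0"
    using assms by (intro powser_times_n_limit_0) simp
  moreover have "\<forall>\<^sub>F k in sequentially. real k * (1 / \<rho>) ^ k > 0"
    using eventually_gt_at_top[of 0] by eventually_elim (use assms in simp)
  ultimately have "filterlim (\<lambda>k. inverse (real k * (1 / \<rho>) ^ k)) at_top sequentially"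
    by (intro filterlim_inverse_at_top)
  hence "\<forall>\<^sub>F k in sequentially. inverse (real k * (1 / \<rho>) ^ k) > C"
    by (simp add: filterlim_at_top_dense)
  with eventually_gt_at_top[of 0] have "\<forall>\<^sub>F k in sequentially. k > 0 \<and> \<rho> ^ k / real k > C"
    by eventually_elim (simp add: field_simps power_one_over)
  thus ?thesis by (auto dest: eventually_happens)
qed

lemma central_binomial_limit_gt:
  fixes \<rho> :: real assumes "\<rho> \<ge> 0" "k > 0" "\<rho> ^ k / real k > 2 * C"
  shows "\<rho> ^ k * (fact (2 * k) / (4 ^ k * fact k)) * (1 / fact k) > C"
proof -
  have "C < \<rho> ^ k * (1 / (2 * real k))" using assms by (simp add: field_simps)
  also have "1 / (2 * real k) \<le> real ((2 * k) choose k) / 4 ^ k"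
    using central_binomial_lower_bound[OF \<open>k > 0\<close>] by (simp add: field_simps)
  also have "\<dots> = fact (2 * k) / (4 ^ k * fact k) * (1 / fact k)"
    by (subst binomial_fact) (auto simp: mult_2)
  finally show ?thesis using \<open>\<rho> \<ge> 0\<close> by (simp add: mult_left_mono)
qed

lemma low_degree_norm_iid_tendsto_infinity:
  assumes \<gamma>_pos: "\<gamma> > 0" and "\<beta>\<^sup>2 > \<gamma>" and standardized: "standardized \<pi>"
    and good: "beta_good \<beta> (iid_prior \<pi>)" and D_growth: "(\<lambda>n. real (D n)) \<in> \<omega>(\<lambda>_. 1)"
  shows "(\<lambda>n. low_degree_norm \<gamma> \<beta> (iid_prior \<pi>) (D n) n) \<longlonglongrightarrow> \<infinity>"
  unfolding infinity_ennreal_def tendsto_top_iff_ennreal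
proof (intro allI impI)
  fix l :: real assume "l \<ge> 0"
  define \<rho> where "\<rho> = \<beta>\<^sup>2 / \<gamma>"
  have "\<rho> > 1" using \<open>\<gamma> > 0\<close> \<open>\<beta>\<^sup>2 > \<gamma>\<close> by (simp add: \<rho>_def)
  obtain k where k_large: "k > 0" "\<rho> ^ k / real k > 2 * l\<^sup>2"
    using power_over_index_unbounded[OF \<open>\<rho> > 1\<close>] by blast
  define bound where
    "bound n = \<rho> ^ k * (fact (2 * k) / (4 ^ k * fact k)) * (real (n choose k) / real n ^ k)" for n
  have "bound \<longlonglongrightarrow> \<rho> ^ k * (fact (2 * k) / (4 ^ k * fact k)) * (1 / fact k)"
    unfolding bound_def by (intro tendsto_mult tendsto_const binomial_over_power_tendsto)
  hence bound_large: "\<forall>\<^sub>F n in sequentially. bound n > l\<^sup>2"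
    by (rule order_tendstoD) (use k_large \<open>\<rho> > 1\<close> in \<open>intro central_binomial_limit_gt; simp\<close>)
  have "\<forall>\<^sub>F n in sequentially. real (D n) \<ge> real (2 * k)"
    using landau_omega.smallD[OF D_growth, of "real (2 * k)"] k_large(1) by simp
  with bound_large eventually_gt_at_top[of 0]
  show "\<forall>\<^sub>F n in sequentially. ennreal l < low_degree_norm \<gamma> \<beta> (iid_prior \<pi>) (D n) n"
  proof eventually_elim
    case (elim n)
    have "l < sqrt (bound n)" using elim by (intro real_less_rsqrt)
    hence "ennreal l < ennreal (sqrt (bound n))" using \<open>l \<ge> 0\<close> by (simp add: ennreal_less_iff)
    also have "\<dots> \<le> low_degree_norm \<gamma> \<beta> (iid_prior \<pi>) (D n) n"
      unfolding bound_def \<rho>_def using elim \<open>\<beta>\<^sup>2 > \<gamma>\<close> \<gamma>_pos good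
      by (intro low_degree_norm_iid_ge standardized) (auto simp: beta_good_def)
    finally show ?case .
  qed
qed

section \<open>Exponential moments\<close>

lemma nn_integral_gauss_exp_quadratic:
  assumes "b < 1 / 2"
  shows "(\<integral>\<^sup>+g. ennreal (exp (a * g + b * g\<^sup>2)) \<partial>gauss)
    = ennreal (exp (a\<^sup>2 / (2 * (1 - 2 * b))) / sqrt (1 - 2 * b))"
proof -
  define v where "v = 1 - 2 * b"
  define mass where "mass = exp (a\<^sup>2 / (2 * v)) / sqrt v"
  let ?density = "normal_density (a / v) (1 / sqrt v)"
  have "v > 0" and b_eq: "b = (1 - v) / 2" using assms by (simp_all add: v_def)
  have complete_square: "std_normal_density g * exp (a * g + b * g\<^sup>2) = mass * ?density g" for g
  proof -
    have "- g\<^sup>2 / 2 + (a * g + b * g\<^sup>2) = a\<^sup>2 / (2 * v) + - (g - a / v)\<^sup>2 / (2 * (1 / sqrt v)\<^sup>2)"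
      using \<open>v > 0\<close> by (simp add: b_eq power_divide field_simps power2_eq_square)
    hence "exp (- g\<^sup>2 / 2) * exp (a * g + b * g\<^sup>2)
        = exp (a\<^sup>2 / (2 * v)) * exp (- (g - a / v)\<^sup>2 / (2 * (1 / sqrt v)\<^sup>2))"
      by (simp only: exp_add[symmetric])
    thus ?thesis
      using \<open>v > 0\<close> by (simp add: normal_density_def mass_def real_sqrt_divide power_divide)
  qed
  have "(\<integral>\<^sup>+g. ennreal (exp (a * g + b * g\<^sup>2)) \<partial>gauss)
      = (\<integral>\<^sup>+g. ennreal mass * ennreal (?density g) \<partial>lborel)"
    using \<open>v > 0\<close>
    by (subst nn_integral_density) (auto simp: ennreal_mult[symmetric] complete_square mass_def)
  also have "\<dots> = ennreal mass * emeasure (density lborel ?density) UNIV"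
    by (subst nn_integral_cmult) (auto simp: emeasure_density)
  also have "emeasure (density lborel ?density) UNIV = 1"
    using prob_space.emeasure_space_1[OF prob_space_normal_density[of "1 / sqrt v" "a / v"]] \<open>v > 0\<close>
    by simp
  finally show ?thesis by (simp add: mass_def v_def)
qed

text \<open>The square is linearised by an independent standard Gaussian.\<close>

lemma subgaussian_exp_square:
  assumes "subgaussian \<pi>"
  shows "\<exists>s>0. integrable \<pi> (\<lambda>x. exp (s * x\<^sup>2))"
proof -
  interpret \<pi>: real_distribution \<pi> using assms by (simp add: subgaussian_def)
  from assms obtain \<sigma> where integrable_exp: "\<And>t. integrable \<pi> (\<lambda>x. exp (t * x))"
    and mgf_le: "\<And>t. (\<integral>x. exp (t * x) \<partial>\<pi>) \<le> exp (\<sigma>\<^sup>2 * t\<^sup>2 / 2)"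
    by (auto simp: subgaussian_def)
  define s where "s = 1 / (4 * (\<sigma>\<^sup>2 + 1))"
  define b where "b = sqrt (2 * s)"
  have "\<sigma>\<^sup>2 + 1 > 0" by (simp add: add_nonneg_pos)
  hence "s > 0" and "\<sigma>\<^sup>2 * s < 1 / 2" by (auto simp: s_def field_simps add_nonneg_pos)
  have b_square: "b\<^sup>2 = 2 * s" using \<open>s > 0\<close> by (simp add: b_def)
  interpret gauss: prob_space gauss by (rule prob_space_gauss)
  interpret \<pi>_gauss: pair_sigma_finite \<pi> gauss ..
  have measurable: "(\<lambda>z. ennreal (exp (b * fst z * snd z))) \<in> borel_measurable (\<pi> \<Otimes>\<^sub>M gauss)"
    by measurable
  have "(\<integral>\<^sup>+x. ennreal (exp (s * x\<^sup>2)) \<partial>\<pi>) = (\<integral>\<^sup>+x. \<integral>\<^sup>+g. ennreal (exp (b * x * g)) \<partial>gauss \<partial>\<pi>)"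
    using nn_integral_gauss_exp_quadratic[of 0 "b * x" for x]
    by (simp add: power_mult_distrib b_square)
  also have "\<dots> = (\<integral>\<^sup>+g. \<integral>\<^sup>+x. ennreal (exp (b * x * g)) \<partial>\<pi> \<partial>gauss)"
    using \<pi>_gauss.Fubini[OF measurable] by simp
  also have "\<dots> \<le> (\<integral>\<^sup>+g. ennreal (exp (0 * g + (\<sigma>\<^sup>2 * s) * g\<^sup>2)) \<partial>gauss)"
  proof (rule nn_integral_mono)
    fix g
    have "(\<integral>\<^sup>+x. ennreal (exp (b * x * g)) \<partial>\<pi>) = ennreal (\<integral>x. exp ((b * g) * x) \<partial>\<pi>)"
      using nn_integral_eq_integral[OF integrable_exp[of "b * g"]] by (simp add: mult_ac)
    also have "\<dots> \<le> ennreal (exp (\<sigma>\<^sup>2 * (b * g)\<^sup>2 / 2))" by (intro ennreal_leI mgf_le)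
    also have "\<sigma>\<^sup>2 * (b * g)\<^sup>2 / 2 = 0 * g + (\<sigma>\<^sup>2 * s) * g\<^sup>2"
      by (simp add: power_mult_distrib b_square)
    finally show "(\<integral>\<^sup>+x. ennreal (exp (b * x * g)) \<partial>\<pi>) \<le> ennreal (exp (0 * g + (\<sigma>\<^sup>2 * s) * g\<^sup>2))" .
  qed
  also have "\<dots> < \<infinity>"
    unfolding nn_integral_gauss_exp_quadratic[OF \<open>\<sigma>\<^sup>2 * s < 1 / 2\<close>] by simp
  finally have "integrable \<pi> (\<lambda>x. exp (s * x\<^sup>2))" by (intro integrableI_nonneg) auto
  thus ?thesis using \<open>s > 0\<close> by blast
qed

lemma exp_le_quadratic_plus_cubic:
  fixes u :: real shows "exp u \<le> 1 + u + u\<^sup>2 / 2 + \<bar>u\<bar> ^ 3 / fact 3 * exp \<bar>u\<bar>"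
proof -
  obtain t where maclaurin: "\<bar>t\<bar> \<le> \<bar>u\<bar>" "exp u = (\<Sum>m<3. u ^ m / fact m) + (exp t / fact 3) * u ^ 3"
    using Maclaurin_exp_le[of u 3] by blast
  have "(exp t / fact 3) * u ^ 3 \<le> exp t / fact 3 * \<bar>u\<bar> ^ 3"
    by (intro mult_left_mono) (auto simp: power_abs[symmetric])
  also have "\<dots> \<le> exp \<bar>u\<bar> / fact 3 * \<bar>u\<bar> ^ 3"
    using maclaurin(1) by (intro mult_right_mono divide_right_mono) auto
  finally show ?thesis using maclaurin(2)
    by (simp add: numeral_3_eq_3 power2_eq_square mult.commute)
qed

lemma power_div_fact_le_exp:
  fixes x :: real assumes "x \<ge> 0" shows "x ^ m / fact m \<le> exp x"
proof -
  obtain t where "exp x = (\<Sum>i<Suc m. x ^ i / fact i) + (exp t / fact (Suc m)) * x ^ Suc m"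
    using Maclaurin_exp_le[of x "Suc m"] by blast
  moreover have "x ^ m / fact m \<le> (\<Sum>i<Suc m. x ^ i / fact i)" using assms by (simp add: sum_nonneg)
  moreover have "(exp t / fact (Suc m)) * x ^ Suc m \<ge> 0" using assms by simp
  ultimately show ?thesis by linarith
qed

lemma power_le_exp:
  fixes x :: real assumes "x \<ge> 0" shows "x ^ m \<le> (real m / exp 1) ^ m * exp x"
proof (cases "m = 0")
  case False
  have "x / m \<le> exp (x / m - 1)" using exp_ge_add_one_self[of "x / m - 1"] by simp
  hence "(x / m) ^ m \<le> exp (x / m - 1) ^ m" using assms by (intro power_mono) auto
  also have "exp (x / m - 1) ^ m = exp x / exp 1 ^ m"
    using False by (simp add: exp_diff power_divide flip: exp_of_nat_mult)
  finally show ?thesis using False by (simp add: power_divide field_simps)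
qed (use assms in simp)

lemma exp_mult_le_cubic:
  fixes s t z :: real assumes "s > 0" "\<bar>t\<bar> \<le> s"
  shows "exp (t * z) \<le> 1 + t * z + t\<^sup>2 / 2 * z\<^sup>2 + \<bar>t\<bar> ^ 3 * (exp (2 * s * \<bar>z\<bar>) / s ^ 3)"
proof -
  have "(s * \<bar>z\<bar>) ^ 3 / fact 3 \<le> exp (s * \<bar>z\<bar>)"
    using \<open>s > 0\<close> by (intro power_div_fact_le_exp) simp
  hence cube_le: "\<bar>z\<bar> ^ 3 / fact 3 \<le> exp (s * \<bar>z\<bar>) / s ^ 3"
    using \<open>s > 0\<close> by (simp add: power_mult_distrib pos_le_divide_eq mult.commute)
  have "\<bar>t\<bar> * \<bar>z\<bar> \<le> s * \<bar>z\<bar>" using \<open>\<bar>t\<bar> \<le> s\<close> by (intro mult_right_mono) auto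
  hence "exp \<bar>t * z\<bar> \<le> exp (s * \<bar>z\<bar>)" by (simp add: abs_mult)
  with cube_le have "\<bar>z\<bar> ^ 3 / fact 3 * exp \<bar>t * z\<bar> \<le> exp (s * \<bar>z\<bar>) / s ^ 3 * exp (s * \<bar>z\<bar>)"
    using \<open>s > 0\<close> by (intro mult_mono) auto
  also have "\<dots> = exp (2 * s * \<bar>z\<bar>) / s ^ 3"
    using exp_double[of "s * \<bar>z\<bar>"] by (simp add: power2_eq_square mult.assoc)
  finally have "\<bar>t\<bar> ^ 3 * (\<bar>z\<bar> ^ 3 / fact 3 * exp \<bar>t * z\<bar>) \<le> \<bar>t\<bar> ^ 3 * (exp (2 * s * \<bar>z\<bar>) / s ^ 3)"
    by (rule mult_left_mono) simp
  thus ?thesis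
    using exp_le_quadratic_plus_cubic[of "t * z"] by (simp add: abs_mult power_mult_distrib)
qed

lemma (in prob_space) mgf_le_exp_cubic:
  assumes mean: "has_bochner_integral M Z 0"
    and variance: "has_bochner_integral M (\<lambda>x. (Z x)\<^sup>2) 1"
    and cubic_mean: "has_bochner_integral M (\<lambda>x. exp (2 * s * \<bar>Z x\<bar>) / s ^ 3) K"
    and "s > 0" "\<bar>t\<bar> \<le> s"
  shows "(\<integral>\<^sup>+x. ennreal (exp (t * Z x)) \<partial>M) \<le> ennreal (exp (t\<^sup>2 / 2 + \<bar>t\<bar> ^ 3 * K))"
proof -
  let ?cubic = "\<lambda>z. 1 + t * z + t\<^sup>2 / 2 * z\<^sup>2 + \<bar>t\<bar> ^ 3 * (exp (2 * s * \<bar>z\<bar>) / s ^ 3)"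
  have exp_le: "exp (t * z) \<le> ?cubic z" for z
    using \<open>s > 0\<close> \<open>\<bar>t\<bar> \<le> s\<close> by (rule exp_mult_le_cubic)
  have unit: "has_bochner_integral M (\<lambda>x. 1) (1 :: real)"
    by (simp add: has_bochner_integral_iff prob_space)
  have "has_bochner_integral M (\<lambda>x. ?cubic (Z x)) (1 + t * 0 + t\<^sup>2 / 2 * 1 + \<bar>t\<bar> ^ 3 * K)"
    by (rule has_bochner_integral_add[OF has_bochner_integral_add[OF has_bochner_integral_add[OF unit
          has_bochner_integral_mult_right[OF mean]] has_bochner_integral_mult_right[OF variance]]
          has_bochner_integral_mult_right[OF cubic_mean]])
  hence integrable: "integrable M (\<lambda>x. ?cubic (Z x))"
    and expectation: "expectation (\<lambda>x. ?cubic (Z x)) = 1 + t\<^sup>2 / 2 + \<bar>t\<bar> ^ 3 * K"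
    by (simp_all add: has_bochner_integral_iff)
  have "(\<integral>\<^sup>+x. ennreal (exp (t * Z x)) \<partial>M) \<le> (\<integral>\<^sup>+x. ennreal (?cubic (Z x)) \<partial>M)"
    by (intro nn_integral_mono ennreal_leI exp_le)
  also have "\<dots> = ennreal (1 + (t\<^sup>2 / 2 + \<bar>t\<bar> ^ 3 * K))"
    unfolding nn_integral_eq_integral[OF integrable AE_I2[OF order_trans[OF exp_ge_zero exp_le]]]
      expectation
    by (simp only: add.assoc)
  also have "\<dots> \<le> ennreal (exp (t\<^sup>2 / 2 + \<bar>t\<bar> ^ 3 * K))"
    by (intro ennreal_leI exp_ge_add_one_self)
  finally show ?thesis .
qed

lemma (in prob_space) mgf_le_near_0:
  assumes mean: "has_bochner_integral M Z 0"
    and variance: "has_bochner_integral M (\<lambda>x. (Z x)\<^sup>2) 1"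
    and "s > 0" and integrable: "integrable M (\<lambda>x. exp (2 * s * \<bar>Z x\<bar>))" and "\<delta> > 0"
  shows "\<exists>r>0. \<forall>t. \<bar>t\<bar> \<le> r \<longrightarrow>
    (\<integral>\<^sup>+x. ennreal (exp (t * Z x)) \<partial>M) \<le> ennreal (exp ((1 + \<delta>) * t\<^sup>2 / 2))"
proof -
  define K where "K = expectation (\<lambda>x. exp (2 * s * \<bar>Z x\<bar>) / s ^ 3)"
  have "K \<ge> 0"
    unfolding K_def using \<open>s > 0\<close> by (intro Bochner_Integration.integral_nonneg) auto
  have cubic_mean: "has_bochner_integral M (\<lambda>x. exp (2 * s * \<bar>Z x\<bar>) / s ^ 3) K"
    unfolding K_def using integrable
    by (intro has_bochner_integral_integrable integrable_divide_zero) auto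
  define r where "r = min s (\<delta> / (2 * (K + 1)))"
  have "(\<integral>\<^sup>+x. ennreal (exp (t * Z x)) \<partial>M) \<le> ennreal (exp ((1 + \<delta>) * t\<^sup>2 / 2))" if "\<bar>t\<bar> \<le> r" for t
  proof -
    have "\<bar>t\<bar> * K \<le> \<delta> / (2 * (K + 1)) * K"
      using \<open>\<bar>t\<bar> \<le> r\<close> \<open>K \<ge> 0\<close> by (intro mult_right_mono) (auto simp: r_def)
    also have "\<dots> \<le> \<delta> / 2" using \<open>K \<ge> 0\<close> \<open>\<delta> > 0\<close> by (simp add: field_simps)
    finally have "t\<^sup>2 * (\<bar>t\<bar> * K) \<le> t\<^sup>2 * (\<delta> / 2)" by (intro mult_left_mono) auto
    moreover have "\<bar>t\<bar> ^ 3 = \<bar>t\<bar>\<^sup>2 * \<bar>t\<bar>" by (simp only: power3_eq_cube power2_eq_square)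
    ultimately have exponent_le: "t\<^sup>2 / 2 + \<bar>t\<bar> ^ 3 * K \<le> (1 + \<delta>) * t\<^sup>2 / 2"
      by (simp add: field_simps)
    have "\<bar>t\<bar> \<le> s" using \<open>\<bar>t\<bar> \<le> r\<close> by (simp add: r_def)
    from mgf_le_exp_cubic[OF mean variance cubic_mean \<open>s > 0\<close> this] exponent_le
    show ?thesis by (rule order_trans[OF _ ennreal_leI[OF exp_mono]])
  qed
  moreover have "r > 0" using \<open>s > 0\<close> \<open>\<delta> > 0\<close> \<open>K \<ge> 0\<close> by (simp add: r_def)
  ultimately show ?thesis by blast
qed

definition product_mgf :: "real measure \<Rightarrow> real \<Rightarrow> ennreal" where
  "product_mgf \<pi> t = (\<integral>\<^sup>+z. ennreal (exp (t * (fst z * snd z))) \<partial>(\<pi> \<Otimes>\<^sub>M \<pi>))"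

definition product_mgf_bound :: "real measure \<Rightarrow> real \<Rightarrow> real \<Rightarrow> bool" where
  "product_mgf_bound \<pi> \<delta> r \<longleftrightarrow>
    (\<forall>t. \<bar>t\<bar> \<le> r \<longrightarrow> product_mgf \<pi> t \<le> ennreal (exp ((1 + \<delta>) * t\<^sup>2 / 2)))"

lemma subgaussian_product_mgf_bound:
  assumes subgaussian: "subgaussian \<pi>" and standardized: "standardized \<pi>" and "\<delta> > 0"
  shows "\<exists>r>0. product_mgf_bound \<pi> \<delta> r"
proof -
  interpret \<pi>: real_distribution \<pi> using subgaussian by (simp add: subgaussian_def)
  interpret \<pi>_pair: pair_prob_space \<pi> \<pi> ..
  let ?M = "\<pi> \<Otimes>\<^sub>M \<pi>" and ?Z = "\<lambda>z. fst z * snd z :: real"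
  note product = \<pi>_pair.has_bochner_integral_mult_fst_snd
  obtain s where "s > 0" and exp_square: "integrable \<pi> (\<lambda>x. exp (s * x\<^sup>2))"
    using subgaussian_exp_square[OF subgaussian] by blast
  show ?thesis unfolding product_mgf_bound_def product_mgf_def
  proof (rule \<pi>_pair.mgf_le_near_0[OF _ _ \<open>s > 0\<close> _ \<open>\<delta> > 0\<close>])
    show "has_bochner_integral ?M ?Z 0" "has_bochner_integral ?M (\<lambda>z. (?Z z)\<^sup>2) 1"
      using standardized product[of "\<lambda>x. x" 0 "\<lambda>x. x" 0] product[of "\<lambda>x. x\<^sup>2" 1 "\<lambda>x. x\<^sup>2" 1]
      by (simp_all add: standardized_def power_mult_distrib)
    have "integrable ?M (\<lambda>z. exp (s * (fst z)\<^sup>2) * exp (s * (snd z)\<^sup>2))"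
      using exp_square product[of "\<lambda>x. exp (s * x\<^sup>2)" _ "\<lambda>x. exp (s * x\<^sup>2)"]
      by (simp add: has_bochner_integral_iff)
    thus "integrable ?M (\<lambda>z. exp (2 * s * \<bar>?Z z\<bar>))"
    proof (rule Bochner_Integration.integrable_bound)
      have "exp (2 * s * \<bar>?Z z\<bar>) \<le> exp (s * (fst z)\<^sup>2) * exp (s * (snd z)\<^sup>2)" for z
        using mult_left_mono[OF sum_squares_bound[of "\<bar>fst z\<bar>" "\<bar>snd z\<bar>"], of s] \<open>s > 0\<close>
        by (simp add: abs_mult exp_add[symmetric] algebra_simps)
      thus "AE z in ?M. norm (exp (2 * s * \<bar>?Z z\<bar>))
          \<le> norm (exp (s * (fst z)\<^sup>2) * exp (s * (snd z)\<^sup>2))"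
        by simp
    qed measurable
  qed
qed

section \<open>Moments of the overlap\<close>

lemma measurable_overlap:
  assumes "sets X = sets (Rn n)" "sets Y = sets (Rn n)"
  shows "(\<lambda>z. dot n (fst z) (snd z)) \<in> borel_measurable (X \<Otimes>\<^sub>M Y)"
proof -
  note [measurable_cong] = assms
  show ?thesis by (intro measurable_dot) measurable
qed

lemma nn_integral_pair_PiM_prod:
  assumes prob_M: "\<And>i. prob_space (M i)" and "finite I"
    and measurable:
      "\<And>i. i \<in> I \<Longrightarrow> (\<lambda>z. f i (fst z) (snd z)) \<in> borel_measurable (M i \<Otimes>\<^sub>M M i)"
  shows "(\<integral>\<^sup>+z. (\<Prod>i\<in>I. f i (fst z i) (snd z i)) \<partial>(PiM I M \<Otimes>\<^sub>M PiM I M))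
    = (\<Prod>i\<in>I. \<integral>\<^sup>+z. f i (fst z) (snd z) \<partial>(M i \<Otimes>\<^sub>M M i))"
proof -
  interpret M: product_prob_space M I by (rule product_prob_spaceI[OF prob_M])
  note sigma_finite = prob_space_imp_sigma_finite[OF prob_M]
  have iterated: "(\<integral>\<^sup>+z. f i (fst z) (snd z) \<partial>(M i \<Otimes>\<^sub>M M i)) = (\<integral>\<^sup>+u. \<integral>\<^sup>+v. f i u v \<partial>M i \<partial>M i)"
    if "i \<in> I" for i
    using sigma_finite_measure.nn_integral_fst[OF sigma_finite measurable[OF that]] by simp
  have row: "(\<lambda>v. f i u v) \<in> borel_measurable (M i)" if "i \<in> I" "u \<in> space (M i)" for i u
    using measurable_compose[OF measurable_Pair1'[OF that(2)] measurable[OF that(1)]] by simp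
  have inner: "(\<lambda>u. \<integral>\<^sup>+v. f i u v \<partial>M i) \<in> borel_measurable (M i)" if "i \<in> I" for i
    using sigma_finite_measure.borel_measurable_nn_integral_fst[OF sigma_finite measurable[OF that]]
    by simp
  have "(\<lambda>z. f i (fst z i) (snd z i)) \<in> borel_measurable (PiM I M \<Otimes>\<^sub>M PiM I M)" if "i \<in> I" for i
  proof -
    have "(\<lambda>z. (fst z i, snd z i)) \<in> PiM I M \<Otimes>\<^sub>M PiM I M \<rightarrow>\<^sub>M M i \<Otimes>\<^sub>M M i"
      using that by measurable
    from measurable_compose[OF this measurable[OF that]] show ?thesis by simp
  qed
  hence "(\<integral>\<^sup>+z. (\<Prod>i\<in>I. f i (fst z i) (snd z i)) \<partial>(PiM I M \<Otimes>\<^sub>M PiM I M))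
      = (\<integral>\<^sup>+x. \<integral>\<^sup>+y. (\<Prod>i\<in>I. f i (x i) (y i)) \<partial>PiM I M \<partial>PiM I M)"
    by (subst M.P.nn_integral_fst[symmetric]) auto
  also have "\<dots> = (\<integral>\<^sup>+x. (\<Prod>i\<in>I. \<integral>\<^sup>+v. f i (x i) v \<partial>M i) \<partial>PiM I M)"
    using \<open>finite I\<close> row
    by (intro nn_integral_cong M.product_nn_integral_prod) (auto simp: space_PiM PiE_iff)
  also have "\<dots> = (\<Prod>i\<in>I. \<integral>\<^sup>+u. \<integral>\<^sup>+v. f i u v \<partial>M i \<partial>M i)"
    using \<open>finite I\<close> inner by (intro M.product_nn_integral_prod)
  finally show ?thesis by (simp add: iterated)
qed

lemma iid_overlap_mgf:
  assumes standardized: "standardized \<pi>" and "n > 0"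
  shows "(\<integral>\<^sup>+z. ennreal (exp (t * real n * dot n (fst z) (snd z))) \<partial>(iid_prior \<pi> n \<Otimes>\<^sub>M iid_prior \<pi> n))
    = product_mgf \<pi> t ^ n"
proof -
  let ?scale = "\<lambda>t. t / sqrt (real n)" and ?X = "iid_prior \<pi> n"
  let ?\<mu> = "distr \<pi> borel ?scale"
  note scale = measurable_standardized_scale[OF standardized]
  interpret \<mu>: prob_space ?\<mu> by (rule prob_space_scaled[OF standardized])
  have pair: "?\<mu> \<Otimes>\<^sub>M ?\<mu> = distr (\<pi> \<Otimes>\<^sub>M \<pi>) (borel \<Otimes>\<^sub>M borel) (\<lambda>(x, y). (?scale x, ?scale y))"
    by (rule pair_measure_distr[OF scale scale \<mu>.sigma_finite_measure_axioms])
  have unscale: "t * real n * (?scale x * ?scale y) = t * (x * y)" for x y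
    using \<open>n > 0\<close> by (simp add: times_divide_times_eq)
  have "(\<integral>\<^sup>+z. ennreal (exp (t * real n * dot n (fst z) (snd z))) \<partial>(?X \<Otimes>\<^sub>M ?X))
      = (\<integral>\<^sup>+z. (\<Prod>j<n. ennreal (exp (t * real n * (fst z j * snd z j)))) \<partial>(?X \<Otimes>\<^sub>M ?X))"
    by (simp add: dot_def sum_distrib_left exp_sum prod_ennreal)
  also have "\<dots> = (\<integral>\<^sup>+z. ennreal (exp (t * real n * (fst z * snd z))) \<partial>(?\<mu> \<Otimes>\<^sub>M ?\<mu>)) ^ n"
    unfolding iid_prior_def
    by (subst nn_integral_pair_PiM_prod) (simp_all add: \<mu>.prob_space_axioms)
  also have "(\<integral>\<^sup>+z. ennreal (exp (t * real n * (fst z * snd z))) \<partial>(?\<mu> \<Otimes>\<^sub>M ?\<mu>)) = product_mgf \<pi> t"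
    unfolding pair product_mgf_def using scale \<open>n > 0\<close>
    by (subst nn_integral_distr) (simp_all add: case_prod_unfold unscale)
  finally show ?thesis .
qed

lemma nn_integral_even_power_le_mgf:
  assumes [measurable]: "R \<in> borel_measurable M" and "s > 0" "K \<ge> 0" "even m"
    and mgf: "\<And>u. \<bar>u\<bar> = s \<Longrightarrow> (\<integral>\<^sup>+x. ennreal (exp (u * R x)) \<partial>M) \<le> ennreal K"
  shows "(\<integral>\<^sup>+x. ennreal (R x ^ m) \<partial>M) \<le> ennreal (2 * (real m / (exp 1 * s)) ^ m * K)"
proof -
  define c where "c = (real m / (exp 1 * s)) ^ m"
  have "c \<ge> 0" using \<open>s > 0\<close> by (simp add: c_def)
  have power_le: "r ^ m \<le> c * exp (s * r) + c * exp ((- s) * r)" for r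
  proof -
    have "s ^ m * r ^ m = (s * \<bar>r\<bar>) ^ m"
      using \<open>even m\<close> by (simp add: power_mult_distrib power_even_abs)
    also have "\<dots> \<le> (real m / exp 1) ^ m * exp (s * \<bar>r\<bar>)"
      using \<open>s > 0\<close> by (intro power_le_exp) simp
    also have "exp (s * \<bar>r\<bar>) \<le> exp (s * r) + exp ((- s) * r)"
      by (cases "r \<ge> 0") (auto simp: abs_if)
    finally have "s ^ m * r ^ m \<le> (real m / exp 1) ^ m * (exp (s * r) + exp ((- s) * r))"
      by (simp add: mult_left_mono)
    thus ?thesis
      using \<open>s > 0\<close> by (simp add: c_def power_divide power_mult_distrib field_simps)
  qed
  have "(\<integral>\<^sup>+x. ennreal (R x ^ m) \<partial>M)
      \<le> (\<integral>\<^sup>+x. ennreal c * ennreal (exp (s * R x)) + ennreal c * ennreal (exp ((- s) * R x)) \<partial>M)"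
    using power_le \<open>c \<ge> 0\<close>
    by (intro nn_integral_mono) (simp add: ennreal_leI flip: ennreal_mult ennreal_plus)
  also have "\<dots> = ennreal c * (\<integral>\<^sup>+x. ennreal (exp (s * R x)) \<partial>M)
      + ennreal c * (\<integral>\<^sup>+x. ennreal (exp ((- s) * R x)) \<partial>M)"
    by (simp add: nn_integral_add nn_integral_cmult)
  also have "\<dots> \<le> ennreal c * ennreal K + ennreal c * ennreal K"
    using \<open>s > 0\<close> by (intro add_mono mult_left_mono mgf) auto
  also have "\<dots> = ennreal (2 * c * K)"
    using \<open>c \<ge> 0\<close> \<open>K \<ge> 0\<close> by (simp flip: ennreal_mult ennreal_plus)
  finally show ?thesis by (simp add: c_def)
qed

lemma iid_overlap_mgf_le:
  assumes standardized: "standardized \<pi>" and bound: "product_mgf_bound \<pi> \<delta> r"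
    and "n > 0" "t \<le> r" "\<bar>u\<bar> = t * real n"
  shows "(\<integral>\<^sup>+z. ennreal (exp (u * dot n (fst z) (snd z))) \<partial>(iid_prior \<pi> n \<Otimes>\<^sub>M iid_prior \<pi> n))
    \<le> ennreal (exp (real n * ((1 + \<delta>) * t\<^sup>2 / 2)))"
proof -
  define v where "v = u / real n"
  have abs_v: "\<bar>v\<bar> = t" using assms by (simp add: v_def abs_divide)
  have v_square: "v\<^sup>2 = t\<^sup>2" by (simp flip: abs_v)
  have "(\<integral>\<^sup>+z. ennreal (exp (u * dot n (fst z) (snd z))) \<partial>(iid_prior \<pi> n \<Otimes>\<^sub>M iid_prior \<pi> n))
      = product_mgf \<pi> v ^ n"
    using iid_overlap_mgf[OF standardized \<open>n > 0\<close>, of v] \<open>n > 0\<close> by (simp add: v_def)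
  also have "\<dots> \<le> ennreal (exp ((1 + \<delta>) * v\<^sup>2 / 2)) ^ n"
    using bound \<open>t \<le> r\<close> abs_v by (intro power_mono) (auto simp: product_mgf_bound_def)
  also have "\<dots> = ennreal (exp (real n * ((1 + \<delta>) * t\<^sup>2 / 2)))"
    unfolding v_square by (simp add: ennreal_power exp_of_nat_mult[symmetric])
  finally show ?thesis .
qed

text \<open>For \<open>\<delta> = 0\<close> this value of \<open>t\<close> minimises the Chernoff bound on the \<open>2 k\<close>-th moment.\<close>

lemma chernoff_bound_at_sqrt:
  fixes t \<delta> :: real
  assumes t_square: "t\<^sup>2 = 2 * real k / real n" and "k > 0" "n > 0"
  shows "(real (2 * k) / (exp 1 * (t * real n))) ^ (2 * k) * exp (real n * ((1 + \<delta>) * t\<^sup>2 / 2))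
    = (2 * real k / (exp 1 * real n) * exp \<delta>) ^ k"
proof -
  let ?e = "exp 1 :: real"
  have "(real (2 * k) / (?e * (t * real n)))\<^sup>2 = (2 * real k)\<^sup>2 / (?e\<^sup>2 * (t\<^sup>2 * (real n)\<^sup>2))"
    by (simp add: power_divide power_mult_distrib)
  also have "\<dots> = 2 * real k / (?e\<^sup>2 * real n)"
    unfolding t_square using \<open>k > 0\<close> \<open>n > 0\<close>
    by (simp add: divide_simps) (simp add: power2_eq_square)
  finally have "(real (2 * k) / (?e * (t * real n))) ^ (2 * k) = (2 * real k / (?e\<^sup>2 * real n)) ^ k"
    unfolding power_mult by (rule arg_cong)
  moreover have "real n * ((1 + \<delta>) * t\<^sup>2 / 2) = real k * (1 + \<delta>)"
    using \<open>n > 0\<close> by (simp add: t_square)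
  hence "exp (real n * ((1 + \<delta>) * t\<^sup>2 / 2)) = (?e * exp \<delta>) ^ k"
    by (simp only: exp_of_nat_mult exp_add)
  ultimately show ?thesis by (simp add: power_mult_distrib power_divide power2_eq_square)
qed

lemma iid_overlap_moment_le:
  assumes standardized: "standardized \<pi>" and bound: "product_mgf_bound \<pi> \<delta> r" and "r \<ge> 0"
    and "n > 0" and k_le: "2 * real k \<le> r\<^sup>2 * real n"
  shows "(\<integral>\<^sup>+z. ennreal (dot n (fst z) (snd z) ^ (2 * k)) \<partial>(iid_prior \<pi> n \<Otimes>\<^sub>M iid_prior \<pi> n))
    \<le> ennreal (2 * (2 * real k / (exp 1 * real n) * exp \<delta>) ^ k)"
proof (cases "k = 0")
  case True
  interpret pair_prob_space "iid_prior \<pi> n" "iid_prior \<pi> n"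
    by (intro pair_prob_spaceI prob_space_iid_prior standardized)
  show ?thesis using True by (simp add: emeasure_space_1)
next
  case False
  define t where "t = sqrt (2 * real k / real n)"
  have "t > 0" and t_square: "t\<^sup>2 = 2 * real k / real n"
    using False \<open>n > 0\<close> by (simp_all add: t_def)
  have "t \<le> r"
    unfolding t_def using \<open>n > 0\<close> \<open>r \<ge> 0\<close> k_le by (intro real_le_lsqrt) (auto simp: divide_le_eq)
  have "(\<integral>\<^sup>+z. ennreal (dot n (fst z) (snd z) ^ (2 * k)) \<partial>(iid_prior \<pi> n \<Otimes>\<^sub>M iid_prior \<pi> n))
      \<le> ennreal (2 * (real (2 * k) / (exp 1 * (t * real n))) ^ (2 * k)
        * exp (real n * ((1 + \<delta>) * t\<^sup>2 / 2)))"
    using \<open>t > 0\<close> \<open>n > 0\<close> \<open>t \<le> r\<close>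
    by (intro nn_integral_even_power_le_mgf iid_overlap_mgf_le[OF standardized bound])
       (simp_all add: measurable_overlap sets_iid_prior)
  also have "2 * (real (2 * k) / (exp 1 * (t * real n))) ^ (2 * k)
        * exp (real n * ((1 + \<delta>) * t\<^sup>2 / 2))
      = 2 * (2 * real k / (exp 1 * real n) * exp \<delta>) ^ k"
    using chernoff_bound_at_sqrt[OF t_square, of \<delta>] False \<open>n > 0\<close> by (simp only: mult.assoc)
  finally show ?thesis .
qed

section \<open>The truncated prior\<close>

definition trunc_map :: "real \<Rightarrow> nat \<Rightarrow> (nat \<Rightarrow> real) \<Rightarrow> nat \<Rightarrow> real" where
  "trunc_map \<beta> n x = (if \<beta> * sqnorm n x > -1 \<and> sqnorm n x \<le> 2 then x else (\<lambda>i\<in>{..<n}. 0))"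

lemma trunc_prior_eq: "trunc_prior \<beta> X n = distr (X n) (Rn n) (trunc_map \<beta> n)"
  by (simp add: trunc_prior_def trunc_map_def[abs_def])

lemma sets_trunc_prior: "sets (trunc_prior \<beta> X n) = sets (Rn n)"
  by (simp add: trunc_prior_eq)

lemma measurable_trunc_map:
  assumes "sets M = sets (Rn n)" shows "trunc_map \<beta> n \<in> M \<rightarrow>\<^sub>M Rn n"
proof -
  have "(\<lambda>i\<in>{..<n}. 0 :: real) \<in> space (Rn n)" by (auto simp: space_PiM)
  hence "trunc_map \<beta> n \<in> Rn n \<rightarrow>\<^sub>M Rn n"
    unfolding trunc_map_def[abs_def] by (intro measurable_If measurable_const) measurable
  thus ?thesis by (simp add: measurable_cong_sets[OF assms refl])
qed

lemma prob_space_trunc_prior: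
  assumes "prob_space (X n)" "sets (X n) = sets (Rn n)"
  shows "prob_space (trunc_prior \<beta> X n)"
  unfolding trunc_prior_eq by (intro prob_space.prob_space_distr measurable_trunc_map assms)

lemma AE_trunc_prior:
  assumes "sets (X n) = sets (Rn n)"
  shows "AE x in trunc_prior \<beta> X n. \<beta> * sqnorm n x > -1 \<and> sqnorm n x \<le> 2"
proof -
  have "sqnorm n (\<lambda>i\<in>{..<n}. 0) = 0" by (simp add: sqnorm_def)
  hence "\<beta> * sqnorm n (trunc_map \<beta> n x) > -1 \<and> sqnorm n (trunc_map \<beta> n x) \<le> 2" for x
    by (auto simp: trunc_map_def)
  thus ?thesis
    unfolding trunc_prior_eq by (subst AE_distr_iff[OF measurable_trunc_map[OF assms]]) auto
qed

lemma spiked_model_trunc_prior: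
  assumes "prob_space (X n)" "sets (X n) = sets (Rn n)"
  shows "spiked_model \<beta> n (trunc_prior \<beta> X n)"
  using AE_trunc_prior[of X n \<beta>, OF assms(2)]
  by (intro spiked_model.intro prob_space_trunc_prior sets_trunc_prior assms) auto

lemma dot_trunc_map_power_le:
  assumes "even m"
  shows "dot n (trunc_map \<beta> n x) (trunc_map \<beta> n y) ^ m \<le> dot n x y ^ m"
proof -
  have "dot n (trunc_map \<beta> n x) (trunc_map \<beta> n y) \<in> {dot n x y, 0}"
    by (auto simp: dot_def trunc_map_def intro!: sum.neutral)
  thus ?thesis using assms by (cases "m = 0") (auto simp: zero_le_even_power power_0_left)
qed

lemma trunc_prior_overlap_moment_le:
  assumes prior: "prob_space (X n)" "sets (X n) = sets (Rn n)" and "even m" "C \<ge> 0"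
    and moment_le: "(\<integral>\<^sup>+z. ennreal (dot n (fst z) (snd z) ^ m) \<partial>(X n \<Otimes>\<^sub>M X n)) \<le> ennreal C"
  shows "overlap_moment n (trunc_prior \<beta> X n) m \<le> C"
proof -
  let ?Y = "trunc_prior \<beta> X n" and ?T = "trunc_map \<beta> n"
  note trunc[measurable] = measurable_trunc_map[OF prior(2), of \<beta>]
  interpret Y: prob_space ?Y by (rule prob_space_trunc_prior[of X n, OF prior])
  have [measurable]: "(\<lambda>z. dot n (fst z) (snd z)) \<in> borel_measurable (Rn n \<Otimes>\<^sub>M Rn n)"
    by (intro measurable_overlap refl)
  have pair: "?Y \<Otimes>\<^sub>M ?Y = distr (X n \<Otimes>\<^sub>M X n) (Rn n \<Otimes>\<^sub>M Rn n) (\<lambda>(x, y). (?T x, ?T y))"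
    using Y.sigma_finite_measure_axioms unfolding trunc_prior_eq
    by (rule pair_measure_distr[OF trunc trunc])
  have "(\<integral>\<^sup>+z. ennreal (dot n (fst z) (snd z) ^ m) \<partial>(?Y \<Otimes>\<^sub>M ?Y))
      = (\<integral>\<^sup>+z. ennreal (dot n (?T (fst z)) (?T (snd z)) ^ m) \<partial>(X n \<Otimes>\<^sub>M X n))"
    unfolding pair by (subst nn_integral_distr) (auto simp: case_prod_unfold)
  also have "\<dots> \<le> (\<integral>\<^sup>+z. ennreal (dot n (fst z) (snd z) ^ m) \<partial>(X n \<Otimes>\<^sub>M X n))"
    by (intro nn_integral_mono ennreal_leI dot_trunc_map_power_le \<open>even m\<close>)
  also note moment_le
  finally have "(\<integral>\<^sup>+z. ennreal (dot n (fst z) (snd z) ^ m) \<partial>(?Y \<Otimes>\<^sub>M ?Y)) \<le> ennreal C" .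
  moreover have "overlap_moment n ?Y m
      = enn2real (\<integral>\<^sup>+z. ennreal (dot n (fst z) (snd z) ^ m) \<partial>(?Y \<Otimes>\<^sub>M ?Y))"
    unfolding overlap_moment_def using \<open>even m\<close>
    by (intro integral_eq_nn_integral borel_measurable_power measurable_overlap sets_trunc_prior)
       (auto simp: zero_le_even_power)
  ultimately show ?thesis using \<open>C \<ge> 0\<close> by (simp add: enn2real_leI)
qed

lemma (in spiked_model) hermite_integrable_planted:
  assumes components: "\<And>j. j < n \<Longrightarrow> all_moments X (\<lambda>x. x j)"
  shows "hermite_integrable N n D planted"
proof -
  have "all_moments X (\<lambda>x. spike_coef \<beta> (sqnorm n x))"
  proof (rule all_moments_bounded[OF joint.M1.finite_measure_axioms _ AE_I2[OF abs_spike_coef_le]])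
    note [measurable_cong] = sets_prior
    show "(\<lambda>x. spike_coef \<beta> (sqnorm n x)) \<in> borel_measurable X" by measurable
  qed
  note prior = joint.all_moments_fst[OF this] joint.all_moments_fst[OF components]
  have null: "all_moments (X \<Otimes>\<^sub>M null) (\<lambda>z. snd z i j)" if "i < N" "j < n" for i j
    using that
    by (intro joint.all_moments_snd[where f="\<lambda>y. y i j"] all_moments_gaussian_samples_component)
  have finite: "finite_measure (X \<Otimes>\<^sub>M null)" by (rule joint.finite_measure_axioms)
  have "all_moments (X \<Otimes>\<^sub>M null) (\<lambda>z. planted_map \<beta> N n (fst z) (snd z) i j)"
    if "i < N" "j < n" for i j
  proof -
    have "all_moments (X \<Otimes>\<^sub>M null) (\<lambda>z. snd z i j
        + spike_coef \<beta> (sqnorm n (fst z)) * dot n (fst z) (snd z i) * fst z j)"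
      unfolding dot_def using that
      by (intro all_moments_add all_moments_mult all_moments_sum finite prior null) auto
    thus ?thesis using that by (simp add: planted_map_def spike_map_def rank_one_map_def)
  qed
  hence "all_moments (X \<Otimes>\<^sub>M null)
      (\<lambda>z. hermite_prod N n \<alpha> (planted_map \<beta> N n (fst z) (snd z)))" for \<alpha>
    by (intro all_moments_hermite_prod finite)
  hence "integrable planted (hermite_prod N n \<alpha>)" for \<alpha>
    unfolding planted_samples_def
    by (subst integrable_distr_eq[OF measurable_planted_map measurable_hermite_prod])
       (simp add: all_moments_integrable case_prod_unfold)
  thus ?thesis by (simp add: hermite_integrable_def)
qed

lemma all_moments_trunc_prior_component:
  assumes prior: "prob_space (X n)" "sets (X n) = sets (Rn n)" and "j < n"
  shows "all_moments (trunc_prior \<beta> X n) (\<lambda>x. x j)"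
proof (rule all_moments_bounded)
  show "finite_measure (trunc_prior \<beta> X n)"
    using prob_space_trunc_prior[of X n, OF prior] by (rule prob_space.finite_measure)
  show "(\<lambda>x. x j) \<in> borel_measurable (trunc_prior \<beta> X n)"
    using measurable_Rn_component[OF \<open>j < n\<close>]
    by (simp add: measurable_cong_sets[OF sets_trunc_prior refl])
  show "AE x in trunc_prior \<beta> X n. \<bar>x j\<bar> \<le> 2"
    using AE_trunc_prior[of X n, OF prior(2)]
  proof eventually_elim
    case (elim x)
    have "(x j)\<^sup>2 \<le> sqnorm n x"
      unfolding sqnorm_def using \<open>j < n\<close> by (intro member_le_sum) auto
    hence "(x j)\<^sup>2 \<le> 2\<^sup>2" using elim by simp
    thus ?case by (simp only: abs_le_square_iff[symmetric])
  qed
qed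

section \<open>The upper bound\<close>

lemma pochhammer_le_power_exp:
  fixes x :: real assumes "x > 0" shows "pochhammer x k \<le> (x * exp (real k / x)) ^ k"
proof -
  have "(\<Prod>i<k. x + real i) \<le> (\<Prod>i<k. x * exp (real k / x))"
  proof (intro prod_mono conjI)
    fix i assume "i \<in> {..<k}"
    hence "x + real i \<le> x * (1 + real k / x)" using \<open>x > 0\<close> by (simp add: field_simps)
    also have "\<dots> \<le> x * exp (real k / x)"
      using \<open>x > 0\<close> by (intro mult_left_mono exp_ge_add_one_self) simp
    finally show "x + real i \<le> x * exp (real k / x)" .
  qed (use assms in auto)
  thus ?thesis by (simp add: pochhammer_prod atLeast0LessThan)
qed

lemma overlap_coef_le:
  assumes "N > 0" "2 * real k / real N \<le> \<delta>"
  shows "overlap_coef \<beta> N k \<le> (\<beta>\<^sup>2 * (real N / 2 * exp \<delta>)) ^ k / fact k"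
proof -
  have "pochhammer (real N / 2) k \<le> (real N / 2 * exp (2 * real k / real N)) ^ k"
    using \<open>N > 0\<close> pochhammer_le_power_exp[of "real N / 2" k] by (simp add: mult.commute)
  also have "\<dots> \<le> (real N / 2 * exp \<delta>) ^ k" using assms by (intro power_mono mult_left_mono) auto
  finally have "overlap_coef \<beta> N k \<le> (\<beta>\<^sup>2) ^ k * ((real N / 2 * exp \<delta>) ^ k / fact k)"
    unfolding overlap_coef_def by (intro mult_left_mono divide_right_mono) auto
  thus ?thesis by (simp only: power_mult_distrib times_divide_eq_right)
qed

lemma trunc_iid_degree_term_le:
  assumes standardized: "standardized \<pi>" and bound: "product_mgf_bound \<pi> \<delta> r" and "r \<ge> 0"
    and "n > 0" "N > 0" and k_le: "2 * real k \<le> r\<^sup>2 * real n" "2 * real k / real N \<le> \<delta>"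
    and ratio_le: "\<beta>\<^sup>2 * (real N / real n) * exp (2 * \<delta>) \<le> \<rho>"
  shows "overlap_coef \<beta> N k * overlap_moment n (trunc_prior \<beta> (iid_prior \<pi>) n) (2 * k) \<le> 2 * \<rho> ^ k"
proof -
  let ?ratio = "\<beta>\<^sup>2 * (real N / real n) * exp (2 * \<delta>)"
  have moment_le: "overlap_moment n (trunc_prior \<beta> (iid_prior \<pi>) n) (2 * k)
      \<le> 2 * (2 * real k / (exp 1 * real n) * exp \<delta>) ^ k"
    using \<open>n > 0\<close>
    by (intro trunc_prior_overlap_moment_le prob_space_iid_prior sets_iid_prior standardized
          iid_overlap_moment_le[OF standardized bound \<open>r \<ge> 0\<close> _ k_le(1)]) auto
  have base: "\<beta>\<^sup>2 * (real N / 2 * exp \<delta>) * (2 * real k / (exp 1 * real n) * exp \<delta>)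
      = ?ratio * (real k / exp 1)"
    using \<open>n > 0\<close> exp_double[of \<delta>] by (simp add: divide_simps power2_eq_square)
  have "overlap_coef \<beta> N k * overlap_moment n (trunc_prior \<beta> (iid_prior \<pi>) n) (2 * k)
      \<le> (\<beta>\<^sup>2 * (real N / 2 * exp \<delta>)) ^ k / fact k
        * (2 * (2 * real k / (exp 1 * real n) * exp \<delta>) ^ k)"
    by (rule order_trans[OF mult_left_mono[OF moment_le overlap_coef_nonneg]
          mult_right_mono[OF overlap_coef_le[OF \<open>N > 0\<close> k_le(2)]]]) simp
  also have "\<dots> = 2 * (?ratio * (real k / exp 1)) ^ k / fact k"
    by (simp only: base[symmetric] power_mult_distrib) simp
  also have "\<dots> = 2 * ?ratio ^ k * (real k ^ k / fact k / exp 1 ^ k)"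
    by (simp only: power_mult_distrib power_divide) (simp add: mult_ac)
  also have "\<dots> \<le> 2 * \<rho> ^ k * 1"
  proof (rule mult_mono)
    show "2 * ?ratio ^ k \<le> 2 * \<rho> ^ k" using power_mono[OF ratio_le] by simp
    show "0 \<le> 2 * \<rho> ^ k" using order_trans[OF _ ratio_le] by simp
    have "real k ^ k / fact k \<le> exp 1 ^ k"
      using power_div_fact_le_exp[of "real k" k] by (simp flip: exp_of_nat_mult)
    thus "real k ^ k / fact k / exp 1 ^ k \<le> 1" by (simp add: divide_le_eq mult.commute)
  qed simp
  finally show ?thesis by simp
qed

lemma low_degree_norm_trunc_le:
  assumes standardized: "standardized \<pi>" and bound: "product_mgf_bound \<pi> \<delta> r" and "r \<ge> 0"
    and "n > 0" "num_samples \<gamma> n > 0"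
    and D_le: "real D \<le> r\<^sup>2 * real n" "real D / real (num_samples \<gamma> n) \<le> \<delta>"
    and ratio_le: "\<beta>\<^sup>2 * (real (num_samples \<gamma> n) / real n) * exp (2 * \<delta>) \<le> \<rho>" and "\<rho> < 1"
  shows "low_degree_norm \<gamma> \<beta> (trunc_prior \<beta> (iid_prior \<pi>)) D n \<le> ennreal (sqrt (2 * (1 / (1 - \<rho>))))"
proof -
  define N where "N = num_samples \<gamma> n"
  let ?X = "trunc_prior \<beta> (iid_prior \<pi>)"
  note iid = prob_space_iid_prior[OF standardized, of n] sets_iid_prior[of \<pi> n]
  interpret spiked_model \<beta> N n "?X n" by (rule spiked_model_trunc_prior[of "iid_prior \<pi>" n, OF iid])
  have hermite: "hermite_integrable N n D planted"
    by (intro hermite_integrable_planted all_moments_trunc_prior_component iid)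
  have "\<rho> \<ge> 0" using order_trans[OF _ ratio_le] by simp
  have "(\<Sum>k\<le>D div 2. overlap_coef \<beta> N k * overlap_moment n (?X n) (2 * k))
      \<le> (\<Sum>k\<le>D div 2. 2 * \<rho> ^ k)"
  proof (intro sum_mono trunc_iid_degree_term_le[OF standardized bound \<open>r \<ge> 0\<close> \<open>n > 0\<close>])
    fix k assume "k \<in> {..D div 2}"
    hence "2 * real k \<le> real D" by simp
    thus "2 * real k \<le> r\<^sup>2 * real n" using D_le(1) by linarith
    have "2 * real k / real N \<le> real D / real N"
      using \<open>2 * real k \<le> real D\<close> by (intro divide_right_mono) auto
    thus "2 * real k / real N \<le> \<delta>" using D_le(2) by (simp add: N_def)
  qed (use assms in \<open>simp_all add: N_def\<close>)
  also have "\<dots> = 2 * (\<Sum>k<Suc (D div 2). \<rho> ^ k)" by (simp only: sum_distrib_left lessThan_Suc_atMost)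
  also have "\<dots> \<le> 2 * (\<Sum>k. \<rho> ^ k)"
    using \<open>\<rho> \<ge> 0\<close> \<open>\<rho> < 1\<close> by (intro mult_left_mono sum_le_suminf) auto
  also have "(\<Sum>k. \<rho> ^ k) = 1 / (1 - \<rho>)"
    using \<open>\<rho> \<ge> 0\<close> \<open>\<rho> < 1\<close> by (intro suminf_geometric) simp
  finally show ?thesis
    using low_degree_norm_eq[where Y="?X", OF _ _ hermite] by (simp add: N_def ennreal_leI)
qed

lemma num_samples_ratio_tendsto:
  assumes "\<gamma> > 0" shows "(\<lambda>n. real (num_samples \<gamma> n) / real n) \<longlonglongrightarrow> 1 / \<gamma>"
proof (rule tendsto_sandwich)
  show "\<forall>\<^sub>F n in sequentially. 1 / \<gamma> \<le> real (num_samples \<gamma> n) / real n"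
    using eventually_gt_at_top[of 0]
    by eventually_elim (use num_samples_ge[OF assms] in \<open>simp add: field_simps\<close>)
  show "\<forall>\<^sub>F n in sequentially. real (num_samples \<gamma> n) / real n \<le> 1 / \<gamma> + 1 / real n"
    using eventually_gt_at_top[of 0]
  proof eventually_elim
    case (elim n)
    have "real n / \<gamma> \<ge> 0" using assms by simp
    hence "real (num_samples \<gamma> n) \<le> real n / \<gamma> + 1" unfolding num_samples_def by linarith
    hence "real (num_samples \<gamma> n) / real n \<le> (real n / \<gamma> + 1) / real n"
      by (intro divide_right_mono) auto
    thus ?case using elim by (simp add: add_divide_distrib)
  qed
  show "(\<lambda>n. 1 / \<gamma> + 1 / real n) \<longlonglongrightarrow> 1 / \<gamma>"
    using tendsto_add[OF tendsto_const lim_const_over_n[of 1]] by simp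
qed simp

lemma smallo_div_ln_imp_eventually_le:
  assumes f_smallo: "f \<in> o(\<lambda>n. real n / ln (real n))" and "\<eta> > 0"
  shows "\<forall>\<^sub>F n in sequentially. \<bar>f n\<bar> \<le> \<eta> * real n"
  using landau_o.smallD[OF f_smallo \<open>\<eta> > 0\<close>] eventually_ge_at_top[of 3]
proof eventually_elim
  case (elim n)
  have "exp 1 \<le> real n" using elim(2) exp_le by linarith
  hence ln_ge: "ln (real n) \<ge> 1" using elim(2) by (simp add: ln_ge_iff)
  hence "real n / ln (real n) \<le> real n / 1" by (intro divide_left_mono) auto
  hence "\<eta> * (real n / ln (real n)) \<le> \<eta> * (real n / 1)"
    using \<open>\<eta> > 0\<close> by (intro mult_left_mono) auto
  thus ?case using elim(1) ln_ge by simp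
qed

lemma ex_mult_exp_less_1:
  fixes c :: real assumes "c < 1"
  shows "\<exists>\<delta>>0. c * exp (2 * \<delta>) < 1"
proof -
  have "((\<lambda>\<delta>. c * exp (2 * \<delta>)) \<longlongrightarrow> c * exp (2 * 0)) (at_right 0)"
    by (intro tendsto_intros)
  hence "\<forall>\<^sub>F \<delta> in at_right 0. c * exp (2 * \<delta>) < 1"
    by (rule order_tendstoD) (use assms in simp)
  with eventually_at_right_less[of 0] show ?thesis
    by (auto dest: eventually_happens[OF eventually_conj])
qed

lemma low_degree_norm_trunc_bounded:
  assumes \<gamma>_pos: "\<gamma> > 0" and "\<beta>\<^sup>2 < \<gamma>" and subgaussian: "subgaussian \<pi>"
    and standardized: "standardized \<pi>" and D: "(\<lambda>n. real (D n)) \<in> o(\<lambda>n. real n / ln (real n))"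
  shows "\<exists>C::real. \<forall>\<^sub>F n in sequentially.
    low_degree_norm \<gamma> \<beta> (trunc_prior \<beta> (iid_prior \<pi>)) (D n) n \<le> ennreal C"
proof -
  obtain \<delta> :: real where "\<delta> > 0" and limit_less_1: "\<beta>\<^sup>2 * (1 / \<gamma>) * exp (2 * \<delta>) < 1"
    using ex_mult_exp_less_1[of "\<beta>\<^sup>2 * (1 / \<gamma>)"] \<open>\<beta>\<^sup>2 < \<gamma>\<close> \<open>\<gamma> > 0\<close> by auto
  from dense[OF limit_less_1] obtain \<rho>
    where limit_less: "\<beta>\<^sup>2 * (1 / \<gamma>) * exp (2 * \<delta>) < \<rho>" and "\<rho> < 1" by blast
  obtain r where "r > 0" and bound: "product_mgf_bound \<pi> \<delta> r"
    using subgaussian_product_mgf_bound[OF subgaussian standardized \<open>\<delta> > 0\<close>] by blast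
  define \<eta> where "\<eta> = min (r\<^sup>2) (\<delta> / \<gamma>)"
  have "\<eta> > 0" using \<open>r > 0\<close> \<open>\<delta> > 0\<close> \<open>\<gamma> > 0\<close> by (simp add: \<eta>_def)
  have "(\<lambda>n. \<beta>\<^sup>2 * (real (num_samples \<gamma> n) / real n) * exp (2 * \<delta>)) \<longlonglongrightarrow> \<beta>\<^sup>2 * (1 / \<gamma>) * exp (2 * \<delta>)"
    by (intro tendsto_mult tendsto_const num_samples_ratio_tendsto[OF \<gamma>_pos])
  hence "\<forall>\<^sub>F n in sequentially. \<beta>\<^sup>2 * (real (num_samples \<gamma> n) / real n) * exp (2 * \<delta>) < \<rho>"
    using limit_less by (rule order_tendstoD)
  hence "\<forall>\<^sub>F n in sequentially. low_degree_norm \<gamma> \<beta> (trunc_prior \<beta> (iid_prior \<pi>)) (D n) n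
      \<le> ennreal (sqrt (2 * (1 / (1 - \<rho>))))"
    using smallo_div_ln_imp_eventually_le[OF D \<open>\<eta> > 0\<close>] eventually_gt_at_top[of 0]
  proof eventually_elim
    case (elim n)
    have D_le: "real (D n) \<le> r\<^sup>2 * real n"
      using elim(2) mult_right_mono[of \<eta> "r\<^sup>2" "real n"] by (simp add: \<eta>_def)
    have "real (D n) / real (num_samples \<gamma> n) \<le> \<eta> * real n / (real n / \<gamma>)"
      using elim num_samples_ge[OF \<gamma>_pos, of n] \<open>\<gamma> > 0\<close> \<open>\<eta> > 0\<close> by (intro frac_le) auto
    also have "\<dots> = \<eta> * \<gamma>" using elim(3) by simp
    also have "\<dots> \<le> \<delta> / \<gamma> * \<gamma>" using \<open>\<gamma> > 0\<close> by (intro mult_right_mono) (auto simp: \<eta>_def)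
    finally have "real (D n) / real (num_samples \<gamma> n) \<le> \<delta>" using \<open>\<gamma> > 0\<close> by simp
    with D_le show ?case
      using elim num_samples_pos[OF \<gamma>_pos] \<open>r > 0\<close> \<open>\<rho> < 1\<close>
      by (intro low_degree_norm_trunc_le[OF standardized bound]) auto
  qed
  thus ?thesis by blast
qed

theorem theorem3p2:
  fixes \<gamma> \<beta> :: real
  assumes "\<gamma> > 0" and "\<beta> > -1"
  shows "(\<beta>\<^sup>2 < \<gamma> \<longrightarrow>
           (\<forall>\<pi> :: real measure. subgaussian \<pi> \<and> standardized \<pi> \<longrightarrow>
             (\<forall>D :: nat \<Rightarrow> nat. (\<lambda>n. real (D n)) \<in> o(\<lambda>n. real n / ln (real n)) \<longrightarrow>
               (\<exists>C :: real. \<forall>\<^sub>F n in sequentially.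
                  low_degree_norm \<gamma> \<beta> (trunc_prior \<beta> (iid_prior \<pi>)) (D n) n \<le> ennreal C)))) \<and>
         (\<beta>\<^sup>2 > \<gamma> \<longrightarrow>
           (\<forall>\<pi> :: real measure. standardized \<pi> \<and> symmetric_about_zero \<pi> \<and>
               beta_good \<beta> (iid_prior \<pi>) \<longrightarrow>
             (\<forall>D :: nat \<Rightarrow> nat. (\<lambda>n. real (D n)) \<in> \<omega>(\<lambda>_. 1) \<longrightarrow>
               (\<lambda>n. low_degree_norm \<gamma> \<beta> (iid_prior \<pi>) (D n) n) \<longlonglongrightarrow> \<infinity>)))"
  using low_degree_norm_trunc_bounded[OF assms(1)] low_degree_norm_iid_tendsto_infinity[OF assms(1)]
  by blast

end
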